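(* Suppose that $\mu_\rho(dx)=\mu_\rho^s(dx)+\psi_\rho(x)\,dx$, where $\mu_\rho^s$ is the singular part (with respect to Lebesgue measure) and $\psi_\rho$ the density of the absolutely continuous part of $\mu_\rho$, and assume that there exists $\eta\in(0,1)$ such that $\log(\psi_\rho)\in L^{1+\eta}([0,2\pi])$. Then $$\lim_{n\to+\infty}\mathbb{E}\left[\frac{\mathcal{N}(f_n,[0,2\pi])}{n}\right]=\frac{2}{\sqrt3}.$$
   Context: Let $\mu_\rho$ be a symmetric probability measure on $[-\pi,\pi]$ (the spectral measure), regarded as a measure on the circle $\mathbb{R}/2\pi\mathbb{Z}$, and let $\rho(k)=\int_{-\pi}^{\pi}e^{-ikx}\,\mu_\rho(dx)$, $k\in\mathbb{Z}$. On a probability space $(\Omega,\mathcal{F},\mathbb{P})$ with expectation $\mathbb{E}$, let $(a_k)_{k\ge1}$ and $(b_k)_{k\ge1}$ be two independent centered stationary Gaussian sequences with $\mathbb{E}[a_ka_\ell]=\mathbb{E}[b_kb_\ell]=\rho(|k-\ell|)$ for $k,\ell\ge1$ (so each variable has variance $\rho(0)=1$). For $n\ge1$ set $f_n(x)=\frac{1}{\sqrt n}\sum_{k=1}^n a_k\cos(kx)+b_k\sin(kx)$. For a function $f$ and an interval $[a,b]$, $\mathcal{N}(f,[a,b])=\#\{t\in[a,b]: f(t)=0\}$. The density $\psi_\rho$ is regarded as a $2\pi$-periodic function. *)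

theory Defs
  imports "HOL-Probability.Probability"
begin

definition symmetric_spectral_measure :: "real measure \<Rightarrow> bool" where
  "symmetric_spectral_measure \<mu> \<longleftrightarrow>
     prob_space \<mu> \<and> sets \<mu> = sets borel \<and> (AE x in \<mu>. x \<in> {-pi..pi}) \<and>
     distr \<mu> borel uminus = \<mu>"

definition spectral_corr :: "real measure \<Rightarrow> int \<Rightarrow> complex" where
  "spectral_corr \<mu> k = (\<integral>x. exp (- \<i> * of_int k * complex_of_real x) \<partial>\<mu>)"

definition lebesgue_singular :: "real measure \<Rightarrow> bool" where
  "lebesgue_singular \<nu> \<longleftrightarrow>
     sets \<nu> = sets borel \<and> (\<exists>N \<in> null_sets lborel. emeasure \<nu> (- N) = 0)"

text \<open>Lebesgue decomposition of a measure carried by \<open>[-\<pi>, \<pi>]\<close>. The density is a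
  \<open>2\<pi>\<close>-periodic function on the whole line, so the absolutely continuous part
  sees it only on the fundamental domain \<open>[-\<pi>, \<pi>]\<close>.\<close>

definition spectral_decomposition ::
    "real measure \<Rightarrow> real measure \<Rightarrow> (real \<Rightarrow> real) \<Rightarrow> bool" where
  "spectral_decomposition \<mu> \<mu>s \<psi> \<longleftrightarrow>
     lebesgue_singular \<mu>s \<and>
     \<psi> \<in> borel_measurable borel \<and> (\<forall>x. 0 \<le> \<psi> x) \<and> (\<forall>x. \<psi> (x + 2 * pi) = \<psi> x) \<and>
     (\<forall>A \<in> sets borel.
        emeasure \<mu> A = emeasure \<mu>s A + (\<integral>\<^sup>+x \<in> A \<inter> {-pi..pi}. ennreal (\<psi> x) \<partial>lborel))"

text \<open>\<open>log g \<in> L\<^sup>p([a,b])\<close> for a nonnegative measurable \<open>g\<close>. Mathematically \<open>log 0 = -\<infinity>\<close>, so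
  membership forces \<open>g > 0\<close> almost everywhere; since HOL sets \<open>ln 0 = 0\<close>, this has to be
  required explicitly.\<close>

definition log_in_Lp :: "(real \<Rightarrow> real) \<Rightarrow> real \<Rightarrow> real \<Rightarrow> real \<Rightarrow> bool" where
  "log_in_Lp g p a b \<longleftrightarrow>
     (AE x in lborel. x \<in> {a..b} \<longrightarrow> 0 < g x) \<and>
     set_integrable lborel {a..b} (\<lambda>x. \<bar>ln (g x)\<bar> powr p)"

text \<open>Gaussian variables may be degenerate (zero variance).\<close>

definition gaussian_rv :: "'a measure \<Rightarrow> ('a \<Rightarrow> real) \<Rightarrow> bool" where
  "gaussian_rv M X \<longleftrightarrow>
     X \<in> borel_measurable M \<and>
     ((\<exists>m. AE \<omega> in M. X \<omega> = m) \<or>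
      (\<exists>m \<sigma>. 0 < \<sigma> \<and> distributed M lborel X (\<lambda>x. ennreal (normal_density m \<sigma> x))))"

definition gaussian_process :: "'a measure \<Rightarrow> 'i set \<Rightarrow> ('i \<Rightarrow> 'a \<Rightarrow> real) \<Rightarrow> bool" where
  "gaussian_process M I X \<longleftrightarrow>
     (\<forall>J c. finite J \<and> J \<subseteq> I \<longrightarrow> gaussian_rv M (\<lambda>\<omega>. \<Sum>j\<in>J. c j * X j \<omega>))"

text \<open>A centered Gaussian sequence indexed by \<open>k \<ge> 1\<close> is stationary iff its covariance
  depends only on \<open>\<bar>k - l\<bar>\<close>. The correlation function is kept complex-valued, as it is
  given by a Fourier integral.\<close>

definition stationary_gaussian_seq ::
    "'a measure \<Rightarrow> (int \<Rightarrow> complex) \<Rightarrow> (nat \<Rightarrow> 'a \<Rightarrow> real) \<Rightarrow> bool" where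
  "stationary_gaussian_seq M r X \<longleftrightarrow>
     gaussian_process M {1..} X \<and>
     (\<forall>k\<ge>1. (\<integral>\<omega>. X k \<omega> \<partial>M) = 0) \<and>
     (\<forall>k\<ge>1. \<forall>l\<ge>1. complex_of_real (\<integral>\<omega>. X k \<omega> * X l \<omega> \<partial>M) = r \<bar>int k - int l\<bar>)"

definition indep_seqs ::
    "'a measure \<Rightarrow> (nat \<Rightarrow> 'a \<Rightarrow> real) \<Rightarrow> (nat \<Rightarrow> 'a \<Rightarrow> real) \<Rightarrow> bool" where
  "indep_seqs M X Y \<longleftrightarrow>
     prob_space.indep_var M
       (\<Pi>\<^sub>M k\<in>{1..}. borel) (\<lambda>\<omega>. \<lambda>k\<in>{1..}. X k \<omega>)
       (\<Pi>\<^sub>M k\<in>{1..}. borel) (\<lambda>\<omega>. \<lambda>k\<in>{1..}. Y k \<omega>)"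

definition random_trig_poly ::
    "(nat \<Rightarrow> 'a \<Rightarrow> real) \<Rightarrow> (nat \<Rightarrow> 'a \<Rightarrow> real) \<Rightarrow> nat \<Rightarrow> 'a \<Rightarrow> real \<Rightarrow> real" where
  "random_trig_poly a b n \<omega> x =
     1 / sqrt (real n) *
       (\<Sum>k=1..n. a k \<omega> * cos (real k * x) + b k \<omega> * sin (real k * x))"

text \<open>The number of zeros is counted in \<open>[0, \<infinity>]\<close>, since \<open>card\<close> is \<open>0\<close> on infinite sets.\<close>

definition num_zeros :: "(real \<Rightarrow> real) \<Rightarrow> real set \<Rightarrow> ennreal" where
  "num_zeros f S = emeasure (count_space UNIV) {t \<in> S. f t = 0}"

end

theory Submission
  imports Defs
begin

text \<open>By the Kac--Rice formula the expected number of zeros of \<open>f\<^sub>n\<close> in an interval is the integral over it of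
  \<open>(n / \<pi>) * sqrt (V / S - (C / S)\<^sup>2)\<close>, where \<open>S\<close>, \<open>n\<^sup>2 V\<close> and \<open>n C\<close> are the variance of \<open>f\<^sub>n(x)\<close>, the
  variance of its derivative and the covariance of the two. All three are convolutions of the spectral
  measure with trigonometric kernels of Fejer type (\<open>moment_kernel\<close>, \<open>cross_kernel\<close>) that concentrate at the
  origin, so one expects \<open>S \<approx> 2 \<pi> \<psi>\<close>, \<open>V \<approx> 2 \<pi> \<psi> / 3\<close> and \<open>C \<approx> 0\<close>. The density of zeros is then close to
  \<open>n / (\<pi> * sqrt 3)\<close>, whose integral over a period is \<open>2 n / sqrt 3\<close>. Two things have to be made precise.
  
  \<^bold>\<open>Typical points.\<close> Only the combinations \<open>C\<close> and \<open>V - c\<^sub>n S\<close> with \<open>c\<^sub>n \<longlonglongrightarrow> 1/3\<close> have to be shown to be small, and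
  both are convolutions with kernels of mean zero. Such a convolution tends to zero in Lebesgue measure
  (\<open>zero_mean_kernel_small\<close>): the density is approximated in \<open>L\<^sup>1\<close> by a continuous function, the singular part by
  its restriction to a compact null set, both of these contribute little away from a small set, and the
  remaining measure has small mass, so that Markov's inequality applies. The statement is uniform over windows
  of length \<open>h = 1 / (4 n)\<close>, the natural scale of \<open>f\<^sub>n\<close>. Since \<open>S' = 2 n C\<close>, the variance is nearly constant in
  a window, and it is enough to know that it is not small at the left end point. Hence the expected
  number of zeros in a typical window is close to \<open>h n / (\<pi> * sqrt 3)\<close> (\<open>window_zeros_good\<close>).
  
  \<^bold>\<open>No zeros escape to exceptional points.\<close> If \<open>f\<^sub>n\<close> has more than \<open>m\<close> zeros in a window, Rolle's theorem bounds
  \<open>f\<^sub>n\<close> there by \<open>h ^ m\<close> times the integral of the modulus of its derivative of order \<open>m + 1\<close>, which is typically of order \<open>4 ^ (- m)\<close>. As \<open>f\<^sub>n(x)\<close>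
  is Gaussian, this is unlikely unless \<open>S(x) < 2 ^ (- m)\<close>. By Jensen's inequality \<open>S \<ge> 2 \<pi> exp (- K\<^sub>n * \<bar>log \<psi>\<bar>)\<close> with
  the Fejer average \<open>K\<^sub>n * \<bar>log \<psi>\<bar>\<close>, so the condition \<open>log \<psi> \<in> L\<^sup>1\<^sup>+\<^sup>\<eta>\<close> makes the Lebesgue measure of
  \<open>{S < 2 ^ (- m)}\<close> of order \<open>m powr (- (1 + \<eta>))\<close> uniformly in \<open>n\<close> (\<open>small_variance_measure\<close>). These bounds are summable
  in \<open>m\<close>, and therefore the expected zero counts of windows are uniformly integrable as functions of the
  window (\<open>window_zeros_uniformly_integrable\<close>).
  
  Averaging over all windows and using periodicity turns the convergence of the window counts into that of the
  total count. The Kac--Rice formula itself (\<open>kac_rice_formula\<close>) is proved for continuously differentiable Gaussian processes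
  whose paths have a bounded number of critical points: Kac's integral \<open>(1 / 2 \<epsilon>) * \<integral> \<bar>f'\<bar> 1\<^bsub>\<bar>f\<bar> < \<epsilon>\<^esub>\<close> converges boundedly to
  the number of zeros, and its expectation is computed by regressing \<open>f'\<close> on \<open>f\<close>.\<close>

section \<open>Many zeros in a short interval force small values\<close>

text \<open>Rolle's theorem between consecutive zeros. The location of the new zeros between the smallest and the
  largest old one is what lets the induction add the zero to the right of \<open>Max Y\<close> without a collision.\<close>

lemma Rolle_card:
  fixes f g :: "real \<Rightarrow> real"
  assumes der: "\<And>x. (f has_real_derivative g x) (at x)"
  shows "finite Z \<Longrightarrow> card Z = Suc p \<Longrightarrow> (\<And>z. z \<in> Z \<Longrightarrow> f z = 0) \<Longrightarrow>
     \<exists>Z'. finite Z' \<and> card Z' = p \<and> Z' \<subseteq> {Min Z..Max Z} \<and> (\<forall>z\<in>Z'. g z = 0)"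
proof (induction p arbitrary: Z)
  case 0
  show ?case by (rule exI[of _ "{}"]) auto
next
  case (Suc p)
  define M where "M = Max Z"
  define Y where "Y = Z - {M}"
  have MZ: "M \<in> Z" using Suc.prems unfolding M_def by (intro Max_in) auto
  have cY: "card Y = Suc p" using Suc.prems MZ unfolding Y_def by simp
  have fY: "finite Y" using Suc.prems unfolding Y_def by simp
  have Yne: "Y \<noteq> {}" using cY by auto
  obtain Z' where Z': "finite Z'" "card Z' = p" "Z' \<subseteq> {Min Y..Max Y}" "\<forall>z\<in>Z'. g z = 0"
    using Suc.IH[OF fY cY] Suc.prems unfolding Y_def by auto
  have MY: "Max Y \<in> Y" using fY Yne by (rule Max_in)
  then have "Max Y \<in> Z" "Max Y \<noteq> M" unfolding Y_def by auto
  then have lt: "Max Y < M" using Suc.prems(1) unfolding M_def by (metis Max_ge order_le_imp_less_or_eq)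
  have "\<exists>z. Max Y < z \<and> z < M \<and> DERIV f z :> 0"
  proof (rule Rolle[OF lt])
    show "f (Max Y) = f M" using Suc.prems(3) MZ \<open>Max Y \<in> Z\<close> by simp
    show "continuous_on {Max Y..M} f" by (intro DERIV_continuous_on) (use der has_field_derivative_at_within in blast)
    show "f differentiable (at x)" for x using der real_differentiable_def by blast
  qed
  then obtain z where z: "Max Y < z" "z < M" "DERIV f z :> 0" by blast
  have gz: "g z = 0" using z(3) der DERIV_unique by blast
  have zn: "z \<notin> Z'" using Z'(3) z(1) by auto
  have mm: "Min Z \<le> Min Y" using Suc.prems(1) Yne by (intro Min_antimono) (auto simp: Y_def)
  have mm2: "Min Y \<le> Max Y" using fY Yne by (meson Max_ge Min_in)
  show ?case
  proof (rule exI[of _ "insert z Z'"], intro conjI)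
    show "card (insert z Z') = Suc p" using Z' zn by simp
    show "insert z Z' \<subseteq> {Min Z..Max Z}" using Z'(3) mm mm2 z lt unfolding M_def[symmetric] by force
  qed (use Z' gz in auto)
qed

lemma Rolle_iterated:
  fixes F :: "nat \<Rightarrow> real \<Rightarrow> real"
  assumes der: "\<And>j x. (F j has_real_derivative F (Suc j) x) (at x)"
    and Z: "finite Z" "card Z = m" "Z \<subseteq> {\<alpha>..\<beta>}" "\<And>z. z \<in> Z \<Longrightarrow> F 0 z = 0"
    and "j \<le> m"
  shows "\<exists>Z'. finite Z' \<and> card Z' = m - j \<and> Z' \<subseteq> {\<alpha>..\<beta>} \<and> (\<forall>z\<in>Z'. F j z = 0)"
  using \<open>j \<le> m\<close>
proof (induction j)
  case 0
  then show ?case using Z by auto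
next
  case (Suc j)
  then obtain Z' where Z': "finite Z'" "card Z' = m - j" "Z' \<subseteq> {\<alpha>..\<beta>}" "\<forall>z\<in>Z'. F j z = 0" by auto
  have c: "card Z' = Suc (m - Suc j)" using Suc.prems Z' by simp
  then have ne: "Z' \<noteq> {}" by auto
  have "Min Z' \<in> Z'" "Max Z' \<in> Z'" using Z'(1) ne by auto
  then have "{Min Z'..Max Z'} \<subseteq> {\<alpha>..\<beta>}" using Z'(3) by auto
  then show ?case using Rolle_card[OF der Z'(1) c] Z'(4) by (smt (verit, ccfv_threshold) subset_trans)
qed

text \<open>By iterated Rolle, each derivative of order at most \<open>m\<close> vanishes somewhere in the interval, so the mean
  value theorem can be applied \<open>m\<close> times, after one integration of the derivative of order \<open>m + 1\<close>.\<close>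

lemma many_zeros_small_value:
  fixes F :: "nat \<Rightarrow> real \<Rightarrow> real"
  assumes der: "\<And>j x. (F j has_real_derivative F (Suc j) x) (at x)"
    and Z: "finite Z" "card Z = Suc m" "Z \<subseteq> {\<alpha>..\<beta>}" "\<And>z. z \<in> Z \<Longrightarrow> F 0 z = 0"
    and x: "x \<in> {\<alpha>..\<beta>}"
  shows "\<bar>F 0 x\<bar> \<le> (\<beta> - \<alpha>) ^ m * integral {\<alpha>..\<beta>} (\<lambda>t. \<bar>F (Suc m) t\<bar>)"
proof -
  define J where "J = integral {\<alpha>..\<beta>} (\<lambda>t. \<bar>F (Suc m) t\<bar>)"
  have cont: "continuous_on A (F j)" for j A
    by (intro DERIV_continuous_on) (use der has_field_derivative_at_within in blast)
  have le: "\<alpha> \<le> \<beta>" using x by auto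
  have zero: "\<exists>z\<in>{\<alpha>..\<beta>}. F j z = 0" if "j \<le> m" for j
  proof -
    have j: "j \<le> Suc m" using that by simp
    have "\<exists>Z'. finite Z' \<and> card Z' = Suc m - j \<and> Z' \<subseteq> {\<alpha>..\<beta>} \<and> (\<forall>z\<in>Z'. F j z = 0)"
      by (rule Rolle_iterated[OF der Z j])
    then obtain Z' where Z': "finite Z'" "card Z' = Suc m - j" "Z' \<subseteq> {\<alpha>..\<beta>}" "\<forall>z\<in>Z'. F j z = 0"
      by (elim exE conjE)
    then have "Z' \<noteq> {}" using that by auto
    then show ?thesis using Z' by blast
  qed
  have incr: "F j y - F j z = integral {z..y} (F (Suc j))" if "z \<le> y" for j y z
    using fundamental_theorem_of_calculus[OF that, of "F j" "F (Suc j)"] der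
    by (metis has_field_derivative_at_within has_real_derivative_iff_has_vector_derivative integral_unique)
  have top: "\<bar>F m y\<bar> \<le> J" if y: "y \<in> {\<alpha>..\<beta>}" for y
  proof -
    obtain z where z: "z \<in> {\<alpha>..\<beta>}" "F m z = 0" using zero[of m] by auto
    define l u where "l = min y z" and "u = max y z"
    have lu: "l \<le> u" "{l..u} \<subseteq> {\<alpha>..\<beta>}" using y z unfolding l_def u_def by auto
    have "\<bar>F m y\<bar> = \<bar>F m u - F m l\<bar>" using z unfolding l_def u_def by (auto simp: min_def max_def)
    also have "\<dots> = norm (integral {l..u} (F (Suc m)))" using incr[OF lu(1)] by simp
    also have "\<dots> \<le> integral {l..u} (\<lambda>t. \<bar>F (Suc m) t\<bar>)"
      by (intro integral_norm_bound_integral integrable_continuous_interval continuous_intros cont) auto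
    also have "\<dots> \<le> J" unfolding J_def
      by (intro integral_subset_le lu integrable_continuous_interval continuous_intros cont) auto
    finally show ?thesis .
  qed
  have "\<forall>y\<in>{\<alpha>..\<beta>}. \<bar>F (m - i) y\<bar> \<le> (\<beta> - \<alpha>) ^ i * J" if "i \<le> m" for i
    using that
  proof (induction i)
    case 0
    then show ?case using top by auto
  next
    case (Suc i)
    show ?case
    proof
      fix y assume y: "y \<in> {\<alpha>..\<beta>}"
      obtain z where z: "z \<in> {\<alpha>..\<beta>}" "F (m - Suc i) z = 0" using zero[of "m - Suc i"] by auto
      have S: "Suc (m - Suc i) = m - i" using Suc.prems by simp
      have "norm (F (m - Suc i) y - F (m - Suc i) z) \<le> ((\<beta> - \<alpha>) ^ i * J) * norm (y - z)"
      proof (rule field_differentiable_bound[of "{\<alpha>..\<beta>}"])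
        show "(F (m - Suc i) has_field_derivative F (m - i) t) (at t within {\<alpha>..\<beta>})" for t
          using der[of "m - Suc i" t] unfolding S by (rule has_field_derivative_at_within)
        show "norm (F (m - i) t) \<le> (\<beta> - \<alpha>) ^ i * J" if "t \<in> {\<alpha>..\<beta>}" for t
          using Suc that by auto
      qed (use y z in auto)
      also have "\<dots> \<le> ((\<beta> - \<alpha>) ^ i * J) * (\<beta> - \<alpha>)"
      proof (rule mult_left_mono)
        show "norm (y - z) \<le> \<beta> - \<alpha>" using y z by auto
        have "0 \<le> J" unfolding J_def by (intro integral_nonneg integrable_continuous_interval continuous_intros cont) auto
        then show "0 \<le> (\<beta> - \<alpha>) ^ i * J" using le by simp
      qed
      finally show "\<bar>F (m - Suc i) y\<bar> \<le> (\<beta> - \<alpha>) ^ Suc i * J" using z by (simp add: mult_ac)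
    qed
  qed
  from this[of m] x show ?thesis unfolding J_def by auto
qed

text \<open>The previous bound in a form suited to second moments: either \<open>F\<close> itself is small, or the square integral of
  its derivative of order \<open>m + 1\<close> is large.\<close>

lemma many_zeros_dichotomy:
  fixes F :: "nat \<Rightarrow> real \<Rightarrow> real"
  assumes der: "\<And>j x. (F j has_real_derivative F (Suc j) x) (at x)"
    and Z: "finite Z" "card Z = Suc m" "Z \<subseteq> {x..x + h}" "\<And>z. z \<in> Z \<Longrightarrow> F 0 z = 0"
    and h: "0 < h" and \<theta>: "0 < \<theta>"
  shows "\<bar>F 0 x\<bar> \<le> \<theta> \<or> ennreal (\<theta>\<^sup>2 / h ^ (2 * m + 1)) \<le> (\<integral>\<^sup>+t. ennreal ((F (Suc m) t)\<^sup>2) * indicator {x..x + h} t \<partial>lborel)"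
proof (rule disjCI)
  define G where "G = F (Suc m)"
  have cont: "continuous_on A G" for A
    unfolding G_def by (intro DERIV_continuous_on) (use der has_field_derivative_at_within in blast)
  have Gm[measurable]: "G \<in> borel_measurable borel" using cont by (rule borel_measurable_continuous_onI)
  assume neg: "\<not> ennreal (\<theta>\<^sup>2 / h ^ (2 * m + 1)) \<le> (\<integral>\<^sup>+t. ennreal ((F (Suc m) t)\<^sup>2) * indicator {x..x + h} t \<partial>lborel)"
  have i2: "(\<lambda>t. (G t)\<^sup>2) integrable_on {x..x + h}" by (intro integrable_continuous_interval continuous_intros cont)
  have i1: "(\<lambda>t. \<bar>G t\<bar>) integrable_on {x..x + h}" by (intro integrable_continuous_interval continuous_intros cont)
  define Q where "Q = integral {x..x + h} (\<lambda>t. (G t)\<^sup>2)"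
  have "((\<lambda>t. if t \<in> {x..x + h} then (G t)\<^sup>2 else 0) has_integral Q) UNIV"
    unfolding Q_def has_integral_restrict_UNIV by (rule integrable_integral[OF i2])
  then have "(\<integral>\<^sup>+t. ennreal (if t \<in> {x..x + h} then (G t)\<^sup>2 else 0) \<partial>lborel) = ennreal Q"
    by (rule nn_integral_has_integral_lborel[rotated 2]) auto
  also have "(\<integral>\<^sup>+t. ennreal (if t \<in> {x..x + h} then (G t)\<^sup>2 else 0) \<partial>lborel) = (\<integral>\<^sup>+t. ennreal ((F (Suc m) t)\<^sup>2) * indicator {x..x + h} t \<partial>lborel)"
    unfolding G_def by (intro nn_integral_cong) (auto simp: indicator_def)
  finally have "\<not> ennreal (\<theta>\<^sup>2 / h ^ (2 * m + 1)) \<le> ennreal Q" using neg by simp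
  then have Q: "Q < \<theta>\<^sup>2 / h ^ (2 * m + 1)" by (meson ennreal_leI not_le)
  \<comment> \<open>the arithmetic-geometric mean inequality with the weight that balances both terms\<close>
  define s where "s = \<theta> / h ^ Suc m"
  have s0: "0 < s" unfolding s_def using h \<theta> by simp
  have "integral {x..x + h} (\<lambda>t. \<bar>G t\<bar>) \<le> integral {x..x + h} (\<lambda>t. s / 2 + (1 / (2 * s)) * (G t)\<^sup>2)"
  proof (rule integral_le[OF i1])
    show "(\<lambda>t. s / 2 + (1 / (2 * s)) * (G t)\<^sup>2) integrable_on {x..x + h}" by (intro integrable_continuous_interval continuous_intros cont)
    fix t
    have "0 \<le> (s - \<bar>G t\<bar>)\<^sup>2" by simp
    then have "2 * s * \<bar>G t\<bar> \<le> s\<^sup>2 + (G t)\<^sup>2" by (simp add: power2_diff algebra_simps)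
    then show "\<bar>G t\<bar> \<le> s / 2 + (1 / (2 * s)) * (G t)\<^sup>2" using s0 by (simp add: field_simps power2_eq_square)
  qed
  also have "\<dots> = h * (s / 2) + (1 / (2 * s)) * Q"
  proof -
    have "((\<lambda>t. s / 2) has_integral h * (s / 2)) {x..x + h}"
      using has_integral_const_real[of "s / 2" x "x + h"] h by simp
    then have "((\<lambda>t. s / 2 + (1 / (2 * s)) * (G t)\<^sup>2) has_integral (h * (s / 2) + (1 / (2 * s)) * Q)) {x..x + h}"
      unfolding Q_def by (intro has_integral_add has_integral_mult_right integrable_integral i2)
    then show ?thesis by (rule integral_unique)
  qed
  also have "(1 / (2 * s)) * Q \<le> (1 / (2 * s)) * (\<theta>\<^sup>2 / h ^ (2 * m + 1))" using Q s0 by (intro mult_left_mono) auto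
  finally have Y: "integral {x..x + h} (\<lambda>t. \<bar>G t\<bar>) \<le> h * (s / 2) + (1 / (2 * s)) * (\<theta>\<^sup>2 / h ^ (2 * m + 1))" by simp
  have bal: "h ^ m * (h * (s / 2) + (1 / (2 * s)) * (\<theta>\<^sup>2 / h ^ (2 * m + 1))) = \<theta>"
  proof -
    have "h ^ (2 * m + 1) = h ^ m * h ^ m * h" by (simp add: power_add mult_2)
    then show ?thesis unfolding s_def using h \<theta> by (simp add: field_simps power2_eq_square)
  qed
  have "\<bar>F 0 x\<bar> \<le> ((x + h) - x) ^ m * integral {x..x + h} (\<lambda>t. \<bar>F (Suc m) t\<bar>)"
    by (rule many_zeros_small_value[OF der Z]) (use h in auto)
  also have "\<dots> \<le> h ^ m * (h * (s / 2) + (1 / (2 * s)) * (\<theta>\<^sup>2 / h ^ (2 * m + 1)))"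
    using Y h unfolding G_def by (simp add: mult_left_mono)
  finally show "\<bar>F 0 x\<bar> \<le> \<theta>" unfolding bal .
qed

text \<open>The number of zeros exceeds \<open>K\<close> by the number of \<open>m \<ge> K\<close> for which there are more than \<open>m\<close> zeros; an infinite
  zero set satisfies all these conditions.\<close>

lemma num_zeros_le_suminf:
  assumes "\<And>m Z. finite Z \<Longrightarrow> card Z = Suc m \<Longrightarrow> Z \<subseteq> S \<Longrightarrow> (\<And>z. z \<in> Z \<Longrightarrow> f z = 0) \<Longrightarrow> E m"
  shows "num_zeros f S \<le> of_nat K + (\<Sum>i. if E (K + i) then 1 else 0)"
proof -
  let ?A = "{t \<in> S. f t = 0}"
  have ev: "E m" if B: "Suc m \<le> card B" "finite B" "B \<subseteq> ?A" for m B
  proof -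
    obtain Z where "Z \<subseteq> B" "card Z = Suc m" "finite Z" using obtain_subset_with_card_n[OF B(1)] by metis
    then show ?thesis using B(3) by (intro assms[of Z m]) auto
  qed
  have le: "of_nat c \<le> of_nat K + (\<Sum>i. if E (K + i) then 1 else (0::ennreal))" if "finite B" "B \<subseteq> ?A" "card B = c" for B c
  proof -
    \<comment> \<open>truncated subtraction covers the case \<open>c < K\<close> as well\<close>
    have "of_nat c \<le> (of_nat K + (\<Sum>i<c - K. 1) :: ennreal)"
      by (simp add: of_nat_add[symmetric] del: of_nat_add)
    also have "(\<Sum>i<c - K. 1) = (\<Sum>i<c - K. if E (K + i) then 1 else (0::ennreal))"
      by (intro sum.cong refl) (use ev[of _ B] that in auto)
    also have "\<dots> \<le> (\<Sum>i. if E (K + i) then 1 else (0::ennreal))" by (rule sum_le_suminf) auto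
    finally show ?thesis by (simp add: add_left_mono)
  qed
  show ?thesis
  proof (cases "finite ?A")
    case True
    then show ?thesis unfolding num_zeros_def using le[OF True] by simp
  next
    case False
    have "E m" for m
    proof -
      obtain B where "B \<subseteq> ?A" "finite B" "card B = Suc m" using infinite_arbitrarily_large[OF False] by metis
      then show ?thesis using ev[of m B] by simp
    qed
    then have "(\<Sum>i. if E (K + i) then 1 else (0::ennreal)) = (\<Sum>i. 1)" by simp
    also have "\<dots> = (SUP n. of_nat n)" by (subst suminf_eq_SUP) simp
    also have "\<dots> = \<infinity>" by (simp add: ennreal_SUP_of_nat_eq_top)
    finally show ?thesis by simp
  qed
qed

section \<open>Kac's integral counts zeros\<close>

text \<open>On a monotone piece of \<open>f\<close> Kac's integral telescopes to the increment of \<open>clip \<epsilon> \<circ> f\<close>.\<close>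

definition clip :: "real \<Rightarrow> real \<Rightarrow> real" where
  "clip \<epsilon> y = max (- \<epsilon>) (min \<epsilon> y)"

definition kac_integral :: "(real \<Rightarrow> real) \<Rightarrow> (real \<Rightarrow> real) \<Rightarrow> real \<Rightarrow> real \<Rightarrow> real \<Rightarrow> ennreal" where
  "kac_integral f g s t \<epsilon> = (\<integral>\<^sup>+x. ennreal (indicator {s..t} x * (\<bar>g x\<bar> * indicator {- \<epsilon><..<\<epsilon>} (f x))) \<partial>lborel)"

text \<open>End points count one half, which makes the count additive under concatenation of intervals.\<close>

definition weighted_zeros :: "(real \<Rightarrow> real) \<Rightarrow> real \<Rightarrow> real \<Rightarrow> real" where
  "weighted_zeros f s t = real (card {x \<in> {s<..<t}. f x = 0}) + (if f s = 0 then 1/2 else 0) + (if f t = 0 then 1/2 else 0)"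

lemma half_sgn_difference:
  fixes u v :: real
  assumes "u < v" "\<not> (u < 0 \<and> 0 < v)"
  shows "real 0 + (if u = 0 then 1/2 else 0) + (if v = 0 then 1/2 else 0) = (sgn v - sgn u) / 2"
proof -
  consider "v < 0" | "v = 0" | "u = 0" | "0 < u" using assms by linarith
  then show ?thesis using assms(1) by cases simp_all
qed

text \<open>On an interval of strict monotonicity the derivative of \<open>clip \<epsilon> \<circ> f\<close> is \<open>f'\<close> where \<open>\<bar>f\<bar> < \<epsilon>\<close> and zero where
  \<open>\<bar>f\<bar> > \<epsilon>\<close>, and there are at most two points with \<open>\<bar>f\<bar> = \<epsilon>\<close>. As \<open>\<epsilon>\<close> tends to zero, \<open>clip \<epsilon> / \<epsilon>\<close> becomes the sign
  function, and half the increment of the sign of \<open>f\<close> is the weighted number of zeros.\<close>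

lemma kac_increasing:
  fixes f g :: "real \<Rightarrow> real"
  assumes der: "\<And>x. (f has_real_derivative g x) (at x)" and gc: "continuous_on UNIV g"
    and st: "s < t" and pos: "\<And>x. s < x \<Longrightarrow> x < t \<Longrightarrow> 0 < g x"
  shows "\<And>\<epsilon>. 0 < \<epsilon> \<Longrightarrow> kac_integral f g s t \<epsilon> = ennreal (clip \<epsilon> (f t) - clip \<epsilon> (f s))"
    and "\<And>\<epsilon>. 0 < \<epsilon> \<Longrightarrow> 0 \<le> clip \<epsilon> (f t) - clip \<epsilon> (f s)"
    and "\<And>\<epsilon>. 0 < \<epsilon> \<Longrightarrow> clip \<epsilon> (f t) - clip \<epsilon> (f s) \<le> 2 * \<epsilon>"
    and "((\<lambda>\<epsilon>. (clip \<epsilon> (f t) - clip \<epsilon> (f s)) / (2 * \<epsilon>)) \<longlongrightarrow> weighted_zeros f s t) (at_right 0)"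
    and "finite {x \<in> {s..t}. f x = 0}"
proof -
  have fc: "continuous_on A f" for A
    by (intro DERIV_continuous_on) (use der has_field_derivative_at_within in blast)
  have mono: "f x < f y" if "s \<le> x" "x < y" "y \<le> t" for x y
  proof (rule DERIV_pos_imp_increasing_open[OF that(2)])
    show "\<exists>d. (f has_real_derivative d) (at z) \<and> 0 < d" if "x < z" "z < y" for z
      using der[of z] pos[of z] that \<open>s \<le> x\<close> \<open>y \<le> t\<close> by (intro exI[of _ "g z"]) auto
    show "continuous_on {x..y} f" by (rule fc)
  qed
  have inj: "inj_on f {s..t}"
    by (rule inj_onI) (metis atLeastAtMost_iff less_irrefl linorder_neqE mono)
  have lev: "finite {x \<in> {s..t}. f x = c}" for c
    using finite_vimage_IntI[of "{c}" f "{s..t}"] inj by (simp add: vimage_def Int_def conj_commute)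
  show "finite {x \<in> {s..t}. f x = 0}" by (rule lev)
  have fst: "f s < f t" using mono st by simp
  show nn: "0 \<le> clip \<epsilon> (f t) - clip \<epsilon> (f s)" and "clip \<epsilon> (f t) - clip \<epsilon> (f s) \<le> 2 * \<epsilon>" if "0 < \<epsilon>" for \<epsilon>
    using fst that unfolding clip_def by auto
  have gm[measurable]: "g \<in> borel_measurable borel" using gc by (rule borel_measurable_continuous_onI)
  have fm[measurable]: "f \<in> borel_measurable borel" using fc by (rule borel_measurable_continuous_onI)
  show "kac_integral f g s t \<epsilon> = ennreal (clip \<epsilon> (f t) - clip \<epsilon> (f s))" if e: "0 < \<epsilon>" for \<epsilon>
  proof -
    define q where "q x = (if x \<in> {s..t} then \<bar>g x\<bar> * indicator {- \<epsilon><..<\<epsilon>} (f x) else 0)" for x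
    have "((\<lambda>x. q x) has_integral (clip \<epsilon> (f t) - clip \<epsilon> (f s))) {s..t}"
    proof (rule fundamental_theorem_of_calculus_interior_strong[where f="\<lambda>x. clip \<epsilon> (f x)" and S="{x\<in>{s..t}. f x = \<epsilon>} \<union> {x\<in>{s..t}. f x = - \<epsilon>}"])
      show "finite ({x \<in> {s..t}. f x = \<epsilon>} \<union> {x \<in> {s..t}. f x = - \<epsilon>})" using lev by blast
      show "s \<le> t" using st by simp
      show "continuous_on {s..t} (\<lambda>x. clip \<epsilon> (f x))" unfolding clip_def by (intro continuous_intros fc)
      fix x assume x: "x \<in> {s<..<t} - ({x \<in> {s..t}. f x = \<epsilon>} \<union> {x \<in> {s..t}. f x = - \<epsilon>})"
      have xs: "s < x" "x < t" using x by auto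
      have fx: "isCont f x" using der DERIV_isCont by blast
      consider "f x < - \<epsilon>" | "- \<epsilon> < f x \<and> f x < \<epsilon>" | "f x > \<epsilon>" using x by fastforce
      then show "((\<lambda>x. clip \<epsilon> (f x)) has_vector_derivative q x) (at x)"
      proof cases
        case 1
        have ev: "\<forall>\<^sub>F y in nhds x. f y < - \<epsilon>"
          using fx 1 unfolding isCont_def eventually_nhds_conv_at by (auto dest: order_tendstoD)
        have "((\<lambda>x. clip \<epsilon> (f x)) has_real_derivative 0) (at x)"
          by (subst DERIV_cong_ev[OF refl _ refl, where g="\<lambda>_. - \<epsilon>"])
            (use ev e in \<open>auto elim!: eventually_mono simp: clip_def\<close>)
        moreover have "q x = 0" using 1 e by (auto simp: q_def)
        ultimately show ?thesis by (simp add: has_real_derivative_iff_has_vector_derivative)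
      next
        case 2
        have ev: "\<forall>\<^sub>F y in nhds x. - \<epsilon> < f y \<and> f y < \<epsilon>"
          using fx 2 unfolding isCont_def eventually_nhds_conv_at by (auto dest: order_tendstoD intro!: eventually_conj)
        have "((\<lambda>x. clip \<epsilon> (f x)) has_real_derivative g x) (at x)"
          by (subst DERIV_cong_ev[OF refl _ refl, where g="f"])
            (use ev e der in \<open>auto elim!: eventually_mono simp: clip_def\<close>)
        moreover have "q x = g x" using 2 e xs pos[of x] by (auto simp: q_def)
        ultimately show ?thesis by (simp add: has_real_derivative_iff_has_vector_derivative)
      next
        case 3
        have ev: "\<forall>\<^sub>F y in nhds x. f y > \<epsilon>"
          using fx 3 unfolding isCont_def eventually_nhds_conv_at by (auto dest: order_tendstoD)
        have "((\<lambda>x. clip \<epsilon> (f x)) has_real_derivative 0) (at x)"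
          by (subst DERIV_cong_ev[OF refl _ refl, where g="\<lambda>_. \<epsilon>"])
            (use ev e in \<open>auto elim!: eventually_mono simp: clip_def\<close>)
        moreover have "q x = 0" using 3 e by (auto simp: q_def)
        ultimately show ?thesis by (simp add: has_real_derivative_iff_has_vector_derivative)
      qed
    qed
    then have "((\<lambda>x. if x \<in> {s..t} then q x else 0) has_integral (clip \<epsilon> (f t) - clip \<epsilon> (f s))) UNIV"
      by (simp only: has_integral_restrict_UNIV)
    also have "(\<lambda>x. if x \<in> {s..t} then q x else 0) = q" by (auto simp: q_def)
    finally have "(q has_integral (clip \<epsilon> (f t) - clip \<epsilon> (f s))) UNIV" .
    then have "(\<integral>\<^sup>+x. ennreal (q x) \<partial>lborel) = ennreal (clip \<epsilon> (f t) - clip \<epsilon> (f s))"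
    proof (rule nn_integral_has_integral_lborel[rotated 2])
      show "q \<in> borel_measurable borel" unfolding q_def by measurable
      show "0 \<le> q x" for x by (simp add: q_def)
    qed
    also have "(\<integral>\<^sup>+x. ennreal (q x) \<partial>lborel) = kac_integral f g s t \<epsilon>"
      unfolding kac_integral_def by (intro nn_integral_cong) (auto simp: q_def indicator_def)
    finally show ?thesis .
  qed
  have sgnlim: "\<forall>\<^sub>F \<epsilon> in at_right 0. clip \<epsilon> y = \<epsilon> * sgn y" for y :: real
  proof -
    have "\<forall>\<^sub>F \<epsilon> in at_right (0::real). \<epsilon> \<in> {0<..<(if y = 0 then 1 else \<bar>y\<bar>)}"
      by (rule eventually_at_right_real) auto
    then show ?thesis by eventually_elim (auto simp: clip_def sgn_if split: if_splits)
  qed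
  have W: "weighted_zeros f s t = (sgn (f t) - sgn (f s)) / 2"
  proof -
    have e1: "{x \<in> {s<..<t}. f x = 0} = {}" if nn: "0 \<le> f s \<or> f t \<le> 0"
    proof -
      have "f s < f x \<and> f x < f t" if "s < x" "x < t" for x using that mono[of s x] mono[of x t] by simp
      then show ?thesis using nn by fastforce
    qed
    have e2: "card {x \<in> {s<..<t}. f x = 0} = 1" if neg: "f s < 0" "0 < f t"
    proof -
      obtain z where z: "s \<le> z" "z \<le> t" "f z = 0" using IVT'[of f s 0 t] neg st fc by auto
      have "s \<noteq> z" using z(3) neg by fastforce
      moreover have "z \<noteq> t" using z(3) neg by fastforce
      ultimately have zst: "s < z" "z < t" using z by simp_all
      have uniq: "x = z" if x: "s < x" "x < t" "f x = 0" for x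
      proof (rule ccontr)
        assume "x \<noteq> z"
        then consider "x < z" | "z < x" by linarith
        then show False using mono[of x z] mono[of z x] z(3) zst x by cases simp_all
      qed
      have "{x \<in> {s<..<t}. f x = 0} = {z}"
      proof (intro equalityI subsetI)
        fix y assume "y \<in> {x \<in> {s<..<t}. f x = 0}"
        then have "s < y" "y < t" "f y = 0" by simp_all
        then have "y = z" by (rule uniq)
        then show "y \<in> {z}" by simp
      qed (use zst z(3) in simp)
      then show ?thesis by simp
    qed
    show ?thesis
    proof (cases "f s < 0 \<and> 0 < f t")
      case True
      then show ?thesis using e2 unfolding weighted_zeros_def by simp
    next
      case False
      then have "{x \<in> {s<..<t}. f x = 0} = {}" using e1 by auto
      then have "weighted_zeros f s t = real 0 + (if f s = 0 then 1/2 else 0) + (if f t = 0 then 1/2 else 0)"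
        by (simp only: weighted_zeros_def card.empty)
      also have "\<dots> = (sgn (f t) - sgn (f s)) / 2"
        by (rule half_sgn_difference[OF fst False])
      finally show ?thesis .
    qed
  qed
  show "((\<lambda>\<epsilon>. (clip \<epsilon> (f t) - clip \<epsilon> (f s)) / (2 * \<epsilon>)) \<longlongrightarrow> weighted_zeros f s t) (at_right 0)"
  proof (rule tendsto_eventually)
    show "\<forall>\<^sub>F \<epsilon> in at_right 0. (clip \<epsilon> (f t) - clip \<epsilon> (f s)) / (2 * \<epsilon>) = weighted_zeros f s t"
      using sgnlim[of "f t"] sgnlim[of "f s"] eventually_at_right_less[of 0]
      by eventually_elim (auto simp: W field_simps)
  qed
qed

text \<open>Induction on the number of critical points, splitting at one of them. Multiple zeros need no special
  treatment: \<open>f\<close> leaves such a zero monotonically on either side, and each side contributes one half.\<close>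

lemma kac_counting:
  fixes f g :: "real \<Rightarrow> real"
  assumes der: "\<And>x. (f has_real_derivative g x) (at x)" and gc: "continuous_on UNIV g"
  shows "s < t \<Longrightarrow> finite {x \<in> {s<..<t}. g x = 0} \<Longrightarrow>
    finite {x \<in> {s..t}. f x = 0} \<and>
    (\<exists>v. (\<forall>\<epsilon>>0. kac_integral f g s t \<epsilon> = ennreal (v \<epsilon>) \<and> 0 \<le> v \<epsilon> \<and>
              v \<epsilon> \<le> 2 * \<epsilon> * real (card {x \<in> {s<..<t}. g x = 0} + 1)) \<and>
         ((\<lambda>\<epsilon>. v \<epsilon> / (2 * \<epsilon>)) \<longlongrightarrow> weighted_zeros f s t) (at_right 0))"
proof (induction "card {x \<in> {s<..<t}. g x = 0}" arbitrary: s t rule: less_induct)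
  case less
  have fc: "continuous_on A f" for A
    by (intro DERIV_continuous_on) (use der has_field_derivative_at_within in blast)
  show ?case
  proof (cases "{x \<in> {s<..<t}. g x = 0} = {}")
    case True
    have sgn: "(\<forall>x. s < x \<and> x < t \<longrightarrow> 0 < g x) \<or> (\<forall>x. s < x \<and> x < t \<longrightarrow> 0 < - g x)"
    proof (rule ccontr)
      assume "\<not> ?thesis"
      then obtain x y where xy: "s < x" "x < t" "s < y" "y < t" "g x \<le> 0" "0 \<le> g y" by (auto simp: not_less)
      have "\<exists>z\<ge>min x y. z \<le> max x y \<and> g z = 0"
        using xy IVT'[of g x 0 y] IVT2'[of g x 0 y] IVT2'[of g y 0 x] continuous_on_subset[OF gc]
        by (cases "x \<le> y") (auto simp: min_def max_def)
      then obtain z where z: "z \<ge> min x y" "z \<le> max x y" "g z = 0" by auto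
      then have "z \<in> {x \<in> {s<..<t}. g x = 0}" using xy by auto
      then show False using True by blast
    qed
    have card0: "card {x \<in> {s<..<t}. g x = 0} = 0" unfolding True by simp
    from sgn show ?thesis
    proof
      assume A: "\<forall>x. s < x \<and> x < t \<longrightarrow> 0 < g x"
      have pos: "\<And>x. s < x \<Longrightarrow> x < t \<Longrightarrow> 0 < g x" using A by blast
      note K = kac_increasing[OF der gc less.prems(1) pos]
      show ?thesis
        by (intro conjI K(5) exI[of _ "\<lambda>\<epsilon>. clip \<epsilon> (f t) - clip \<epsilon> (f s)"] K(4) allI impI)
          (unfold card0, use K(1-3) in auto)
    next
      assume A: "\<forall>x. s < x \<and> x < t \<longrightarrow> 0 < - g x"
      have pos: "\<And>x. s < x \<Longrightarrow> x < t \<Longrightarrow> 0 < - g x" using A by blast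
      have der': "((\<lambda>x. - f x) has_real_derivative - g x) (at x)" for x using der by (rule DERIV_minus)
      have gc': "continuous_on UNIV (\<lambda>x. - g x)" by (intro continuous_intros gc)
      note K = kac_increasing[OF der' gc' less.prems(1) pos]
      have 1: "kac_integral (\<lambda>x. - f x) (\<lambda>x. - g x) s t \<epsilon> = kac_integral f g s t \<epsilon>" for \<epsilon>
        unfolding kac_integral_def by (intro nn_integral_cong) (auto simp: indicator_def)
      have 2: "weighted_zeros (\<lambda>x. - f x) s t = weighted_zeros f s t" unfolding weighted_zeros_def by simp
      show ?thesis
        by (intro conjI exI[of _ "\<lambda>\<epsilon>. clip \<epsilon> (- f t) - clip \<epsilon> (- f s)"] K(4)[unfolded 2] allI impI)
          (unfold card0, use K(1-3)[unfolded 1] K(5) in auto)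
    qed
  next
    case False
    then obtain c where c: "s < c" "c < t" "g c = 0" by auto
    let ?Z = "\<lambda>s t. {x \<in> {s<..<t}. g x = 0}"
    have Zeq: "?Z s t = insert c (?Z s c \<union> ?Z c t)" using c by auto
    have fin: "finite (?Z s c)" "finite (?Z c t)" using less.prems(2) unfolding Zeq by auto
    have card: "card (?Z s t) = Suc (card (?Z s c) + card (?Z c t))"
      unfolding Zeq using fin by (subst card_insert_disjoint) (auto intro!: card_Un_disjoint)
    obtain v where v: "\<forall>\<epsilon>>0. kac_integral f g s c \<epsilon> = ennreal (v \<epsilon>) \<and> 0 \<le> v \<epsilon> \<and> v \<epsilon> \<le> 2 * \<epsilon> * real (card (?Z s c) + 1)"
       "((\<lambda>\<epsilon>. v \<epsilon> / (2 * \<epsilon>)) \<longlongrightarrow> weighted_zeros f s c) (at_right 0)" and f1: "finite {x \<in> {s..c}. f x = 0}"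
      using less.hyps[of s c] c fin card by auto
    obtain w where w: "\<forall>\<epsilon>>0. kac_integral f g c t \<epsilon> = ennreal (w \<epsilon>) \<and> 0 \<le> w \<epsilon> \<and> w \<epsilon> \<le> 2 * \<epsilon> * real (card (?Z c t) + 1)"
       "((\<lambda>\<epsilon>. w \<epsilon> / (2 * \<epsilon>)) \<longlongrightarrow> weighted_zeros f c t) (at_right 0)" and f2: "finite {x \<in> {c..t}. f x = 0}"
      using less.hyps[of c t] c fin card by auto
    have f3: "finite {x \<in> {s..t}. f x = 0}"
      by (rule finite_subset[OF _ finite_UnI[OF f1 f2]]) auto
    have gm[measurable]: "g \<in> borel_measurable borel" using gc by (rule borel_measurable_continuous_onI)
    have fm[measurable]: "f \<in> borel_measurable borel" using fc by (rule borel_measurable_continuous_onI)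
    have K: "kac_integral f g s t \<epsilon> = kac_integral f g s c \<epsilon> + kac_integral f g c t \<epsilon>" for \<epsilon>
    proof -
      have "kac_integral f g s c \<epsilon> + kac_integral f g c t \<epsilon> = (\<integral>\<^sup>+x. ennreal (indicator {s..c} x * (\<bar>g x\<bar> * indicator {- \<epsilon><..<\<epsilon>} (f x)))
          + ennreal (indicator {c..t} x * (\<bar>g x\<bar> * indicator {- \<epsilon><..<\<epsilon>} (f x))) \<partial>lborel)"
        unfolding kac_integral_def by (rule nn_integral_add[symmetric]) measurable
      also have "\<dots> = kac_integral f g s t \<epsilon>" unfolding kac_integral_def
        using AE_lborel_singleton[of c] c
        by (intro nn_integral_cong_AE) (auto elim!: eventually_mono simp: indicator_def)
      finally show ?thesis by simp
    qed
    have W: "weighted_zeros f s t = weighted_zeros f s c + weighted_zeros f c t"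
    proof -
      have eq: "{x \<in> {s<..<t}. f x = 0} = (if f c = 0 then {c} else {}) \<union> ({x \<in> {s<..<c}. f x = 0} \<union> {x \<in> {c<..<t}. f x = 0})"
      proof (rule set_eqI)
        show "x \<in> {x \<in> {s<..<t}. f x = 0} \<longleftrightarrow> x \<in> (if f c = 0 then {c} else {}) \<union> ({x \<in> {s<..<c}. f x = 0} \<union> {x \<in> {c<..<t}. f x = 0})" for x
          using c by (cases x c rule: linorder_cases) auto
      qed
      have "card {x \<in> {s<..<t}. f x = 0} = card (if f c = 0 then {c} else {}) + (card {x \<in> {s<..<c}. f x = 0} + card {x \<in> {c<..<t}. f x = 0})"
        unfolding eq
        by (subst card_Un_disjoint, simp, rule finite_subset[OF _ f3], use c in force, force,
            subst card_Un_disjoint, rule finite_subset[OF _ f1], force, rule finite_subset[OF _ f2], force, force, simp)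
      then show ?thesis unfolding weighted_zeros_def by auto
    qed
    have lim: "((\<lambda>\<epsilon>. (v \<epsilon> + w \<epsilon>) / (2 * \<epsilon>)) \<longlongrightarrow> weighted_zeros f s t) (at_right 0)"
      unfolding W add_divide_distrib by (intro tendsto_add v w)
    have "\<forall>\<epsilon>>0. kac_integral f g s t \<epsilon> = ennreal (v \<epsilon> + w \<epsilon>) \<and> 0 \<le> v \<epsilon> + w \<epsilon> \<and> v \<epsilon> + w \<epsilon> \<le> 2 * \<epsilon> * real (card (?Z s t) + 1)"
    proof (intro allI impI conjI)
      fix \<epsilon> :: real assume e: "0 < \<epsilon>"
      show "kac_integral f g s t \<epsilon> = ennreal (v \<epsilon> + w \<epsilon>)" "0 \<le> v \<epsilon> + w \<epsilon>" unfolding K using v w e by auto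
      have "v \<epsilon> + w \<epsilon> \<le> 2 * \<epsilon> * real (card (?Z s c) + 1) + 2 * \<epsilon> * real (card (?Z c t) + 1)"
        using v w e by (intro add_mono) auto
      then show "v \<epsilon> + w \<epsilon> \<le> 2 * \<epsilon> * real (card (?Z s t) + 1)" unfolding card by (simp add: algebra_simps)
    qed
    then show ?thesis using lim f3 by (intro conjI exI[of _ "\<lambda>\<epsilon>. v \<epsilon> + w \<epsilon>"])
  qed
qed

section \<open>Zeros of trigonometric polynomials\<close>

definition trig_poly :: "(nat \<Rightarrow> real) \<Rightarrow> (nat \<Rightarrow> real) \<Rightarrow> nat \<Rightarrow> real \<Rightarrow> real" where
  "trig_poly A B n x = (\<Sum>k=1..n. A k * cos (real k * x) + B k * sin (real k * x))"

text \<open>Multiplying by \<open>z ^ n\<close> with \<open>z = cis x\<close> gives a polynomial of degree at most \<open>2 * n\<close>, and \<open>cis\<close> is injective on an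
  open interval of length at most a period.\<close>

lemma trig_poly_zeros:
  assumes nz: "j \<in> {1..n}" "A j \<noteq> 0 \<or> B j \<noteq> 0" and st: "t \<le> s + 2 * pi"
  shows "finite {x \<in> {s<..<t}. trig_poly A B n x = 0}"
    and "card {x \<in> {s<..<t}. trig_poly A B n x = 0} \<le> 2 * n"
proof -
  define P :: "complex poly" where
    "P = (\<Sum>k=1..n. monom (Complex (A k) (- B k) / 2) (n + k) + monom (Complex (A k) (B k) / 2) (n - k))"
  have eval: "poly P (cis x) = cis x ^ n * of_real (trig_poly A B n x)" for x
  proof -
    have "Complex (A k) (- B k) / 2 * cis x ^ (n + k) + Complex (A k) (B k) / 2 * cis x ^ (n - k)
        = cis x ^ n * of_real (A k * cos (real k * x) + B k * sin (real k * x))" if k: "k \<in> {1..n}" for k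
    proof -
      have 1: "cis x ^ (n + k) = cis x ^ n * cis (real k * x)"
        using Complex.DeMoivre[of x k] by (simp only: power_add)
      have "cis x ^ n = cis x ^ (n - k) * cis x ^ k"
        using k by (simp flip: power_add)
      then have "cis x ^ n * cis (- (real k * x)) = cis x ^ (n - k) * (cis (real k * x) * cis (- (real k * x)))"
        by (simp only: Complex.DeMoivre[of x k] mult.assoc)
      then have 2: "cis x ^ (n - k) = cis x ^ n * cis (- (real k * x))" by (simp add: cis_mult)
      have 3: "Complex (A k) (- B k) / 2 * cis (real k * x) + Complex (A k) (B k) / 2 * cis (- (real k * x))
          = of_real (A k * cos (real k * x) + B k * sin (real k * x))"
        by (simp add: complex_eq_iff field_simps)
      show ?thesis unfolding 1 2 3[symmetric] by (simp add: algebra_simps)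
    qed
    then show ?thesis
      unfolding P_def trig_poly_def poly_sum of_real_sum sum_distrib_left
      by (intro sum.cong refl) (simp only: poly_monom poly_add)
  qed
  have "coeff P (n + j) = (\<Sum>k=1..n. if k = j then Complex (A k) (- B k) / 2 else 0)"
    unfolding P_def coeff_sum using nz(1) by (intro sum.cong) (auto simp: coeff_monom)
  also have "\<dots> = Complex (A j) (- B j) / 2" using nz(1) by simp
  finally have "coeff P (n + j) \<noteq> 0" using nz(2) by (auto simp: complex_eq_iff)
  then have P0: "P \<noteq> 0" by auto
  have degP: "degree P \<le> 2 * n"
    unfolding P_def
  proof (rule degree_sum_le)
    fix k assume "k \<in> {1..n}"
    then have "n + k \<le> 2 * n" "n - k \<le> 2 * n" by auto
    then show "degree (monom (Complex (A k) (- B k) / 2) (n + k) + monom (Complex (A k) (B k) / 2) (n - k)) \<le> 2 * n"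
      by (intro degree_add_le order_trans[OF degree_monom_le])
  qed simp
  let ?Z = "{x \<in> {s<..<t}. trig_poly A B n x = 0}"
  have inj: "inj_on cis ?Z"
  proof (rule inj_onI)
    fix x y assume xy: "x \<in> ?Z" "y \<in> ?Z" and eq: "cis x = cis y"
    from eq have "sin y = sin x \<and> cos y = cos x" by (simp add: complex_eq_iff)
    then obtain m :: int where m: "y = x + 2 * pi * m" by (auto simp: sin_cos_eq_iff)
    have "\<bar>y - x\<bar> < 2 * pi" using xy st by auto
    then have "2 * pi * \<bar>real_of_int m\<bar> < 2 * pi * 1" using m by (simp add: abs_mult)
    then have "\<bar>real_of_int m\<bar> < 1" by (subst (asm) mult_less_cancel_left_pos) auto
    then have "m = 0" by linarith
    then show "x = y" using m by simp
  qed
  have sub: "cis ` ?Z \<subseteq> {z. poly P z = 0}" by (auto simp: eval)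
  have fin: "finite {z. poly P z = 0}" using P0 by (rule poly_roots_finite)
  show "finite ?Z" using finite_subset[OF sub fin] inj by (rule finite_imageD)
  have "card ?Z = card (cis ` ?Z)" using inj by (simp add: card_image)
  also have "\<dots> \<le> card {z. poly P z = 0}" using sub fin by (rule card_mono[rotated])
  also have "\<dots> \<le> degree P" using P0 by (rule card_poly_roots_bound)
  finally show "card ?Z \<le> 2 * n" using degP by simp
qed

section \<open>Gaussian pairs\<close>

text \<open>The joint law of two centred jointly Gaussian variables (possibly degenerate) with variances \<open>v\<close>, \<open>w\<close> and
  covariance \<open>c\<close>, expressed by the characteristic functions of their linear combinations.\<close>

definition gaussian_pair :: "'a measure \<Rightarrow> ('a \<Rightarrow> real) \<Rightarrow> ('a \<Rightarrow> real) \<Rightarrow> real \<Rightarrow> real \<Rightarrow> real \<Rightarrow> bool" where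
  "gaussian_pair M X Y v c w \<longleftrightarrow> X \<in> borel_measurable M \<and> Y \<in> borel_measurable M \<and>
     (\<forall>\<alpha> \<beta>. (CLINT \<omega>|M. iexp (\<alpha> * X \<omega> + \<beta> * Y \<omega>)) = of_real (exp (- (\<alpha>\<^sup>2 * v + 2 * \<alpha> * \<beta> * c + \<beta>\<^sup>2 * w) / 2)))"

text \<open>Levy's uniqueness theorem applied to the standardised variable.\<close>

lemma (in prob_space) distributed_normal_char:
  assumes X: "X \<in> borel_measurable M" and v: "0 < v"
    and char: "\<And>t. (CLINT \<omega>|M. iexp (t * X \<omega>)) = of_real (exp (- (t\<^sup>2 * v) / 2))"
  shows "distributed M lborel X (normal_density 0 (sqrt v))"
proof -
  have Xs: "(\<lambda>\<omega>. X \<omega> / sqrt v) \<in> borel_measurable M" using X by simp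
  have "distr M borel (\<lambda>\<omega>. X \<omega> / sqrt v) = std_normal_distribution"
  proof (rule Levy_uniqueness)
    show "real_distribution (distr M borel (\<lambda>\<omega>. X \<omega> / sqrt v))" using Xs by simp
    show "real_distribution std_normal_distribution" by (rule real_dist_normal_dist)
    show "char (distr M borel (\<lambda>\<omega>. X \<omega> / sqrt v)) = char std_normal_distribution"
    proof
      fix t
      have "char (distr M borel (\<lambda>\<omega>. X \<omega> / sqrt v)) t = (CLINT \<omega>|M. iexp ((t / sqrt v) * X \<omega>))"
        unfolding char_def using Xs by (subst integral_distr) (auto simp: mult_ac)
      also have "\<dots> = of_real (exp (- (t\<^sup>2) / 2))"
        unfolding char using v by (simp add: power_divide)
      finally show "char (distr M borel (\<lambda>\<omega>. X \<omega> / sqrt v)) t = char std_normal_distribution t"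
        by (simp add: char_std_normal_distribution)
    qed
  qed
  then have "distributed M lborel (\<lambda>\<omega>. (X \<omega> - 0) / sqrt v) std_normal_density"
    unfolding distributed_def using Xs by (simp add: distr_cong[OF refl sets_lborel])
  then show ?thesis using v by (subst normal_standard_normal_convert) auto
qed

lemma (in prob_space) degenerate_char:
  assumes X: "X \<in> borel_measurable M"
    and char: "\<And>t. (CLINT \<omega>|M. iexp (t * X \<omega>)) = 1"
  shows "AE \<omega> in M. X \<omega> = 0"
proof -
  have "distr M borel X = return borel 0"
  proof (rule Levy_uniqueness)
    show "real_distribution (distr M borel X)" using X by simp
    show "real_distribution (return borel (0::real))"
      unfolding real_distribution_def real_distribution_axioms_def by (auto intro!: prob_space_return)
    show "char (distr M borel X) = char (return borel 0)"
    proof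
      fix t
      have "char (distr M borel X) t = 1"
        unfolding char_def using X by (subst integral_distr) (auto simp: char[unfolded of_real_mult])
      moreover have "char (return borel 0) t = 1"
        unfolding char_def by (subst integral_return) auto
      ultimately show "char (distr M borel X) t = char (return borel 0) t" by simp
    qed
  qed
  moreover have "AE x in return borel (0::real). x = 0" by (subst AE_return) auto
  ultimately have "AE x in distr M borel X. x = 0" by (simp only:)
  then show ?thesis using X by (subst (asm) AE_distr_iff) auto
qed

text \<open>Independence of \<open>U\<close> and \<open>W\<close> is derived from the uniqueness theorem on the real line alone. The weight
  \<open>1 + cos (\<beta> * W + \<theta>)\<close> is nonnegative, and after normalisation it does not change the characteristic function
  of \<open>U\<close>; hence it does not change the law of \<open>U\<close>.\<close>

lemma (in prob_space) uncorrelated_weighted_law: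
  assumes P: "gaussian_pair M U W v 0 w" and A: "A \<in> sets borel"
    and m: "m = 1 + exp (- (\<beta>\<^sup>2 * w) / 2) * cos \<theta>" "0 < m"
  shows "(\<integral>\<omega>. (1 + cos (\<beta> * W \<omega> + \<theta>)) * indicator A (U \<omega>) \<partial>M) = m * measure M {\<omega> \<in> space M. U \<omega> \<in> A}"
proof -
  have U[measurable]: "U \<in> borel_measurable M" and W[measurable]: "W \<in> borel_measurable M"
    using P by (auto simp: gaussian_pair_def)
  have A'[measurable]: "A \<in> sets borel" by fact
  have ch: "(CLINT \<omega>|M. iexp (\<alpha> * U \<omega> + \<beta> * W \<omega>)) = of_real (exp (- (\<alpha>\<^sup>2 * v) / 2) * exp (- (\<beta>\<^sup>2 * w) / 2))" for \<alpha> \<beta>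
    using P unfolding gaussian_pair_def by (simp add: exp_add[symmetric] field_simps)
  define q where "q \<omega> = (1 + cos (\<beta> * W \<omega> + \<theta>)) / m" for \<omega>
  have q0: "0 \<le> q \<omega>" for \<omega> using m(2) unfolding q_def by (intro divide_nonneg_pos) (use cos_ge_minus_one[of "\<beta> * W \<omega> + \<theta>"] in linarith)+
  have qm[measurable]: "q \<in> borel_measurable M" unfolding q_def by measurable
  have qb: "\<bar>q \<omega>\<bar> \<le> 2 / m" for \<omega>
  proof -
    have "q \<omega> \<le> 2 / m" unfolding q_def using m(2) cos_le_one[of "\<beta> * W \<omega> + \<theta>"] by (intro divide_right_mono) linarith+
    then show ?thesis using q0[of \<omega>] by simp
  qed
  have qint: "integrable M q" by (rule integrable_const_bound[of _ "2 / m"]) (use qb in auto)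
  have iint: "integrable M (\<lambda>\<omega>. iexp (h \<omega>))" if "h \<in> borel_measurable M" for h :: "'a \<Rightarrow> real"
    using that by (intro integrable_const_bound[of _ 1]) auto
  have key: "(CLINT \<omega>|M. of_real (q \<omega>) * iexp (\<alpha> * U \<omega>)) = of_real (exp (- (\<alpha>\<^sup>2 * v) / 2))" for \<alpha>
  proof -
    have eq: "of_real (q \<omega>) * iexp (\<alpha> * U \<omega>) = (iexp (\<alpha> * U \<omega> + 0 * W \<omega>) + (iexp \<theta> * iexp (\<alpha> * U \<omega> + \<beta> * W \<omega>)
        + iexp (- \<theta>) * iexp (\<alpha> * U \<omega> + (- \<beta>) * W \<omega>)) / 2) / of_real m" for \<omega>
    proof -
      have c: "complex_of_real (cos y) = (iexp y + iexp (- y)) / 2" for y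
        by (simp add: cos_of_real[symmetric] cos_exp_eq)
      show ?thesis unfolding q_def of_real_divide of_real_add c
        by (simp add: exp_add[symmetric] algebra_simps)
    qed
    have "(CLINT \<omega>|M. of_real (q \<omega>) * iexp (\<alpha> * U \<omega>)) =
       (of_real (exp (- (\<alpha>\<^sup>2 * v) / 2) * exp (- (0\<^sup>2 * w) / 2)) + (iexp \<theta> * of_real (exp (- (\<alpha>\<^sup>2 * v) / 2) * exp (- (\<beta>\<^sup>2 * w) / 2))
        + iexp (- \<theta>) * of_real (exp (- (\<alpha>\<^sup>2 * v) / 2) * exp (- ((- \<beta>)\<^sup>2 * w) / 2))) / 2) / of_real m"
    proof -
      note i = iint[of "\<lambda>\<omega>. \<alpha> * U \<omega> + 0 * W \<omega>"] iint[of "\<lambda>\<omega>. \<alpha> * U \<omega> + \<beta> * W \<omega>"] iint[of "\<lambda>\<omega>. \<alpha> * U \<omega> + (- \<beta>) * W \<omega>"]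
      have j: "complex_integrable M (\<lambda>\<omega>. iexp (\<alpha> * U \<omega> + 0 * W \<omega>))"
        "complex_integrable M (\<lambda>\<omega>. iexp \<theta> * iexp (\<alpha> * U \<omega> + \<beta> * W \<omega>))"
        "complex_integrable M (\<lambda>\<omega>. iexp (- \<theta>) * iexp (\<alpha> * U \<omega> + (- \<beta>) * W \<omega>))"
        by (rule i(1), measurable) (intro integrable_mult_right i(2,3), measurable)+
      show ?thesis
        unfolding eq integral_divide_zero ch[symmetric]
        by (subst Bochner_Integration.integral_add, rule j(1), intro integrable_divide Bochner_Integration.integrable_add j,
            subst integral_divide_zero, subst Bochner_Integration.integral_add, rule j(2), rule j(3),
            simp only: integral_mult_right_zero)
    qed
    also have "\<dots> = of_real (exp (- (\<alpha>\<^sup>2 * v) / 2)) * (1 + of_real (exp (- (\<beta>\<^sup>2 * w) / 2)) * ((iexp \<theta> + iexp (- \<theta>)) / 2)) / of_real m"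
      by (simp add: algebra_simps)
    also have "(iexp \<theta> + iexp (- \<theta>)) / 2 = of_real (cos \<theta>)" by (simp add: cos_of_real[symmetric] cos_exp_eq)
    also have "complex_of_real (exp (- (\<alpha>\<^sup>2 * v) / 2)) * (1 + of_real (exp (- (\<beta>\<^sup>2 * w) / 2)) * of_real (cos \<theta>)) / of_real m = of_real (exp (- (\<alpha>\<^sup>2 * v) / 2))"
    proof -
      have "of_real (exp (- (\<alpha>\<^sup>2 * v) / 2)) * (1 + of_real (exp (- (\<beta>\<^sup>2 * w) / 2)) * of_real (cos \<theta>)) / of_real m
          = complex_of_real (exp (- (\<alpha>\<^sup>2 * v) / 2) * m / m)"
        unfolding m(1) by (simp only: of_real_mult of_real_add of_real_divide of_real_1)
      then show ?thesis using m(2) by (simp only: nonzero_mult_div_cancel_right less_imp_neq[symmetric] not_False_eq_True)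
    qed
    finally show ?thesis .
  qed
  \<comment> \<open>under \<open>N\<close> the variable \<open>U\<close> has the same characteristic function as under \<open>M\<close>\<close>
  define N where "N = density M (\<lambda>\<omega>. ennreal (q \<omega>))"
  have one: "(\<integral>\<omega>. q \<omega> \<partial>M) = 1"
  proof -
    have "complex_of_real (\<integral>\<omega>. q \<omega> \<partial>M) = 1" using key[of 0] by simp
    then show ?thesis by simp
  qed
  have PN: "prob_space N"
  proof
    have "emeasure N (space N) = (\<integral>\<^sup>+\<omega>. ennreal (q \<omega>) \<partial>M)" unfolding N_def
      by (simp add: emeasure_density cong: nn_integral_cong_simp)
    also have "\<dots> = 1" using one qint q0 by (subst nn_integral_eq_integral) auto
    finally show "emeasure N (space N) = 1" .
  qed
  have UN[measurable]: "U \<in> borel_measurable N" unfolding N_def by simp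
  have eq: "distr N borel U = distr M borel U"
  proof (rule Levy_uniqueness)
    show "real_distribution (distr N borel U)" using PN UN prob_space.real_distribution_distr by blast
    show "real_distribution (distr M borel U)" by simp
    show "char (distr N borel U) = char (distr M borel U)"
    proof
      fix t
      have "char (distr N borel U) t = (CLINT \<omega>|N. iexp (t * U \<omega>))"
        unfolding char_def by (subst integral_distr) auto
      also have "\<dots> = (CLINT \<omega>|M. q \<omega> *\<^sub>R iexp (t * U \<omega>))"
        unfolding N_def by (subst integral_density) (auto simp: q0)
      also have "\<dots> = of_real (exp (- (t\<^sup>2 * v) / 2))" using key[of t] by (simp add: scaleR_conv_of_real)
      also have "\<dots> = (CLINT \<omega>|M. iexp (t * U \<omega>))" using ch[of t 0] by simp
      also have "\<dots> = char (distr M borel U) t" unfolding char_def by (subst integral_distr) auto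
      finally show "char (distr N borel U) t = char (distr M borel U) t" .
    qed
  qed
  have "(\<integral>x. indicator A x \<partial>distr N borel U) = (\<integral>x. indicator A x \<partial>distr M borel U :: real)" unfolding eq ..
  then have "(\<integral>\<omega>. q \<omega> * indicator A (U \<omega>) \<partial>M) = (\<integral>\<omega>. indicator A (U \<omega>) \<partial>M)"
    by (subst (asm) (1 2) integral_distr) (auto simp: N_def integral_density q0)
  also have "(\<integral>\<omega>. indicator A (U \<omega>) \<partial>M) = (\<integral>\<omega>. indicator {\<omega> \<in> space M. U \<omega> \<in> A} \<omega> \<partial>M :: real)"
    by (intro Bochner_Integration.integral_cong) (auto simp: indicator_def)
  also have "\<dots> = measure M {\<omega> \<in> space M. U \<omega> \<in> A}" by simp
  finally show ?thesis unfolding q_def using m(2) by (simp add: field_simps)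
qed

text \<open>With \<open>\<theta> = 0\<close> and \<open>\<theta> = - \<pi> / 2\<close> the preceding lemma yields the characteristic function of \<open>W\<close> conditioned on
  \<open>U \<in> A\<close>. It is the unconditional one, so conditioning does not change the mean of \<open>\<bar>W\<bar>\<close>.\<close>

lemma (in prob_space) uncorrelated_abs_integral:
  assumes P: "gaussian_pair M U W v 0 w" and A: "A \<in> sets borel"
  shows "(\<integral>\<^sup>+\<omega>. ennreal \<bar>W \<omega>\<bar> * indicator A (U \<omega>) \<partial>M) = ennreal (measure M {\<omega> \<in> space M. U \<omega> \<in> A}) * (\<integral>\<^sup>+\<omega>. ennreal \<bar>W \<omega>\<bar> \<partial>M)"
proof -
  have U[measurable]: "U \<in> borel_measurable M" and W[measurable]: "W \<in> borel_measurable M"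
    using P by (auto simp: gaussian_pair_def)
  have A'[measurable]: "A \<in> sets borel" by fact
  have chW: "(CLINT \<omega>|M. iexp (\<beta> * W \<omega>)) = of_real (exp (- (\<beta>\<^sup>2 * w) / 2))" for \<beta>
  proof -
    have "(CLINT \<omega>|M. iexp (0 * U \<omega> + \<beta> * W \<omega>)) = of_real (exp (- (0\<^sup>2 * v + 2 * 0 * \<beta> * 0 + \<beta>\<^sup>2 * w) / 2))"
      using P unfolding gaussian_pair_def by (elim conjE allE)
    then show ?thesis by simp
  qed
  define p where "p = measure M {\<omega> \<in> space M. U \<omega> \<in> A}"
  have pint: "(\<integral>\<omega>. indicator A (U \<omega>) \<partial>M) = p"
  proof -
    have "(\<integral>\<omega>. indicator A (U \<omega>) \<partial>M) = (\<integral>\<omega>. indicator {\<omega> \<in> space M. U \<omega> \<in> A} \<omega> \<partial>M :: real)"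
      by (intro Bochner_Integration.integral_cong) (auto simp: indicator_def)
    then show ?thesis by (simp add: p_def)
  qed
  have pe: "(\<integral>\<^sup>+\<omega>. indicator A (U \<omega>) \<partial>M) = ennreal p"
  proof -
    have "(\<integral>\<^sup>+\<omega>. indicator A (U \<omega>) \<partial>M) = (\<integral>\<^sup>+\<omega>. indicator {\<omega> \<in> space M. U \<omega> \<in> A} \<omega> \<partial>M)"
      by (intro nn_integral_cong) (auto simp: indicator_def)
    then show ?thesis by (simp add: p_def emeasure_eq_measure)
  qed
  have bint: "integrable M (\<lambda>\<omega>. h (W \<omega>) * indicator A (U \<omega>))" if "h \<in> borel_measurable borel" "\<And>x. \<bar>h x\<bar> \<le> 2" for h :: "real \<Rightarrow> real"
    using that by (intro integrable_const_bound[of _ 2]) (auto simp: indicator_def)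
  have iA: "integrable M (\<lambda>\<omega>. indicator A (U \<omega>) :: real)"
    by (intro integrable_const_bound[of _ 1]) (auto simp: indicator_def)
  have cosA: "(\<integral>\<omega>. cos (\<beta> * W \<omega> + \<theta>) * indicator A (U \<omega>) \<partial>M) = exp (- (\<beta>\<^sup>2 * w) / 2) * cos \<theta> * p"
    if "0 < 1 + exp (- (\<beta>\<^sup>2 * w) / 2) * cos \<theta>" for \<beta> \<theta>
  proof -
    have "integrable M (\<lambda>\<omega>. cos (\<beta> * W \<omega> + \<theta>) * indicator A (U \<omega>))"
      using bint[of "\<lambda>x. cos (\<beta> * x + \<theta>)"] by (simp add: order_trans[OF abs_cos_le_one])
    then have "(\<integral>\<omega>. (1 + cos (\<beta> * W \<omega> + \<theta>)) * indicator A (U \<omega>) \<partial>M) = p + (\<integral>\<omega>. cos (\<beta> * W \<omega> + \<theta>) * indicator A (U \<omega>) \<partial>M)"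
      using iA by (simp add: distrib_right pint)
    then show ?thesis
      using uncorrelated_weighted_law[OF P A refl that] unfolding p_def[symmetric] by (simp add: algebra_simps)
  qed
  show ?thesis
  proof (cases "p = 0")
    case True
    have "AE \<omega> in M. U \<omega> \<notin> A"
    proof -
      have "(\<integral>\<^sup>+\<omega>. indicator A (U \<omega>) \<partial>M) = 0" using pe True by simp
      then have "AE \<omega> in M. indicator A (U \<omega>) = (0::ennreal)" by (subst (asm) nn_integral_0_iff_AE) auto
      then show ?thesis by eventually_elim (auto simp: indicator_def split: if_splits)
    qed
    then have "(\<integral>\<^sup>+\<omega>. ennreal \<bar>W \<omega>\<bar> * indicator A (U \<omega>) \<partial>M) = (\<integral>\<^sup>+\<omega>. 0 \<partial>M)"
      by (intro nn_integral_cong_AE) auto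
    then show ?thesis using True unfolding p_def by simp
  next
    case False
    then have p: "0 < p" unfolding p_def by (simp add: zero_less_measure_iff)
    \<comment> \<open>\<open>M\<close> conditioned on \<open>U \<in> A\<close>\<close>
    define N where "N = density M (\<lambda>\<omega>. ennreal (indicator A (U \<omega>) / p))"
    have PN: "prob_space N"
    proof
      have "emeasure N (space N) = (\<integral>\<^sup>+\<omega>. ennreal (indicator A (U \<omega>) / p) \<partial>M)" unfolding N_def
        by (simp add: emeasure_density cong: nn_integral_cong_simp)
      also have "\<dots> = 1" using p pint iA by (subst nn_integral_eq_integral) auto
      finally show "emeasure N (space N) = 1" .
    qed
    have WN[measurable]: "W \<in> borel_measurable N" unfolding N_def by simp
    have eq: "distr N borel W = distr M borel W"
    proof (rule Levy_uniqueness)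
      show "real_distribution (distr N borel W)" using PN WN prob_space.real_distribution_distr by blast
      show "real_distribution (distr M borel W)" by simp
      show "char (distr N borel W) = char (distr M borel W)"
      proof
        fix t
        have i1: "integrable M (\<lambda>\<omega>. (indicator A (U \<omega>) / p) *\<^sub>R iexp (t * W \<omega>))"
          using p by (intro integrable_const_bound[of _ "1 / p"]) (auto simp: indicator_def)
        have "char (distr N borel W) t = (CLINT \<omega>|N. iexp (t * W \<omega>))"
          unfolding char_def by (subst integral_distr) auto
        also have "\<dots> = (CLINT \<omega>|M. (indicator A (U \<omega>) / p) *\<^sub>R iexp (t * W \<omega>))"
          unfolding N_def using p by (subst integral_density) auto
        also have "\<dots> = of_real (exp (- (t\<^sup>2 * w) / 2))"
        proof (rule complex_eqI)
          have "Re (CLINT \<omega>|M. (indicator A (U \<omega>) / p) *\<^sub>R iexp (t * W \<omega>)) = (\<integral>\<omega>. cos (t * W \<omega> + 0) * indicator A (U \<omega>) / p \<partial>M)"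
            using i1 by (subst integral_Re[symmetric]) (auto simp: Re_exp mult_ac)
          also have "\<dots> = (\<integral>\<omega>. cos (t * W \<omega> + 0) * indicator A (U \<omega>) \<partial>M) / p" by simp
          also have "\<dots> = exp (- (t\<^sup>2 * w) / 2)" using p by (subst cosA) (auto simp: add_pos_pos)
          finally show "Re (CLINT \<omega>|M. (indicator A (U \<omega>) / p) *\<^sub>R iexp (t * W \<omega>)) = Re (of_real (exp (- (t\<^sup>2 * w) / 2)))" by simp
          have "Im (CLINT \<omega>|M. (indicator A (U \<omega>) / p) *\<^sub>R iexp (t * W \<omega>)) = (\<integral>\<omega>. cos (t * W \<omega> + (- (pi / 2))) * indicator A (U \<omega>) / p \<partial>M)"
            using i1 by (subst integral_Im[symmetric]) (auto simp: Im_exp cos_diff mult_ac)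
          also have "\<dots> = (\<integral>\<omega>. cos (t * W \<omega> + (- (pi / 2))) * indicator A (U \<omega>) \<partial>M) / p" by simp
          also have "\<dots> = 0" by (subst cosA) auto
          finally show "Im (CLINT \<omega>|M. (indicator A (U \<omega>) / p) *\<^sub>R iexp (t * W \<omega>)) = Im (of_real (exp (- (t\<^sup>2 * w) / 2)))" by simp
        qed
        also have "\<dots> = char (distr M borel W) t"
          unfolding char_def by (subst integral_distr) (auto simp: chW[unfolded of_real_mult])
        finally show "char (distr N borel W) t = char (distr M borel W) t" .
      qed
    qed
    have "(\<integral>\<^sup>+x. ennreal \<bar>x\<bar> \<partial>distr N borel W) = (\<integral>\<^sup>+x. ennreal \<bar>x\<bar> \<partial>distr M borel W)" unfolding eq ..
    then have "(\<integral>\<^sup>+\<omega>. ennreal \<bar>W \<omega>\<bar> \<partial>N) = (\<integral>\<^sup>+\<omega>. ennreal \<bar>W \<omega>\<bar> \<partial>M)"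
      by (subst (asm) (1 2) nn_integral_distr) auto
    also have "(\<integral>\<^sup>+\<omega>. ennreal \<bar>W \<omega>\<bar> \<partial>N) = (\<integral>\<^sup>+\<omega>. ennreal (1 / p) * (ennreal \<bar>W \<omega>\<bar> * indicator A (U \<omega>)) \<partial>M)"
      unfolding N_def by (subst nn_integral_density) (auto intro!: nn_integral_cong simp: indicator_def)
    also have "\<dots> = ennreal (1 / p) * (\<integral>\<^sup>+\<omega>. ennreal \<bar>W \<omega>\<bar> * indicator A (U \<omega>) \<partial>M)"
      by (rule nn_integral_cmult) measurable
    finally have "ennreal p * (\<integral>\<^sup>+\<omega>. ennreal \<bar>W \<omega>\<bar> \<partial>M) = (ennreal p * ennreal (1 / p)) * (\<integral>\<^sup>+\<omega>. ennreal \<bar>W \<omega>\<bar> * indicator A (U \<omega>) \<partial>M)"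
      by (simp add: mult.assoc)
    also have "ennreal p * ennreal (1 / p) = 1" using p by (simp add: ennreal_mult[symmetric])
    finally show ?thesis unfolding p_def by simp
  qed
qed

text \<open>Linear regression: subtracting the projection on \<open>X\<close> makes the second component uncorrelated with \<open>X\<close>.\<close>

lemma gaussian_pair_regression:
  assumes P: "gaussian_pair M X Y v c w" and v: "v \<noteq> 0"
  shows "gaussian_pair M X (\<lambda>\<omega>. Y \<omega> - c / v * X \<omega>) v 0 (w - c\<^sup>2 / v)"
proof -
  have X[measurable]: "X \<in> borel_measurable M" and Y[measurable]: "Y \<in> borel_measurable M"
    using P by (auto simp: gaussian_pair_def)
  have "(CLINT \<omega>|M. iexp (\<alpha> * X \<omega> + \<beta> * (Y \<omega> - c / v * X \<omega>))) =
     of_real (exp (- (\<alpha>\<^sup>2 * v + 2 * \<alpha> * \<beta> * 0 + \<beta>\<^sup>2 * (w - c\<^sup>2 / v)) / 2))" for \<alpha> \<beta>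
  proof -
    have "\<alpha> * X \<omega> + \<beta> * (Y \<omega> - c / v * X \<omega>) = (\<alpha> - \<beta> * c / v) * X \<omega> + \<beta> * Y \<omega>" for \<omega>
      by (simp add: algebra_simps)
    then have "(CLINT \<omega>|M. iexp (\<alpha> * X \<omega> + \<beta> * (Y \<omega> - c / v * X \<omega>))) = (CLINT \<omega>|M. iexp ((\<alpha> - \<beta> * c / v) * X \<omega> + \<beta> * Y \<omega>))"
      by (simp only:)
    also have "\<dots> = of_real (exp (- ((\<alpha> - \<beta> * c / v)\<^sup>2 * v + 2 * (\<alpha> - \<beta> * c / v) * \<beta> * c + \<beta>\<^sup>2 * w) / 2))"
      using P unfolding gaussian_pair_def by (elim conjE allE)
    also have "(\<alpha> - \<beta> * c / v)\<^sup>2 * v + 2 * (\<alpha> - \<beta> * c / v) * \<beta> * c + \<beta>\<^sup>2 * w = \<alpha>\<^sup>2 * v + 2 * \<alpha> * \<beta> * 0 + \<beta>\<^sup>2 * (w - c\<^sup>2 / v)"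
      using v by (simp add: field_simps power2_eq_square)
    finally show ?thesis .
  qed
  then show ?thesis unfolding gaussian_pair_def by simp
qed

text \<open>The variance parameter is nonnegative because a characteristic function is bounded by one.\<close>

lemma (in prob_space) gaussian_pair_second:
  assumes P: "gaussian_pair M X Y v c w"
  shows "(CLINT \<omega>|M. iexp (t * Y \<omega>)) = of_real (exp (- (t\<^sup>2 * w) / 2))" and "0 \<le> w"
proof -
  have Y[measurable]: "Y \<in> borel_measurable M" using P by (auto simp: gaussian_pair_def)
  show *: "(CLINT \<omega>|M. iexp (t * Y \<omega>)) = of_real (exp (- (t\<^sup>2 * w) / 2))" for t
  proof -
    have "(CLINT \<omega>|M. iexp (0 * X \<omega> + t * Y \<omega>)) = of_real (exp (- (0\<^sup>2 * v + 2 * 0 * t * c + t\<^sup>2 * w) / 2))"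
      using P unfolding gaussian_pair_def by (elim conjE allE)
    then show ?thesis by simp
  qed
  have "norm (CLINT \<omega>|M. iexp (1 * Y \<omega>)) \<le> (\<integral>\<omega>. norm (iexp (1 * Y \<omega>)) \<partial>M)" by (rule integral_norm_bound)
  also have "\<dots> = 1" by (simp add: prob_space)
  finally have "exp (- w / 2) \<le> 1" unfolding * by simp
  then show "0 \<le> w" by simp
qed

lemma (in prob_space) gaussian_pair_first:
  assumes P: "gaussian_pair M X Y v c w"
  shows "(CLINT \<omega>|M. iexp (t * X \<omega>)) = of_real (exp (- (t\<^sup>2 * v) / 2))"
proof -
  have "(CLINT \<omega>|M. iexp (t * X \<omega> + 0 * Y \<omega>)) = of_real (exp (- (t\<^sup>2 * v + 2 * t * 0 * c + 0\<^sup>2 * w) / 2))"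
    using P unfolding gaussian_pair_def by (elim conjE allE)
  then show ?thesis by simp
qed

lemma (in prob_space) gaussian_abs_moment:
  assumes W: "W \<in> borel_measurable M" and w: "0 \<le> w"
    and char: "\<And>t. (CLINT \<omega>|M. iexp (t * W \<omega>)) = of_real (exp (- (t\<^sup>2 * w) / 2))"
  shows "(\<integral>\<^sup>+\<omega>. ennreal \<bar>W \<omega>\<bar> \<partial>M) = ennreal (sqrt (2 / pi) * sqrt w)"
proof (cases "w = 0")
  case True
  have "AE \<omega> in M. W \<omega> = 0" by (rule degenerate_char[OF W]) (use char True in simp)
  then have "(\<integral>\<^sup>+\<omega>. ennreal \<bar>W \<omega>\<bar> \<partial>M) = (\<integral>\<^sup>+\<omega>. 0 \<partial>M)" by (intro nn_integral_cong_AE) auto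
  then show ?thesis using True by simp
next
  case False
  then have w: "0 < w" using w by simp
  have D: "distributed M lborel W (normal_density 0 (sqrt w))" by (rule distributed_normal_char[OF W w char])
  have h: "has_bochner_integral lborel (\<lambda>x. normal_density 0 (sqrt w) x * \<bar>x\<bar>) (sqrt w * sqrt (2 / pi))"
    using normal_moment_abs_odd[where \<mu>=0 and \<sigma>="sqrt w" and k=0] w by simp
  have "(\<integral>\<^sup>+\<omega>. ennreal \<bar>W \<omega>\<bar> \<partial>M) = (\<integral>\<^sup>+x. ennreal (normal_density 0 (sqrt w) x) * ennreal \<bar>x\<bar> \<partial>lborel)"
    by (rule distributed_nn_integral[OF D, symmetric]) measurable
  also have "\<dots> = (\<integral>\<^sup>+x. ennreal (normal_density 0 (sqrt w) x * \<bar>x\<bar>) \<partial>lborel)"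
    by (simp add: ennreal_mult')
  also have "\<dots> = ennreal (sqrt w * sqrt (2 / pi))"
    using h by (subst nn_integral_eq_integral) (auto simp: has_bochner_integral_iff)
  finally show ?thesis by (simp add: mult.commute)
qed

lemma (in prob_space) gaussian_second_moment:
  assumes W: "W \<in> borel_measurable M" and w: "0 \<le> w"
    and char: "\<And>t. (CLINT \<omega>|M. iexp (t * W \<omega>)) = of_real (exp (- (t\<^sup>2 * w) / 2))"
  shows "(\<integral>\<^sup>+\<omega>. ennreal ((W \<omega>)\<^sup>2) \<partial>M) = ennreal w"
proof (cases "w = 0")
  case True
  have "AE \<omega> in M. W \<omega> = 0" by (rule degenerate_char[OF W]) (use char True in simp)
  then have "(\<integral>\<^sup>+\<omega>. ennreal ((W \<omega>)\<^sup>2) \<partial>M) = (\<integral>\<^sup>+\<omega>. 0 \<partial>M)" by (intro nn_integral_cong_AE) auto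
  then show ?thesis using True by simp
next
  case False
  then have w: "0 < w" using w by simp
  have D: "distributed M lborel W (normal_density 0 (sqrt w))" by (rule distributed_normal_char[OF W w char])
  have h: "has_bochner_integral lborel (\<lambda>x. normal_density 0 (sqrt w) x * x\<^sup>2) w"
    using normal_moment_even[where \<mu>=0 and \<sigma>="sqrt w" and k=1] w by simp
  have "(\<integral>\<^sup>+\<omega>. ennreal ((W \<omega>)\<^sup>2) \<partial>M) = (\<integral>\<^sup>+x. ennreal (normal_density 0 (sqrt w) x) * ennreal (x\<^sup>2) \<partial>lborel)"
    by (rule distributed_nn_integral[OF D, symmetric]) measurable
  also have "\<dots> = (\<integral>\<^sup>+x. ennreal (normal_density 0 (sqrt w) x * x\<^sup>2) \<partial>lborel)"
    by (simp add: ennreal_mult')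
  also have "\<dots> = ennreal w"
    using h by (subst nn_integral_eq_integral) (auto simp: has_bochner_integral_iff)
  finally show ?thesis .
qed

lemma (in prob_space) gaussian_small_ball:
  assumes X: "X \<in> borel_measurable M" and v: "0 < v"
    and char: "\<And>t. (CLINT \<omega>|M. iexp (t * X \<omega>)) = of_real (exp (- (t\<^sup>2 * v) / 2))" and e: "0 \<le> \<epsilon>"
  shows "prob {\<omega> \<in> space M. \<bar>X \<omega>\<bar> \<le> \<epsilon>} \<le> 2 * \<epsilon> * normal_density 0 (sqrt v) 0"
    and "2 * \<epsilon> * normal_density 0 (sqrt v) \<epsilon> \<le> prob {\<omega> \<in> space M. \<bar>X \<omega>\<bar> < \<epsilon>}"
proof -
  have Xm[measurable]: "X \<in> borel_measurable M" by fact
  have D: "distributed M lborel X (normal_density 0 (sqrt v))" by (rule distributed_normal_char[OF X v char])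
  have le0: "normal_density 0 (sqrt v) x \<le> normal_density 0 (sqrt v) 0" for x
    unfolding normal_density_def using v by (intro mult_left_mono) auto
  have lee: "normal_density 0 (sqrt v) \<epsilon> \<le> normal_density 0 (sqrt v) x" if "\<bar>x\<bar> < \<epsilon>" for x
    unfolding normal_density_def using v that abs_le_square_iff[of x \<epsilon>] e
    by (intro mult_left_mono) (auto intro!: divide_right_mono)
  have "emeasure M (X -` {-\<epsilon>..\<epsilon>} \<inter> space M) = (\<integral>\<^sup>+x. ennreal (normal_density 0 (sqrt v) x) * indicator {-\<epsilon>..\<epsilon>} x \<partial>lborel)"
    by (rule distributed_emeasure[OF D]) auto
  also have "\<dots> \<le> (\<integral>\<^sup>+x. ennreal (normal_density 0 (sqrt v) 0) * indicator {-\<epsilon>..\<epsilon>} x \<partial>lborel)"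
    by (intro nn_integral_mono mult_right_mono ennreal_leI le0) auto
  also have "\<dots> = ennreal (2 * \<epsilon> * normal_density 0 (sqrt v) 0)"
    using e by (simp add: nn_integral_cmult_indicator ennreal_mult'[symmetric] mult.commute)
  also have "X -` {-\<epsilon>..\<epsilon>} \<inter> space M = {\<omega> \<in> space M. \<bar>X \<omega>\<bar> \<le> \<epsilon>}" by (auto simp: abs_le_iff)
  finally show "prob {\<omega> \<in> space M. \<bar>X \<omega>\<bar> \<le> \<epsilon>} \<le> 2 * \<epsilon> * normal_density 0 (sqrt v) 0"
    using e by (simp add: emeasure_eq_measure)
  have "emeasure M (X -` {-\<epsilon><..<\<epsilon>} \<inter> space M) = (\<integral>\<^sup>+x. ennreal (normal_density 0 (sqrt v) x) * indicator {-\<epsilon><..<\<epsilon>} x \<partial>lborel)"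
    by (rule distributed_emeasure[OF D]) auto
  moreover have "(\<integral>\<^sup>+x. ennreal (normal_density 0 (sqrt v) \<epsilon>) * indicator {-\<epsilon><..<\<epsilon>} x \<partial>lborel) \<le> \<dots>"
    by (intro nn_integral_mono) (auto simp: indicator_def intro!: ennreal_leI lee)
  moreover have "(\<integral>\<^sup>+x. ennreal (normal_density 0 (sqrt v) \<epsilon>) * indicator {-\<epsilon><..<\<epsilon>} x \<partial>lborel) = ennreal (2 * \<epsilon> * normal_density 0 (sqrt v) \<epsilon>)"
    using e by (simp add: nn_integral_cmult_indicator ennreal_mult'[symmetric] mult.commute)
  moreover have "X -` {-\<epsilon><..<\<epsilon>} \<inter> space M = {\<omega> \<in> space M. \<bar>X \<omega>\<bar> < \<epsilon>}" by auto
  ultimately have "ennreal (2 * \<epsilon> * normal_density 0 (sqrt v) \<epsilon>) \<le> ennreal (prob {\<omega> \<in> space M. \<bar>X \<omega>\<bar> < \<epsilon>})"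
    by (simp only: emeasure_eq_measure)
  then show "2 * \<epsilon> * normal_density 0 (sqrt v) \<epsilon> \<le> prob {\<omega> \<in> space M. \<bar>X \<omega>\<bar> < \<epsilon>}"
    by (subst (asm) ennreal_le_iff) simp_all
qed

section \<open>The Kac--Rice formula\<close>

text \<open>Write \<open>Y = W + (c / v) * X\<close> with \<open>W\<close> independent of \<open>X\<close>. On \<open>\<bar>X\<bar> < \<epsilon>\<close> the second term is of order \<open>\<epsilon>\<close>, so \<open>J \<epsilon>\<close> is
  close to the mean of \<open>\<bar>W\<bar>\<close> times the probability of \<open>\<bar>X\<bar> < \<epsilon>\<close> divided by \<open>2 * \<epsilon>\<close>, and the latter tends to the
  density of \<open>X\<close> at zero.\<close>

lemma (in prob_space) kac_rice_density:
  fixes X Y :: "'a \<Rightarrow> real"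
  assumes P: "gaussian_pair M X Y v c w" and v: "0 < v"
  defines "J \<equiv> \<lambda>\<epsilon>. (\<integral>\<^sup>+\<omega>. ennreal (\<bar>Y \<omega>\<bar> * indicator {-\<epsilon><..<\<epsilon>} (X \<omega>)) \<partial>M) / ennreal (2 * \<epsilon>)"
  shows "c\<^sup>2 / v \<le> w"
    and "\<And>\<epsilon>. 0 < \<epsilon> \<Longrightarrow> \<epsilon> \<le> 1 \<Longrightarrow> J \<epsilon> \<le> ennreal ((sqrt (2 / pi) * sqrt (w - c\<^sup>2 / v) + \<bar>c / v\<bar>) / sqrt (2 * pi * v))"
    and "(J \<longlongrightarrow> ennreal (sqrt (w / v - (c / v)\<^sup>2) / pi)) (at_right 0)"
proof -
  have X[measurable]: "X \<in> borel_measurable M" and Y[measurable]: "Y \<in> borel_measurable M"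
    using P by (auto simp: gaussian_pair_def)
  define r where "r = c / v"
  define W where "W \<omega> = Y \<omega> - r * X \<omega>" for \<omega>
  define k where "k = sqrt (2 / pi) * sqrt (w - c\<^sup>2 / v)"
  define d where "d = normal_density 0 (sqrt v)"
  have PW: "gaussian_pair M X W v 0 (w - c\<^sup>2 / v)"
    unfolding W_def r_def using gaussian_pair_regression[OF P] v by simp
  have W[measurable]: "W \<in> borel_measurable M" unfolding W_def by measurable
  show cw: "c\<^sup>2 / v \<le> w" using gaussian_pair_second(2)[OF PW] by simp
  have k0: "0 \<le> k" unfolding k_def using cw by simp
  have EW: "(\<integral>\<^sup>+\<omega>. ennreal \<bar>W \<omega>\<bar> \<partial>M) = ennreal k"
    unfolding k_def by (rule gaussian_abs_moment[OF W gaussian_pair_second(2)[OF PW] gaussian_pair_second(1)[OF PW]])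
  define p where "p \<epsilon> = prob {\<omega> \<in> space M. X \<omega> \<in> {-\<epsilon><..<\<epsilon>}}" for \<epsilon>
  have WA: "(\<integral>\<^sup>+\<omega>. ennreal \<bar>W \<omega>\<bar> * indicator {-\<epsilon><..<\<epsilon>} (X \<omega>) \<partial>M) = ennreal (p \<epsilon> * k)" for \<epsilon>
    using uncorrelated_abs_integral[OF PW, of "{-\<epsilon><..<\<epsilon>}"] k0 unfolding EW p_def by (simp add: ennreal_mult')
  have PA: "(\<integral>\<^sup>+\<omega>. ennreal a * indicator {-\<epsilon><..<\<epsilon>} (X \<omega>) \<partial>M) = ennreal (a * p \<epsilon>)" if "0 \<le> a" for a \<epsilon>
  proof -
    have "(\<integral>\<^sup>+\<omega>. ennreal a * indicator {-\<epsilon><..<\<epsilon>} (X \<omega>) \<partial>M) = (\<integral>\<^sup>+\<omega>. ennreal a * indicator {\<omega> \<in> space M. X \<omega> \<in> {-\<epsilon><..<\<epsilon>}} \<omega> \<partial>M)"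
      by (intro nn_integral_cong) (auto simp: indicator_def)
    also have "\<dots> = ennreal a * emeasure M {\<omega> \<in> space M. X \<omega> \<in> {-\<epsilon><..<\<epsilon>}}" by (rule nn_integral_cmult_indicator) measurable
    finally show ?thesis using that by (simp add: p_def emeasure_eq_measure ennreal_mult')
  qed
  define I where "I \<epsilon> = (\<integral>\<^sup>+\<omega>. ennreal (\<bar>Y \<omega>\<bar> * indicator {-\<epsilon><..<\<epsilon>} (X \<omega>)) \<partial>M)" for \<epsilon>
  have up: "I \<epsilon> \<le> ennreal ((k + \<bar>r\<bar> * \<epsilon>) * p \<epsilon>)" if e: "0 < \<epsilon>" for \<epsilon>
  proof -
    have "I \<epsilon> \<le> (\<integral>\<^sup>+\<omega>. ennreal \<bar>W \<omega>\<bar> * indicator {-\<epsilon><..<\<epsilon>} (X \<omega>) + ennreal (\<bar>r\<bar> * \<epsilon>) * indicator {-\<epsilon><..<\<epsilon>} (X \<omega>) \<partial>M)"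
      unfolding I_def
    proof (intro nn_integral_mono)
      fix \<omega>
      have "\<bar>Y \<omega>\<bar> \<le> \<bar>W \<omega>\<bar> + \<bar>r\<bar> * \<epsilon>" if "\<bar>X \<omega>\<bar> < \<epsilon>"
      proof -
        have "\<bar>Y \<omega>\<bar> \<le> \<bar>W \<omega>\<bar> + \<bar>r\<bar> * \<bar>X \<omega>\<bar>" unfolding W_def abs_mult[symmetric] by linarith
        also have "\<bar>r\<bar> * \<bar>X \<omega>\<bar> \<le> \<bar>r\<bar> * \<epsilon>" using that by (intro mult_left_mono) auto
        finally show ?thesis by simp
      qed
      then show "ennreal (\<bar>Y \<omega>\<bar> * indicator {-\<epsilon><..<\<epsilon>} (X \<omega>)) \<le> ennreal \<bar>W \<omega>\<bar> * indicator {-\<epsilon><..<\<epsilon>} (X \<omega>) + ennreal (\<bar>r\<bar> * \<epsilon>) * indicator {-\<epsilon><..<\<epsilon>} (X \<omega>)"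
        using e by (auto simp: indicator_def ennreal_plus[symmetric] simp del: ennreal_plus intro!: ennreal_leI)
    qed
    also have "\<dots> = ennreal (p \<epsilon> * k) + ennreal (\<bar>r\<bar> * \<epsilon> * p \<epsilon>)"
      using e by (subst nn_integral_add) (auto simp: WA PA)
    also have "\<dots> = ennreal ((k + \<bar>r\<bar> * \<epsilon>) * p \<epsilon>)"
      using e k0 by (subst ennreal_plus[symmetric]) (auto simp: p_def algebra_simps)
    finally show ?thesis .
  qed
  define i where "i \<epsilon> = enn2real (I \<epsilon>)" for \<epsilon>
  have I_i: "I \<epsilon> = ennreal (i \<epsilon>)" if "0 < \<epsilon>" for \<epsilon>
    unfolding i_def using up[OF that] by (metis ennreal_enn2real ennreal_less_top order_le_less_trans)
  have i0: "0 \<le> i \<epsilon>" for \<epsilon> unfolding i_def by simp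
  have i_up: "i \<epsilon> \<le> (k + \<bar>r\<bar> * \<epsilon>) * p \<epsilon>" if e: "0 < \<epsilon>" for \<epsilon>
    using up[OF e] unfolding I_i[OF e] by (subst (asm) ennreal_le_iff) (use k0 e in \<open>auto simp: p_def\<close>)
  have i_lo: "(k - \<bar>r\<bar> * \<epsilon>) * p \<epsilon> \<le> i \<epsilon>" if e: "0 < \<epsilon>" for \<epsilon>
  proof -
    have "ennreal (p \<epsilon> * k) \<le> (\<integral>\<^sup>+\<omega>. ennreal (\<bar>Y \<omega>\<bar> * indicator {-\<epsilon><..<\<epsilon>} (X \<omega>)) + ennreal (\<bar>r\<bar> * \<epsilon>) * indicator {-\<epsilon><..<\<epsilon>} (X \<omega>) \<partial>M)"
      unfolding WA[symmetric]
    proof (intro nn_integral_mono)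
      fix \<omega>
      have "\<bar>W \<omega>\<bar> \<le> \<bar>Y \<omega>\<bar> + \<bar>r\<bar> * \<epsilon>" if "\<bar>X \<omega>\<bar> < \<epsilon>"
      proof -
        have "\<bar>W \<omega>\<bar> \<le> \<bar>Y \<omega>\<bar> + \<bar>r\<bar> * \<bar>X \<omega>\<bar>" unfolding W_def abs_mult[symmetric] by linarith
        also have "\<bar>r\<bar> * \<bar>X \<omega>\<bar> \<le> \<bar>r\<bar> * \<epsilon>" using that by (intro mult_left_mono) auto
        finally show ?thesis by simp
      qed
      then show "ennreal \<bar>W \<omega>\<bar> * indicator {-\<epsilon><..<\<epsilon>} (X \<omega>) \<le> ennreal (\<bar>Y \<omega>\<bar> * indicator {-\<epsilon><..<\<epsilon>} (X \<omega>)) + ennreal (\<bar>r\<bar> * \<epsilon>) * indicator {-\<epsilon><..<\<epsilon>} (X \<omega>)"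
        using e by (auto simp: indicator_def ennreal_plus[symmetric] simp del: ennreal_plus intro!: ennreal_leI)
    qed
    also have "\<dots> = I \<epsilon> + ennreal (\<bar>r\<bar> * \<epsilon> * p \<epsilon>)"
      using e by (subst nn_integral_add) (auto simp: I_def PA)
    also have "\<dots> = ennreal (i \<epsilon> + \<bar>r\<bar> * \<epsilon> * p \<epsilon>)"
      using e i0 by (subst ennreal_plus) (auto simp: p_def I_i)
    finally have "p \<epsilon> * k \<le> i \<epsilon> + \<bar>r\<bar> * \<epsilon> * p \<epsilon>"
      by (subst (asm) ennreal_le_iff) (use i0 e in \<open>auto simp: p_def intro!: add_nonneg_nonneg\<close>)
    then show ?thesis by (simp add: algebra_simps)
  qed
  have pup: "p \<epsilon> \<le> 2 * \<epsilon> * d 0" and plo: "2 * \<epsilon> * d \<epsilon> \<le> p \<epsilon>" if e: "0 < \<epsilon>" for \<epsilon>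
  proof -
    have eq: "{\<omega> \<in> space M. X \<omega> \<in> {-\<epsilon><..<\<epsilon>}} = {\<omega> \<in> space M. \<bar>X \<omega>\<bar> < \<epsilon>}" by auto
    have "p \<epsilon> \<le> prob {\<omega> \<in> space M. \<bar>X \<omega>\<bar> \<le> \<epsilon>}" unfolding p_def by (intro finite_measure_mono) auto
    also have "\<dots> \<le> 2 * \<epsilon> * d 0"
      unfolding d_def using e by (intro gaussian_small_ball(1)[OF X v gaussian_pair_first[OF P]]) simp
    finally show "p \<epsilon> \<le> 2 * \<epsilon> * d 0" .
    show "2 * \<epsilon> * d \<epsilon> \<le> p \<epsilon>"
      unfolding d_def p_def eq using e by (intro gaussian_small_ball(2)[OF X v gaussian_pair_first[OF P]]) simp
  qed
  have d0: "d 0 = 1 / sqrt (2 * pi * v)" unfolding d_def normal_density_def using v by simp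
  have JI: "J \<epsilon> = ennreal (i \<epsilon> / (2 * \<epsilon>))" if "0 < \<epsilon>" for \<epsilon>
    unfolding J_def I_def[symmetric] I_i[OF that] using that i0 by (intro divide_ennreal) auto
  show "J \<epsilon> \<le> ennreal ((sqrt (2 / pi) * sqrt (w - c\<^sup>2 / v) + \<bar>c / v\<bar>) / sqrt (2 * pi * v))" if e: "0 < \<epsilon>" "\<epsilon> \<le> 1" for \<epsilon>
  proof -
    have "i \<epsilon> \<le> (k + \<bar>r\<bar> * \<epsilon>) * p \<epsilon>" by (rule i_up[OF e(1)])
    also have "\<dots> \<le> (k + \<bar>r\<bar> * 1) * (2 * \<epsilon> * d 0)"
      using e k0 pup[OF e(1)] by (intro mult_mono add_mono mult_left_mono) (auto simp: p_def)
    finally have "i \<epsilon> / (2 * \<epsilon>) \<le> (k + \<bar>r\<bar>) * d 0" using e by (simp add: field_simps)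
    then show ?thesis unfolding JI[OF e(1)] d0 k_def r_def by (intro ennreal_leI) simp
  qed
  have dlim: "(d \<longlongrightarrow> d 0) (at_right 0)"
  proof -
    have "continuous_on UNIV d" unfolding d_def normal_density_def using v by (intro continuous_intros) auto
    then have "isCont d 0" by (simp add: continuous_on_eq_continuous_at)
    then show ?thesis unfolding isCont_def by (rule filterlim_at_split[THEN iffD1, THEN conjunct2])
  qed
  have plim: "((\<lambda>\<epsilon>. p \<epsilon> / (2 * \<epsilon>)) \<longlongrightarrow> d 0) (at_right 0)"
  proof (rule tendsto_sandwich[OF _ _ dlim tendsto_const])
    show "\<forall>\<^sub>F \<epsilon> in at_right 0. d \<epsilon> \<le> p \<epsilon> / (2 * \<epsilon>)"
      using eventually_at_right_less[of 0] by eventually_elim (use plo in \<open>auto simp: field_simps\<close>)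
    show "\<forall>\<^sub>F \<epsilon> in at_right 0. p \<epsilon> / (2 * \<epsilon>) \<le> d 0"
      using eventually_at_right_less[of 0] by eventually_elim (use pup in \<open>auto simp: field_simps\<close>)
  qed
  have id: "((\<lambda>\<epsilon>. \<epsilon>) \<longlongrightarrow> (0::real)) (at_right 0)" by (rule tendsto_ident_at)
  have ilim: "((\<lambda>\<epsilon>. i \<epsilon> / (2 * \<epsilon>)) \<longlongrightarrow> k * d 0) (at_right 0)"
  proof (rule tendsto_sandwich)
    show "\<forall>\<^sub>F \<epsilon> in at_right 0. (k - \<bar>r\<bar> * \<epsilon>) * (p \<epsilon> / (2 * \<epsilon>)) \<le> i \<epsilon> / (2 * \<epsilon>)"
      using eventually_at_right_less[of 0] by eventually_elim (use i_lo in \<open>auto intro!: divide_right_mono\<close>)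
    show "\<forall>\<^sub>F \<epsilon> in at_right 0. i \<epsilon> / (2 * \<epsilon>) \<le> (k + \<bar>r\<bar> * \<epsilon>) * (p \<epsilon> / (2 * \<epsilon>))"
      using eventually_at_right_less[of 0] by eventually_elim (use i_up in \<open>auto intro!: divide_right_mono\<close>)
    have "((\<lambda>\<epsilon>. (k - \<bar>r\<bar> * \<epsilon>) * (p \<epsilon> / (2 * \<epsilon>))) \<longlongrightarrow> (k - \<bar>r\<bar> * 0) * d 0) (at_right 0)"
      by (intro tendsto_intros plim id)
    then show "((\<lambda>\<epsilon>. (k - \<bar>r\<bar> * \<epsilon>) * (p \<epsilon> / (2 * \<epsilon>))) \<longlongrightarrow> k * d 0) (at_right 0)" by simp
    have "((\<lambda>\<epsilon>. (k + \<bar>r\<bar> * \<epsilon>) * (p \<epsilon> / (2 * \<epsilon>))) \<longlongrightarrow> (k + \<bar>r\<bar> * 0) * d 0) (at_right 0)"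
      by (intro tendsto_intros plim id)
    then show "((\<lambda>\<epsilon>. (k + \<bar>r\<bar> * \<epsilon>) * (p \<epsilon> / (2 * \<epsilon>))) \<longlongrightarrow> k * d 0) (at_right 0)" by simp
  qed
  have kd: "k * d 0 = sqrt (w / v - (c / v)\<^sup>2) / pi"
  proof -
    have "k * d 0 = sqrt ((2 / pi) * (w - c\<^sup>2 / v) / (2 * pi * v))"
      unfolding k_def d0 by (simp only: real_sqrt_mult real_sqrt_divide times_divide_eq_right mult_1_right)
    also have "(2 / pi) * (w - c\<^sup>2 / v) / (2 * pi * v) = (w / v - (c / v)\<^sup>2) / pi\<^sup>2"
      using v by (simp add: field_simps power2_eq_square)
    finally show ?thesis by (simp add: real_sqrt_divide)
  qed
  have "((\<lambda>\<epsilon>. ennreal (i \<epsilon> / (2 * \<epsilon>))) \<longlongrightarrow> ennreal (k * d 0)) (at_right 0)" by (intro tendsto_ennrealI ilim)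
  then show "(J \<longlongrightarrow> ennreal (sqrt (w / v - (c / v)\<^sup>2) / pi)) (at_right 0)"
    unfolding kd by (rule Lim_transform_eventually) (use eventually_at_right_less[of 0] in \<open>auto elim!: eventually_mono simp: JI\<close>)
qed

text \<open>Kac's integrals for \<open>\<epsilon> = 1 / (j + 1)\<close> converge to the number of zeros, bounded by the number of critical points,
  and by Tonelli their expectations are integrals over the interval of the quantities \<open>J\<close> above, which are bounded
  as well. The number of zeros as a function of \<open>\<omega>\<close> is only known to agree almost surely with a measurable function
  \<open>U\<close>; exposing \<open>U\<close> makes linearity of the integral available later on.\<close>

lemma (in prob_space) kac_rice_formula:
  fixes f g :: "'a \<Rightarrow> real \<Rightarrow> real"
  assumes fm: "(\<lambda>(\<omega>, x). f \<omega> x) \<in> borel_measurable (M \<Otimes>\<^sub>M borel)"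
    and gm: "(\<lambda>(\<omega>, x). g \<omega> x) \<in> borel_measurable (M \<Otimes>\<^sub>M borel)"
    and der: "\<And>\<omega> x. (f \<omega> has_real_derivative g \<omega> x) (at x)"
    and gc: "\<And>\<omega>. continuous_on UNIV (g \<omega>)"
    and P: "\<And>x. gaussian_pair M (\<lambda>\<omega>. f \<omega> x) (\<lambda>\<omega>. g \<omega> x) (v x) (c x) (w x)"
    and v: "\<And>x. 0 < v x"
    and cont: "continuous_on UNIV v" "continuous_on UNIV c" "continuous_on UNIV w"
    and crit: "\<And>\<omega>. f \<omega> s \<noteq> 0 \<Longrightarrow> finite {x \<in> {s<..<t}. g \<omega> x = 0} \<and> card {x \<in> {s<..<t}. g \<omega> x = 0} \<le> K"
    and st: "s < t"
  shows "\<exists>U\<in>borel_measurable M. (AE \<omega> in M. num_zeros (f \<omega>) {s..t} = U \<omega>) \<and>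
    (\<integral>\<^sup>+\<omega>. U \<omega> \<partial>M) = (\<integral>\<^sup>+x. ennreal (sqrt (w x / v x - (c x / v x)\<^sup>2) / pi) * indicator {s..t} x \<partial>lborel)"
proof -
  note fm[measurable] gm[measurable]
  have cv[measurable]: "v \<in> borel_measurable borel" "c \<in> borel_measurable borel" "w \<in> borel_measurable borel"
    using cont by (auto intro: borel_measurable_continuous_onI)
  define e where "e j = 1 / real (Suc j)" for j
  have e0: "0 < e j" "e j \<le> 1" for j unfolding e_def by auto
  have elim: "filterlim e (at_right 0) sequentially"
    unfolding e_def by real_asymp
  define H where "H j \<omega> x = ennreal (indicator {s..t} x * (\<bar>g \<omega> x\<bar> * indicator {- e j<..<e j} (f \<omega> x))) / ennreal (2 * e j)" for j \<omega> x
  define u where "u j \<omega> = kac_integral (f \<omega>) (g \<omega>) s t (e j) / ennreal (2 * e j)" for j \<omega>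
  have Hm[measurable]: "(\<lambda>(\<omega>, x). H j \<omega> x) \<in> borel_measurable (M \<Otimes>\<^sub>M borel)" for j
    unfolding H_def by measurable
  have fxm[measurable]: "(\<lambda>\<omega>. f \<omega> x) \<in> borel_measurable M" for x using P[of x] by (simp add: gaussian_pair_def)
  have gxm[measurable]: "(\<lambda>\<omega>. g \<omega> x) \<in> borel_measurable M" for x using P[of x] by (simp add: gaussian_pair_def)
  have fom[measurable]: "f \<omega> \<in> borel_measurable borel" for \<omega>
    by (intro borel_measurable_continuous_onI DERIV_continuous_on) (use der has_field_derivative_at_within in blast)
  have gom[measurable]: "g \<omega> \<in> borel_measurable borel" for \<omega>
    using gc by (rule borel_measurable_continuous_onI)
  have uH: "u j \<omega> = (\<integral>\<^sup>+x. H j \<omega> x \<partial>lborel)" for j \<omega>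
    unfolding u_def H_def kac_integral_def by (rule nn_integral_divide[symmetric]) measurable
  have um[measurable]: "u j \<in> borel_measurable M" for j
    unfolding uH by measurable
  have nz: "AE \<omega> in M. f \<omega> x \<noteq> 0" for x
  proof -
    have D: "distributed M lborel (\<lambda>\<omega>. f \<omega> x) (normal_density 0 (sqrt (v x)))"
      by (rule distributed_normal_char[OF _ v gaussian_pair_first[OF P]]) measurable
    have "emeasure M ((\<lambda>\<omega>. f \<omega> x) -` {0} \<inter> space M) = (\<integral>\<^sup>+y. ennreal (normal_density 0 (sqrt (v x)) y) * indicator {0} y \<partial>lborel)"
      by (rule distributed_emeasure[OF D]) auto
    also have "\<dots> = 0" by (subst nn_integral_indicator_singleton) auto
    finally have "emeasure M ((\<lambda>\<omega>. f \<omega> x) -` {0} \<inter> space M) = 0" .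
    then show ?thesis by (intro AE_I[where N="(\<lambda>\<omega>. f \<omega> x) -` {0} \<inter> space M"]) auto
  qed
  define U where "U \<omega> = liminf (\<lambda>j. u j \<omega>)" for \<omega>
  have Um[measurable]: "U \<in> borel_measurable M" unfolding U_def by measurable
  have good: "(\<lambda>j. u j \<omega>) \<longlonglongrightarrow> U \<omega> \<and> U \<omega> = num_zeros (f \<omega>) {s..t} \<and> (\<forall>j. u j \<omega> \<le> of_nat (K + 1))"
    if ns: "f \<omega> s \<noteq> 0" and nt: "f \<omega> t \<noteq> 0" for \<omega>
  proof -
    from crit[OF ns] have cr: "finite {x \<in> {s<..<t}. g \<omega> x = 0}" "card {x \<in> {s<..<t}. g \<omega> x = 0} \<le> K" by auto
    obtain vv where fin: "finite {x \<in> {s..t}. f \<omega> x = 0}"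
      and vv: "\<And>\<epsilon>. \<epsilon> > 0 \<Longrightarrow> kac_integral (f \<omega>) (g \<omega>) s t \<epsilon> = ennreal (vv \<epsilon>) \<and> 0 \<le> vv \<epsilon> \<and>
              vv \<epsilon> \<le> 2 * \<epsilon> * real (card {x \<in> {s<..<t}. g \<omega> x = 0} + 1)"
      and lim: "((\<lambda>\<epsilon>. vv \<epsilon> / (2 * \<epsilon>)) \<longlongrightarrow> weighted_zeros (f \<omega>) s t) (at_right 0)"
      using kac_counting[OF der gc st cr(1)] by auto
    have uv: "u j \<omega> = ennreal (vv (e j) / (2 * e j))" for j
      unfolding u_def using vv[OF e0(1)[of j]] e0[of j] by (auto intro!: divide_ennreal)
    have "(\<lambda>j. vv (e j) / (2 * e j)) \<longlonglongrightarrow> weighted_zeros (f \<omega>) s t"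
      using filterlim_compose[OF lim elim] .
    then have 1: "(\<lambda>j. u j \<omega>) \<longlonglongrightarrow> ennreal (weighted_zeros (f \<omega>) s t)"
      unfolding uv by (rule tendsto_ennrealI)
    have "{x \<in> {s..t}. f \<omega> x = 0} = {x \<in> {s<..<t}. f \<omega> x = 0}"
      using ns nt by (auto simp: less_le)
    then have 2: "num_zeros (f \<omega>) {s..t} = ennreal (weighted_zeros (f \<omega>) s t)"
      unfolding num_zeros_def weighted_zeros_def using fin ns nt
      by (simp add: ennreal_of_nat_eq_real_of_nat)
    have 3: "U \<omega> = ennreal (weighted_zeros (f \<omega>) s t)"
      unfolding U_def using 1 by (rule lim_imp_Liminf[rotated]) simp
    have 4: "u j \<omega> \<le> of_nat (K + 1)" for j
    proof -
      have "vv (e j) \<le> 2 * e j * real (card {x \<in> {s<..<t}. g \<omega> x = 0} + 1)" using vv[OF e0(1)[of j]] by simp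
      also have "\<dots> \<le> 2 * e j * real (K + 1)" using e0[of j] cr(2) by (intro mult_left_mono) auto
      finally have "vv (e j) / (2 * e j) \<le> real (K + 1)" using e0(1)[of j] by (simp add: field_simps)
      then show ?thesis unfolding uv ennreal_of_nat_eq_real_of_nat by (rule ennreal_leI)
    qed
    show ?thesis using 1 2 3 4 by simp
  qed
  have lim1: "(\<lambda>j. \<integral>\<^sup>+\<omega>. u j \<omega> \<partial>M) \<longlonglongrightarrow> (\<integral>\<^sup>+\<omega>. U \<omega> \<partial>M)"
  proof (rule nn_integral_dominated_convergence[where w="\<lambda>_. of_nat (K + 1)"])
    show "AE \<omega> in M. u j \<omega> \<le> of_nat (K + 1)" for j
      using nz[of s] nz[of t] by eventually_elim (use good in blast)
    show "AE \<omega> in M. (\<lambda>j. u j \<omega>) \<longlonglongrightarrow> U \<omega>"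
      using nz[of s] nz[of t] by eventually_elim (use good in blast)
    show "(\<integral>\<^sup>+\<omega>. of_nat (K + 1) \<partial>M) < \<infinity>" by (simp add: emeasure_space_1 ennreal_of_nat_eq_real_of_nat del: of_nat_Suc of_nat_add)
  qed auto
  have EU: "AE \<omega> in M. num_zeros (f \<omega>) {s..t} = U \<omega>"
    using nz[of s] nz[of t] by eventually_elim (use good in metis)
  define J where "J x \<epsilon> = (\<integral>\<^sup>+\<omega>. ennreal (\<bar>g \<omega> x\<bar> * indicator {-\<epsilon><..<\<epsilon>} (f \<omega> x)) \<partial>M) / ennreal (2 * \<epsilon>)" for x \<epsilon>
  have HJ: "(\<integral>\<^sup>+\<omega>. H j \<omega> x \<partial>M) = J x (e j) * indicator {s..t} x" for j x
    unfolding H_def J_def by (cases "x \<in> {s..t}") (auto simp: nn_integral_divide)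
  have Jm[measurable]: "(\<lambda>x. J x (e j) * indicator {s..t} x) \<in> borel_measurable lborel" for j
    unfolding HJ[symmetric] by measurable
  have "pair_sigma_finite M lborel" by (intro pair_sigma_finite.intro sigma_finite_lborel) unfold_locales
  then have sw: "(\<integral>\<^sup>+\<omega>. u j \<omega> \<partial>M) = (\<integral>\<^sup>+x. J x (e j) * indicator {s..t} x \<partial>lborel)" for j
    unfolding uH HJ[symmetric] by (rule pair_sigma_finite.Fubini'[symmetric]) measurable
  define B where "B x = (sqrt (2 / pi) * sqrt (w x - (c x)\<^sup>2 / v x) + \<bar>c x / v x\<bar>) / sqrt (2 * pi * v x)" for x
  have vne: "v x \<noteq> 0" for x using v[of x] by simp
  have Bc: "continuous_on {s..t} B"
    unfolding B_def using v vne
    by (intro continuous_intros continuous_on_subset[OF cont(1)] continuous_on_subset[OF cont(2)] continuous_on_subset[OF cont(3)]) auto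
  obtain b where b': "\<forall>y\<in>B ` {s..t}. norm y \<le> b"
    using compact_imp_bounded[OF compact_continuous_image[OF Bc compact_Icc]] unfolding bounded_iff by (elim exE)
  have b: "B x \<le> b" if "x \<in> {s..t}" for x using bspec[OF b' imageI[OF that]] by simp
  have lim2: "(\<lambda>j. \<integral>\<^sup>+x. J x (e j) * indicator {s..t} x \<partial>lborel) \<longlonglongrightarrow>
     (\<integral>\<^sup>+x. ennreal (sqrt (w x / v x - (c x / v x)\<^sup>2) / pi) * indicator {s..t} x \<partial>lborel)"
  proof (rule nn_integral_dominated_convergence[where w="\<lambda>x. ennreal b * indicator {s..t} x"])
    show "AE x in lborel. J x (e j) * indicator {s..t} x \<le> ennreal b * indicator {s..t} x" for j
    proof (rule AE_I2)
      fix x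
      have "J x (e j) \<le> ennreal b" if "x \<in> {s..t}"
        using kac_rice_density(2)[OF P v e0(1) e0(2), of x j] b[OF that]
        unfolding J_def B_def by (meson ennreal_leI order_trans)
      then show "J x (e j) * indicator {s..t} x \<le> ennreal b * indicator {s..t} x" by (auto simp: indicator_def)
    qed
    show "(\<integral>\<^sup>+x. ennreal b * indicator {s..t} x \<partial>lborel) < \<infinity>"
      using st by (simp add: nn_integral_cmult_indicator ennreal_mult_less_top)
    show "AE x in lborel. (\<lambda>j. J x (e j) * indicator {s..t} x) \<longlonglongrightarrow> ennreal (sqrt (w x / v x - (c x / v x)\<^sup>2) / pi) * indicator {s..t} x"
    proof (rule AE_I2)
      fix x
      have "(\<lambda>j. J x (e j)) \<longlonglongrightarrow> ennreal (sqrt (w x / v x - (c x / v x)\<^sup>2) / pi)"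
        using filterlim_compose[OF kac_rice_density(3)[OF P v] elim] unfolding J_def .
      then show "(\<lambda>j. J x (e j) * indicator {s..t} x) \<longlonglongrightarrow> ennreal (sqrt (w x / v x - (c x / v x)\<^sup>2) / pi) * indicator {s..t} x"
        by (auto simp: indicator_def)
    qed
  qed auto
  show ?thesis using LIMSEQ_unique[OF lim1[unfolded sw] lim2] EU Um by (intro bexI[of _ U] conjI)
qed

section \<open>Integrals of periodic functions\<close>

lemma nn_integral_period_aux:
  fixes f :: "real \<Rightarrow> ennreal"
  assumes [measurable]: "f \<in> borel_measurable borel" and per: "\<And>x. f (x + T) = f x" and ab: "a \<le> b" "b \<le> a + T"
  shows "(\<integral>\<^sup>+x. f x * indicator {a..a + T} x \<partial>lborel) = (\<integral>\<^sup>+x. f x * indicator {b..b + T} x \<partial>lborel)"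
proof -
  have eqL: "(\<integral>\<^sup>+x. f x * indicator {a..a + T} x \<partial>lborel) = (\<integral>\<^sup>+x. f x * indicator {a..b} x \<partial>lborel) + (\<integral>\<^sup>+x. f x * indicator {b..a + T} x \<partial>lborel)"
    using ab AE_lborel_singleton[of b]
    by (subst nn_integral_add[symmetric], measurable) (intro nn_integral_cong_AE, auto elim!: eventually_mono simp: indicator_def)
  have eqR: "(\<integral>\<^sup>+x. f x * indicator {b..b + T} x \<partial>lborel) = (\<integral>\<^sup>+x. f x * indicator {b..a + T} x \<partial>lborel) + (\<integral>\<^sup>+x. f x * indicator {a + T..b + T} x \<partial>lborel)"
    using ab AE_lborel_singleton[of "a + T"]
    by (subst nn_integral_add[symmetric], measurable) (intro nn_integral_cong_AE, auto elim!: eventually_mono simp: indicator_def)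
  have "(\<integral>\<^sup>+x. f x * indicator {a + T..b + T} x \<partial>lborel) = (\<integral>\<^sup>+x. f (T + 1 * x) * indicator {a + T..b + T} (T + 1 * x) \<partial>lborel)"
    by (subst nn_integral_real_affine[where c=1 and t=T]) auto
  also have "\<dots> = (\<integral>\<^sup>+x. f x * indicator {a..b} x \<partial>lborel)"
    by (intro nn_integral_cong) (use per in \<open>auto simp: indicator_def add.commute\<close>)
  finally show ?thesis unfolding eqL eqR by (simp add: add.commute)
qed

lemma nn_integral_period_shift:
  fixes f :: "real \<Rightarrow> ennreal"
  assumes f[measurable]: "f \<in> borel_measurable borel" and per: "\<And>x. f (x + T) = f x" and u: "\<bar>u\<bar> \<le> T"
  shows "(\<integral>\<^sup>+x. f (x + u) * indicator {a..a + T} x \<partial>lborel) = (\<integral>\<^sup>+x. f x * indicator {a..a + T} x \<partial>lborel)"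
proof -
  have "(\<integral>\<^sup>+x. f x * indicator {a + u..a + u + T} x \<partial>lborel) = (\<integral>\<^sup>+x. f (u + 1 * x) * indicator {a + u..a + u + T} (u + 1 * x) \<partial>lborel)"
    by (subst nn_integral_real_affine[where c=1 and t=u]) auto
  also have "\<dots> = (\<integral>\<^sup>+x. f (x + u) * indicator {a..a + T} x \<partial>lborel)"
    by (intro nn_integral_cong) (auto simp: indicator_def add.commute)
  finally have 1: "(\<integral>\<^sup>+x. f (x + u) * indicator {a..a + T} x \<partial>lborel) = (\<integral>\<^sup>+x. f x * indicator {a + u..a + u + T} x \<partial>lborel)" ..
  show ?thesis
  proof (cases "0 \<le> u")
    case True
    then show ?thesis unfolding 1 using u by (intro nn_integral_period_aux[OF f per, symmetric]) auto
  next
    case False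
    then show ?thesis unfolding 1 using u by (intro nn_integral_period_aux[OF f per]) auto
  qed
qed

lemma window_shift:
  fixes f :: "real \<Rightarrow> ennreal"
  assumes [measurable]: "f \<in> borel_measurable borel"
  shows "(\<integral>\<^sup>+t. f (x + t) * indicator {0..h} t \<partial>lborel) = (\<integral>\<^sup>+t. f t * indicator {x..x + h} t \<partial>lborel)"
proof -
  have "(\<integral>\<^sup>+t. f t * indicator {x..x + h} t \<partial>lborel) = (\<integral>\<^sup>+t. f (x + 1 * t) * indicator {x..x + h} (x + 1 * t) \<partial>lborel)"
    by (subst nn_integral_real_affine[where c=1 and t=x]) auto
  also have "\<dots> = (\<integral>\<^sup>+t. f (x + t) * indicator {0..h} t \<partial>lborel)"
    by (intro nn_integral_cong) (auto simp: indicator_def)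
  finally show ?thesis ..
qed

section \<open>An integrable envelope at scale 1/n\<close>

lemma half_le_sin:
  fixes x :: real
  assumes "0 \<le> x" "x \<le> pi / 2"
  shows "x / 2 \<le> sin x"
proof (cases "x \<le> pi / 3")
  case True
  show ?thesis
  proof (cases "x = 0")
    case False
    then have x: "0 < x" using assms by simp
    obtain z where z: "0 < z" "z < x" "sin x - sin 0 = (x - 0) * cos z"
      using MVT2[OF x, of sin cos] by (auto intro: DERIV_sin)
    have "cos (pi / 3) \<le> cos z" using z True by (subst cos_mono_le_eq) auto
    then have "1 / 2 \<le> cos z" by (simp add: cos_60)
    then show ?thesis using z(3) x mult_left_mono[of "1/2" "cos z" x] by simp
  qed simp
next
  case False
  have "sin (pi / 3) \<le> sin x" using False assms by (subst sin_mono_le_eq) auto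
  then have "sqrt 3 / 2 \<le> sin x" by (simp add: sin_60)
  moreover have "1.7 \<le> sqrt (3::real)" by (rule real_le_rsqrt) (simp add: power2_eq_square)
  moreover have "x / 2 \<le> 0.8" using assms(2) pi_less_4 pi_approx by simp
  ultimately show ?thesis by linarith
qed

lemma sin_abs_half_le: "sin (\<bar>v\<bar> / 2) \<le> \<bar>sin (v / 2 :: real)\<bar>"
proof (cases "0 \<le> v")
  case False
  then have "\<bar>v\<bar> / 2 = - (v / 2)" by simp
  then have "sin (\<bar>v\<bar> / 2) = - sin (v / 2)" by (simp only: sin_minus)
  then show ?thesis by simp
qed simp

text \<open>A weak form of Jordan's inequality.\<close>

lemma abs_sin_half_ge:
  fixes v :: real
  assumes "\<bar>v\<bar> \<le> pi"
  shows "\<bar>v\<bar> / 4 \<le> \<bar>sin (v / 2)\<bar>"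
proof -
  have "\<bar>v\<bar> / 2 / 2 \<le> sin (\<bar>v\<bar> / 2)" using assms by (intro half_le_sin) auto
  also have "\<dots> \<le> \<bar>sin (v / 2)\<bar>" by (rule sin_abs_half_le)
  finally show ?thesis by simp
qed

text \<open>Up to constants this is the minimum of \<open>n\<close> and \<open>1 / (n * sin\<^sup>2 (v / 2))\<close>, in a form that is smooth and
  \<open>2\<pi>\<close>-periodic.\<close>

definition envelope :: "nat \<Rightarrow> real \<Rightarrow> real" where
  "envelope n v = real n / (1 + (real n * sin (v / 2))\<^sup>2)"

lemma envelope_denom_pos: "0 < 1 + (real n * sin (v / 2))\<^sup>2"
  by (rule add_pos_nonneg) auto

lemma envelope_nonneg: "0 \<le> envelope n v"
  unfolding envelope_def using envelope_denom_pos by (intro divide_nonneg_pos) auto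

lemma continuous_envelope[continuous_intros]: "continuous_on A (h :: real \<Rightarrow> real) \<Longrightarrow> continuous_on A (\<lambda>x. envelope n (h x))"
  unfolding envelope_def by (intro continuous_intros ballI less_imp_neq[OF envelope_denom_pos, symmetric]) auto

lemma measurable_envelope[measurable]: "envelope n \<in> borel_measurable borel"
  by (intro borel_measurable_continuous_onI continuous_intros)

lemma envelope_periodic: "envelope n (v + 2 * pi) = envelope n v"
proof -
  have "sin ((v + 2 * pi) / 2) = - sin (v / 2)" by (simp add: add_divide_distrib)
  then show ?thesis unfolding envelope_def by simp
qed

lemma envelope_even: "envelope n (- v) = envelope n v"
  unfolding envelope_def by simp

text \<open>Comparison with a Cauchy density, whose antiderivative is an arc tangent.\<close>

lemma envelope_integral:
  "(\<integral>\<^sup>+v. ennreal (envelope n v) * indicator {-pi..pi} v \<partial>lborel) \<le> ennreal (4 * pi)"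
proof (cases "n = 0")
  case True
  then show ?thesis by (simp add: envelope_def)
next
  case False
  define G where "G v = 4 * arctan (real n * v / 4)" for v
  define g where "g v = real n / (1 + (real n * v / 4)\<^sup>2)" for v
  have d: "0 < 1 + (real n * v / 4)\<^sup>2" for v by (rule add_pos_nonneg) auto
  have "(\<integral>\<^sup>+v. ennreal (envelope n v) * indicator {-pi..pi} v \<partial>lborel) \<le> (\<integral>\<^sup>+v. ennreal (g v) * indicator {-pi..pi} v \<partial>lborel)"
  proof (intro nn_integral_mono)
    fix v :: real
    show "ennreal (envelope n v) * indicator {-pi..pi} v \<le> ennreal (g v) * indicator {-pi..pi} v"
    proof (cases "v \<in> {-pi..pi}")
      case True
      then have "(real n * \<bar>v\<bar> / 4)\<^sup>2 \<le> (real n * \<bar>sin (v / 2)\<bar>)\<^sup>2"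
      proof (intro power_mono)
        have "real n * (\<bar>v\<bar> / 4) \<le> real n * \<bar>sin (v / 2)\<bar>"
          using True by (intro mult_left_mono abs_sin_half_ge) auto
        then show "real n * \<bar>v\<bar> / 4 \<le> real n * \<bar>sin (v / 2)\<bar>" by simp
      qed simp
      then have "(real n * v / 4)\<^sup>2 \<le> (real n * sin (v / 2))\<^sup>2"
        by (simp add: power_mult_distrib power_divide)
      then have "envelope n v \<le> g v" unfolding envelope_def g_def using d[of v] envelope_denom_pos[of n v]
        by (intro divide_left_mono) auto
      then show ?thesis using True by (simp add: ennreal_leI)
    qed simp
  qed
  also have "\<dots> = ennreal (G pi - G (- pi))"
  proof (rule nn_integral_FTC_Icc)
    show "(\<lambda>v. g v) \<in> borel_measurable borel" unfolding g_def by measurable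
    show "- pi \<le> pi" by simp
    show "0 \<le> g x" for x unfolding g_def using d[of x] by (intro divide_nonneg_pos) auto
    show "(G has_real_derivative g x) (at x)" for x
      unfolding G_def g_def by (auto intro!: derivative_eq_intros simp: field_simps)
  qed
  also have "\<dots> \<le> ennreal (4 * pi)"
    using arctan_bounded[of "real n * pi / 4"] by (intro ennreal_leI) (auto simp: G_def arctan_minus)
  finally show ?thesis .
qed

text \<open>The envelope varies at scale \<open>1 / n\<close>, so shifts inside a window cost only a constant factor.\<close>

lemma envelope_shift:
  assumes t: "0 \<le> t" "t \<le> 1 / (4 * real n)"
  shows "envelope n (v + t) \<le> 3 * envelope n v"
proof (cases "n = 0")
  case True
  then show ?thesis by (simp add: envelope_def)
next
  case False
  define p q where "p = real n * sin (v / 2)" and "q = real n * sin ((v + t) / 2)"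
  have "\<bar>sin (v / 2) - sin ((v + t) / 2)\<bar> \<le> t / 2"
  proof -
    have "sin (v / 2) - sin ((v + t) / 2) = 2 * sin ((v / 2 - (v + t) / 2) / 2) * cos ((v / 2 + (v + t) / 2) / 2)"
      by (rule sin_diff_sin)
    also have "(v / 2 - (v + t) / 2) / 2 = - (t / 4)" by (simp add: field_simps)
    finally have "\<bar>sin (v / 2) - sin ((v + t) / 2)\<bar> = 2 * (\<bar>sin (t / 4)\<bar> * \<bar>cos ((v / 2 + (v + t) / 2) / 2)\<bar>)"
      by (simp add: abs_mult)
    also have "\<dots> \<le> 2 * (\<bar>t / 4\<bar> * 1)" by (intro mult_left_mono mult_mono abs_sin_x_le_abs_x abs_cos_le_one) auto
    finally show ?thesis using t by simp
  qed
  then have "real n * \<bar>sin (v / 2) - sin ((v + t) / 2)\<bar> \<le> real n * (t / 2)" by (intro mult_left_mono) auto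
  then have "\<bar>p - q\<bar> \<le> real n * (t / 2)"
    unfolding p_def q_def right_diff_distrib[symmetric] abs_mult by simp
  also have "\<dots> \<le> 1 / 8" using t False by (simp add: field_simps)
  finally have pq: "\<bar>p\<bar> \<le> \<bar>q\<bar> + 1 / 8" by linarith
  have "p\<^sup>2 = \<bar>p\<bar>\<^sup>2" by simp
  also have "\<dots> \<le> (\<bar>q\<bar> + 1 / 8)\<^sup>2" using pq by (intro power_mono) auto
  also have "\<dots> \<le> 2 * q\<^sup>2 + 2"
  proof -
    have "2 * q\<^sup>2 + 2 - (\<bar>q\<bar> + 1 / 8)\<^sup>2 = (\<bar>q\<bar> - 1 / 8)\<^sup>2 + (2 - 1/32)"
      by (simp add: power2_eq_square algebra_simps)
    moreover have "0 \<le> (\<bar>q\<bar> - 1 / 8)\<^sup>2" by simp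
    ultimately show ?thesis by linarith
  qed
  also have "\<dots> \<le> 3 * q\<^sup>2 + 2" by simp
  finally have "1 + p\<^sup>2 \<le> 3 * (1 + q\<^sup>2)" by simp
  moreover have "0 < 1 + p\<^sup>2" "0 < 1 + q\<^sup>2" by (auto intro: add_pos_nonneg)
  ultimately have "real n / (1 + q\<^sup>2) \<le> 3 * (real n / (1 + p\<^sup>2))"
    by (simp add: field_simps) (metis mult.commute mult_left_mono of_nat_0_le_iff distrib_left mult.assoc mult.left_commute)
  then show ?thesis unfolding envelope_def p_def q_def .
qed

lemma envelope_far:
  assumes "0 < n" "0 < \<eta>" "\<eta> \<le> \<bar>v\<bar>" "\<bar>v\<bar> \<le> 2 * pi - \<eta>"
  shows "envelope n v \<le> 1 / (real n * (sin (\<eta> / 2))\<^sup>2)"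
proof -
  have s: "0 < sin (\<eta> / 2)" using assms by (intro sin_gt_zero) auto
  have "sin (\<eta> / 2) \<le> sin (\<bar>v\<bar> / 2)"
  proof (cases "\<bar>v\<bar> \<le> pi")
    case True
    then show ?thesis using assms by (subst sin_mono_le_eq) auto
  next
    case False
    have "sin (\<eta> / 2) \<le> sin (pi - \<bar>v\<bar> / 2)" using assms False by (subst sin_mono_le_eq) auto
    then show ?thesis by simp
  qed
  also have "\<dots> \<le> \<bar>sin (v / 2)\<bar>" by (rule sin_abs_half_le)
  finally have "(sin (\<eta> / 2))\<^sup>2 \<le> \<bar>sin (v / 2)\<bar>\<^sup>2" using s by (intro power_mono) auto
  then have le: "(sin (\<eta> / 2))\<^sup>2 \<le> (sin (v / 2))\<^sup>2" by simp
  have "envelope n v \<le> real n / (real n * (real n * (sin (\<eta> / 2))\<^sup>2))"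
    unfolding envelope_def
  proof (rule divide_left_mono)
    have "real n * (real n * (sin (\<eta> / 2))\<^sup>2) \<le> real n * (real n * (sin (v / 2))\<^sup>2)"
      using le by (intro mult_left_mono) auto
    also have "\<dots> = (real n * sin (v / 2))\<^sup>2" by (simp add: power_mult_distrib power2_eq_square)
    finally show "real n * (real n * (sin (\<eta> / 2))\<^sup>2) \<le> 1 + (real n * sin (v / 2))\<^sup>2" by simp
    show "0 < (1 + (real n * sin (v / 2))\<^sup>2) * (real n * (real n * (sin (\<eta> / 2))\<^sup>2))"
      using s assms envelope_denom_pos[of n v] by (intro mult_pos_pos) auto
  qed simp
  then show ?thesis using assms by simp
qed

section \<open>Kernels of Fejer type\<close>

definition exp_poly :: "nat \<Rightarrow> nat \<Rightarrow> real \<Rightarrow> complex" where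
  "exp_poly j n v = (\<Sum>k=1..n. of_real ((real k / real n) ^ j) * cis (real k * v))"

text \<open>This is \<open>\<bar>exp_poly j n v\<bar>\<^sup>2 / n\<close>, for \<open>j = 0\<close> the Fejer kernel of mass \<open>2\<pi>\<close>. The expanded double sum lets
  convolutions, derivatives and integrals be computed term by term.\<close>

definition moment_kernel :: "nat \<Rightarrow> nat \<Rightarrow> real \<Rightarrow> real" where
  "moment_kernel j n v = (1 / real n) * (\<Sum>k=1..n. \<Sum>l=1..n. (real k / real n) ^ j * (real l / real n) ^ j * cos ((real k - real l) * v))"

text \<open>The polarised version, \<open>Im (exp_poly 0 n v * cnj (exp_poly 1 n v)) / n\<close>.\<close>

definition cross_kernel :: "nat \<Rightarrow> real \<Rightarrow> real" where
  "cross_kernel n v = (1 / real n) * (\<Sum>k=1..n. \<Sum>l=1..n. (real l / real n) * sin ((real k - real l) * v))"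

lemma exp_poly_mult_cnj:
  "exp_poly i n v * cnj (exp_poly j n v) = (\<Sum>k=1..n. \<Sum>l=1..n. of_real ((real k / real n) ^ i * (real l / real n) ^ j) * cis ((real k - real l) * v))"
proof -
  have *: "of_real a * cis x * cnj (of_real b * cis y) = of_real (a * b) * cis (x - y)" for a b x y
    by (simp add: cis_cnj cis_mult)
  show ?thesis
    unfolding exp_poly_def cnj_sum sum_product * by (simp only: left_diff_distrib)
qed

lemma moment_kernel_eq: "moment_kernel j n v = (cmod (exp_poly j n v))\<^sup>2 / real n"
proof -
  have "(cmod (exp_poly j n v))\<^sup>2 = Re (exp_poly j n v * cnj (exp_poly j n v))"
    by (metis Re_complex_of_real complex_norm_square)
  then show ?thesis unfolding exp_poly_mult_cnj moment_kernel_def by (simp add: Re_sum)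
qed

lemma cross_kernel_eq: "cross_kernel n v = Im (exp_poly 0 n v * cnj (exp_poly 1 n v)) / real n"
  unfolding exp_poly_mult_cnj cross_kernel_def by (simp add: Im_sum)

lemma norm_exp_poly_le: "cmod (exp_poly j n v) \<le> real n"
proof -
  have "cmod (exp_poly j n v) \<le> (\<Sum>k=1..n. cmod (of_real ((real k / real n) ^ j) * cis (real k * v)))"
    unfolding exp_poly_def by (rule norm_sum)
  also have "\<dots> \<le> (\<Sum>k=1..n. 1)"
    by (intro sum_mono) (auto simp: norm_mult norm_power norm_divide intro!: power_le_one)
  finally show ?thesis by simp
qed

lemma norm_cis_diff_1: "cmod (cis v - 1) = 2 * \<bar>sin (v / 2)\<bar>"
proof -
  have "(cmod (cis v - 1))\<^sup>2 = (cos v - 1)\<^sup>2 + (sin v)\<^sup>2" by (simp add: cmod_power2)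
  also have "\<dots> = 2 - 2 * cos v" using sin_cos_squared_add[of v] by (simp add: power2_eq_square algebra_simps)
  also have "cos v = 1 - 2 * (sin (v / 2))\<^sup>2" using cos_double_sin[of "v / 2"] by simp
  finally have "(cmod (cis v - 1))\<^sup>2 = (2 * \<bar>sin (v / 2)\<bar>)\<^sup>2" by (simp add: power_mult_distrib)
  then show ?thesis by (rule power2_eq_imp_eq) auto
qed

text \<open>The geometric sum telescopes after multiplication by \<open>cis v - 1\<close>.\<close>

lemma geometric_cis_bound:
  assumes "j \<le> Suc n"
  shows "cmod (\<Sum>k=j..n. cis (real k * v)) * \<bar>sin (v / 2)\<bar> \<le> 1"
proof -
  have "(\<Sum>k=j..n. cis (real k * v)) * (cis v - 1) = (\<Sum>k=j..n. cis (real (Suc k) * v) - cis (real k * v))"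
    unfolding sum_distrib_right by (intro sum.cong) (auto simp: right_diff_distrib cis_mult algebra_simps)
  also have "\<dots> = cis (real (Suc n) * v) - cis (real j * v)"
    using assms by (rule sum_Suc_diff)
  finally have "cmod (\<Sum>k=j..n. cis (real k * v)) * (2 * \<bar>sin (v / 2)\<bar>) = cmod (cis (real (Suc n) * v) - cis (real j * v))"
    unfolding norm_cis_diff_1[symmetric] norm_mult[symmetric] by simp
  also have "\<dots> \<le> 2" by (rule order_trans[OF norm_triangle_ineq4]) simp
  finally show ?thesis by simp
qed

text \<open>For \<open>j = 1\<close> by summation by parts: the weights \<open>k / n\<close> are averages of indicators of \<open>{i..n}\<close>.\<close>

lemma norm_exp_poly_sin_le:
  assumes "0 < n" "j \<in> {0, 1}"
  shows "cmod (exp_poly j n v) * \<bar>sin (v / 2)\<bar> \<le> 1"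
proof (cases "j = 0")
  case True
  then show ?thesis using geometric_cis_bound[of 1 n v] by (simp add: exp_poly_def)
next
  case False
  then have j: "j = 1" using assms by simp
  have "exp_poly 1 n v = (\<Sum>k=1..n. \<Sum>i=1..k. cis (real k * v)) / of_nat n"
    unfolding exp_poly_def sum_divide_distrib by (intro sum.cong) auto
  also have "(\<Sum>k=1..n. \<Sum>i=1..k. cis (real k * v)) = (\<Sum>i=1..n. \<Sum>k=i..n. cis (real k * v))"
  proof -
    have "(\<Sum>k=1..n. \<Sum>i=1..k. cis (real k * v)) = (\<Sum>k=1..n. \<Sum>i=1..n. if i \<le> k then cis (real k * v) else 0)"
      by (intro sum.cong refl sum.mono_neutral_cong_left) auto
    also have "\<dots> = (\<Sum>i=1..n. \<Sum>k=1..n. if i \<le> k then cis (real k * v) else 0)" by (rule sum.swap)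
    also have "\<dots> = (\<Sum>i=1..n. \<Sum>k=i..n. cis (real k * v))"
      by (intro sum.cong refl sum.mono_neutral_cong_right) auto
    finally show ?thesis .
  qed
  finally have "cmod (exp_poly 1 n v) * \<bar>sin (v / 2)\<bar> = cmod (\<Sum>i=1..n. \<Sum>k=i..n. cis (real k * v)) * \<bar>sin (v / 2)\<bar> / real n"
    by (simp add: norm_divide)
  also have "\<dots> \<le> (\<Sum>i=1..n. cmod (\<Sum>k=i..n. cis (real k * v))) * \<bar>sin (v / 2)\<bar> / real n"
    by (intro divide_right_mono mult_right_mono norm_sum) auto
  also have "\<dots> \<le> (\<Sum>i=1..n. 1) / real n"
    unfolding sum_distrib_right by (intro divide_right_mono sum_mono geometric_cis_bound) auto
  also have "\<dots> = 1" using assms by simp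
  finally show ?thesis using j by simp
qed

text \<open>Both factors are bounded by \<open>n\<close> and by \<open>1 / \<bar>sin (v / 2)\<bar>\<close>.\<close>

lemma exp_poly_product_envelope:
  assumes n: "0 < n" and i: "i \<in> {0, 1}" and j: "j \<in> {0, 1}"
  shows "cmod (exp_poly i n v) * cmod (exp_poly j n v) / real n \<le> 2 * envelope n v"
proof -
  define a b s where "a = cmod (exp_poly i n v)" and "b = cmod (exp_poly j n v)" and "s = \<bar>sin (v / 2)\<bar>"
  have ab: "0 \<le> a" "a \<le> real n" "a * s \<le> 1" "0 \<le> b" "b \<le> real n" "b * s \<le> 1" "0 \<le> s"
    unfolding a_def b_def s_def using norm_exp_poly_le norm_exp_poly_sin_le[OF n] i j by auto
  have "a * b \<le> real n * real n" using ab by (intro mult_mono) auto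
  moreover have "(a * s) * (b * s) \<le> 1 * 1" using ab by (intro mult_mono) auto
  then have "real n * real n * ((a * s) * (b * s)) \<le> real n * real n * 1" by (intro mult_left_mono) auto
  ultimately have "a * b * (1 + (real n * s)\<^sup>2) \<le> 2 * (real n * real n)"
    by (simp add: power2_eq_square algebra_simps)
  moreover have "0 < 1 + (real n * s)\<^sup>2" by (auto intro: add_pos_nonneg)
  ultimately have "a * b / real n \<le> 2 * (real n / (1 + (real n * s)\<^sup>2))"
    using n by (simp add: field_simps)
  moreover have "(real n * s)\<^sup>2 = (real n * sin (v / 2))\<^sup>2" unfolding s_def by (simp add: power_mult_distrib)
  ultimately show ?thesis unfolding a_def b_def envelope_def by simp
qed

lemma moment_kernel_nonneg: "0 \<le> moment_kernel j n v"
  unfolding moment_kernel_eq by simp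

lemma moment_kernel_le_envelope:
  assumes "0 < n" "j \<in> {0, 1}"
  shows "moment_kernel j n v \<le> 2 * envelope n v"
  using exp_poly_product_envelope[OF assms(1,2,2)] unfolding moment_kernel_eq by (simp add: power2_eq_square)

lemma cross_kernel_le_envelope:
  assumes "0 < n"
  shows "\<bar>cross_kernel n v\<bar> \<le> 2 * envelope n v"
proof -
  have "\<bar>Im (exp_poly 0 n v * cnj (exp_poly 1 n v))\<bar> \<le> cmod (exp_poly 0 n v) * cmod (exp_poly 1 n v)"
    using abs_Im_le_cmod[of "exp_poly 0 n v * cnj (exp_poly 1 n v)"] by (simp add: norm_mult)
  then have "\<bar>cross_kernel n v\<bar> \<le> cmod (exp_poly 0 n v) * cmod (exp_poly 1 n v) / real n"
    unfolding cross_kernel_eq by (simp add: divide_right_mono)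
  also have "\<dots> \<le> 2 * envelope n v" by (rule exp_poly_product_envelope) (use assms in auto)
  finally show ?thesis .
qed

lemma continuous_moment_kernel[continuous_intros]: "continuous_on A (h :: real \<Rightarrow> real) \<Longrightarrow> continuous_on A (\<lambda>x. moment_kernel j n (h x))"
  unfolding moment_kernel_def by (intro continuous_intros)

lemma continuous_cross_kernel[continuous_intros]: "continuous_on A (h :: real \<Rightarrow> real) \<Longrightarrow> continuous_on A (\<lambda>x. cross_kernel n (h x))"
  unfolding cross_kernel_def by (intro continuous_intros)

lemma cos_sin_int_periodic:
  fixes k l :: nat
  shows "cos ((real k - real l) * (v + 2 * pi)) = cos ((real k - real l) * v)"
    and "sin ((real k - real l) * (v + 2 * pi)) = sin ((real k - real l) * v)"
proof -
  have "(real k - real l) * (v + 2 * pi) = (real k - real l) * v + 2 * pi * real_of_int (int k - int l)"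
    by (simp add: algebra_simps)
  moreover have "sin (x + 2 * pi * real_of_int m) = sin x \<and> cos (x + 2 * pi * real_of_int m) = cos x" for x m
    using sin_cos_eq_iff[of "x + 2 * pi * real_of_int m" x] by blast
  ultimately show "cos ((real k - real l) * (v + 2 * pi)) = cos ((real k - real l) * v)"
    "sin ((real k - real l) * (v + 2 * pi)) = sin ((real k - real l) * v)" by metis+
qed

lemma has_integral_cos_int:
  fixes k l :: nat
  shows "((\<lambda>v. cos ((real k - real l) * v)) has_integral (if k = l then 2 * pi else 0)) {-pi..pi}"
proof (cases "k = l")
  case True
  then show ?thesis using has_integral_const_real[of "1::real" "-pi" pi] by simp
next
  case False
  define m where "m = real k - real l"
  have m: "m \<noteq> 0" "m \<in> \<int>" using False unfolding m_def by auto
  have "((\<lambda>v. cos (m * v)) has_integral (sin (m * pi) / m - sin (m * (- pi)) / m)) {-pi..pi}"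
    by (rule fundamental_theorem_of_calculus)
      (use m in \<open>auto intro!: derivative_eq_intros simp: has_real_derivative_iff_has_vector_derivative[symmetric]\<close>)
  moreover have "sin (m * pi) = 0" using m(2) by (auto simp: sin_zero_iff_int2 elim: Ints_cases)
  ultimately show ?thesis using False unfolding m_def by simp
qed

lemma has_integral_sin_int:
  fixes k l :: nat
  shows "((\<lambda>v. sin ((real k - real l) * v)) has_integral 0) {-pi..pi}"
proof (cases "k = l")
  case True
  then show ?thesis by simp
next
  case False
  define m where "m = real k - real l"
  have m: "m \<noteq> 0" using False unfolding m_def by auto
  have "((\<lambda>v. sin (m * v)) has_integral (- cos (m * pi) / m - (- cos (m * (- pi)) / m))) {-pi..pi}"
    by (rule fundamental_theorem_of_calculus)
      (use m in \<open>auto intro!: derivative_eq_intros simp: has_real_derivative_iff_has_vector_derivative[symmetric]\<close>)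
  then show ?thesis unfolding m_def by simp
qed

lemma has_integral_cos_int_shift:
  fixes k l :: nat
  shows "((\<lambda>v. cos ((real k - real l) * (y - v))) has_integral (if k = l then 2 * pi else 0)) {-pi..pi}"
proof -
  have eq: "cos ((real k - real l) * (y - v)) = cos ((real k - real l) * y) * cos ((real k - real l) * v) + sin ((real k - real l) * y) * sin ((real k - real l) * v)" for v
    by (simp add: right_diff_distrib cos_diff)
  have "((\<lambda>v. cos ((real k - real l) * (y - v))) has_integral (cos ((real k - real l) * y) * (if k = l then 2 * pi else 0) + sin ((real k - real l) * y) * 0)) {-pi..pi}"
    unfolding eq by (intro has_integral_add has_integral_mult_right has_integral_cos_int has_integral_sin_int)
  then show ?thesis by (cases "k = l") auto
qed

lemma has_integral_sin_int_shift:
  fixes k l :: nat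
  shows "((\<lambda>v. sin ((real k - real l) * (y - v))) has_integral 0) {-pi..pi}"
proof -
  have eq: "sin ((real k - real l) * (y - v)) = sin ((real k - real l) * y) * cos ((real k - real l) * v) - cos ((real k - real l) * y) * sin ((real k - real l) * v)" for v
    by (simp add: right_diff_distrib sin_diff)
  have "((\<lambda>v. sin ((real k - real l) * (y - v))) has_integral (sin ((real k - real l) * y) * (if k = l then 2 * pi else 0) - cos ((real k - real l) * y) * 0)) {-pi..pi}"
    unfolding eq by (intro has_integral_diff has_integral_mult_right has_integral_cos_int has_integral_sin_int)
  then show ?thesis by (cases "k = l") auto
qed

text \<open>The mean of \<open>moment_kernel j n\<close> over a period.\<close>

definition mean_power :: "nat \<Rightarrow> nat \<Rightarrow> real" where
  "mean_power j n = (1 / real n) * (\<Sum>k=1..n. (real k / real n) ^ (2 * j))"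

lemma diagonal_sum:
  "(\<Sum>k=1..n. \<Sum>l=1..n. (real k / real n) ^ j * (real l / real n) ^ j * (if k = l then c else 0)) = c * (\<Sum>k=1..n. (real k / real n) ^ (2 * j))"
  unfolding sum_distrib_left
proof (rule sum.cong[OF refl])
  fix k assume k: "k \<in> {1..n}"
  have "(\<Sum>l=1..n. (real k / real n) ^ j * (real l / real n) ^ j * (if k = l then c else 0)) = (\<Sum>l=1..n. if k = l then (real k / real n) ^ j * (real k / real n) ^ j * c else 0)"
    by (intro sum.cong) auto
  also have "\<dots> = (real k / real n) ^ j * (real k / real n) ^ j * c" using k by simp
  also have "\<dots> = c * (real k / real n) ^ (2 * j)" by (simp only: power_add mult_2 mult.commute[of c])
  finally show "(\<Sum>l=1..n. (real k / real n) ^ j * (real l / real n) ^ j * (if k = l then c else 0)) = c * (real k / real n) ^ (2 * j)" .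
qed

lemma has_integral_moment_kernel_shift:
  "((\<lambda>v. moment_kernel j n (y - v)) has_integral 2 * pi * mean_power j n) {-pi..pi}"
proof -
  have "((\<lambda>v. moment_kernel j n (y - v)) has_integral (1 / real n) * (\<Sum>k=1..n. \<Sum>l=1..n. (real k / real n) ^ j * (real l / real n) ^ j * (if k = l then 2 * pi else 0))) {-pi..pi}"
    unfolding moment_kernel_def
    by (intro has_integral_mult_right has_integral_sum has_integral_cos_int_shift) auto
  also have "(1 / real n) * (\<Sum>k=1..n. \<Sum>l=1..n. (real k / real n) ^ j * (real l / real n) ^ j * (if k = l then 2 * pi else 0)) = 2 * pi * mean_power j n"
    unfolding diagonal_sum mean_power_def by simp
  finally show ?thesis .
qed

lemma has_integral_cross_kernel_shift: "((\<lambda>v. cross_kernel n (y - v)) has_integral 0) {-pi..pi}"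
proof -
  have "((\<lambda>v. cross_kernel n (y - v)) has_integral (1 / real n) * (\<Sum>k=1..n. \<Sum>l=1..n. (real l / real n) * 0)) {-pi..pi}"
    unfolding cross_kernel_def
    by (intro has_integral_mult_right has_integral_sum has_integral_sin_int_shift) auto
  then show ?thesis by simp
qed

lemma mean_power_bounds: "0 \<le> mean_power j n" "mean_power j n \<le> 1"
proof -
  show "0 \<le> mean_power j n" unfolding mean_power_def by (intro mult_nonneg_nonneg sum_nonneg) auto
  have "(\<Sum>k=1..n. (real k / real n) ^ (2 * j)) \<le> (\<Sum>k=1..n. 1)" by (intro sum_mono power_le_one) auto
  then show "mean_power j n \<le> 1" unfolding mean_power_def by (cases "n = 0") (auto simp: field_simps)
qed

lemma mean_power_0: "0 < n \<Longrightarrow> mean_power 0 n = 1"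
  unfolding mean_power_def by simp

text \<open>This limit is the origin of \<open>sqrt 3\<close>.\<close>

lemma mean_power_1_limit: "(\<lambda>n. mean_power 1 n) \<longlonglongrightarrow> 1 / 3"
proof -
  have s: "(\<Sum>k=1..n. (real k)\<^sup>2) = real n * (real n + 1) * (2 * real n + 1) / 6" for n
    by (induction n) (auto simp: power2_eq_square field_simps)
  have "mean_power 1 n = (real n + 1) * (2 * real n + 1) / (6 * (real n)\<^sup>2)" for n
  proof (cases "n = 0")
    case False
    have "mean_power 1 n = (1 / real n) * ((\<Sum>k=1..n. (real k)\<^sup>2) / (real n)\<^sup>2)"
      unfolding mean_power_def by (simp add: power_divide sum_divide_distrib numeral_2_eq_2)
    also have "\<dots> = (real n + 1) * (2 * real n + 1) / (6 * (real n)\<^sup>2)"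
      unfolding s using False by (simp add: field_simps power2_eq_square)
    finally show ?thesis .
  qed (simp add: mean_power_def)
  moreover have "(\<lambda>n. (real n + 1) * (2 * real n + 1) / (6 * (real n)\<^sup>2)) \<longlonglongrightarrow> 1 / 3" by real_asymp
  ultimately show ?thesis by simp
qed

section \<open>Measures with a Lebesgue decomposition\<close>

text \<open>Induction over measurable functions.\<close>

lemma nn_integral_measure_sum:
  assumes sets: "sets M1 = sets M" "sets M2 = sets M"
    and sum: "\<And>A. A \<in> sets M \<Longrightarrow> emeasure M A = emeasure M1 A + emeasure M2 A"
    and f: "f \<in> borel_measurable M"
  shows "(\<integral>\<^sup>+x. f x \<partial>M) = (\<integral>\<^sup>+x. f x \<partial>M1) + (\<integral>\<^sup>+x. f x \<partial>M2)"
  using f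
proof (induction rule: borel_measurable_induct)
  case (cong f g)
  have sp: "space M1 = space M" "space M2 = space M" using sets by (auto dest: sets_eq_imp_space_eq)
  have "(\<integral>\<^sup>+x. f x \<partial>N) = (\<integral>\<^sup>+x. g x \<partial>N)" if "space N = space M" for N
    using cong(3) that by (intro nn_integral_cong) auto
  then show ?case using cong(4) sp by metis
next
  case (set A)
  then show ?case using sum sets by simp
next
  case (mult u c)
  then show ?case using sets by (simp add: nn_integral_cmult measurable_cong_sets[OF sets(1) refl] measurable_cong_sets[OF sets(2) refl] distrib_left)
next
  case (add u v)
  then show ?case using sets
    by (simp add: nn_integral_add measurable_cong_sets[OF sets(1) refl] measurable_cong_sets[OF sets(2) refl] ac_simps)
next
  case (seq U)
  have m: "U i \<in> borel_measurable M1" "U i \<in> borel_measurable M2" for i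
    using seq(1) sets by (auto simp: measurable_cong_sets[OF sets(1) refl] measurable_cong_sets[OF sets(2) refl])
  have "(\<integral>\<^sup>+x. (SUP i. U i x) \<partial>M) = (SUP i. \<integral>\<^sup>+x. U i x \<partial>M)"
    using seq by (intro nn_integral_monotone_convergence_SUP) auto
  also have "\<dots> = (SUP i. (\<integral>\<^sup>+x. U i x \<partial>M1) + (\<integral>\<^sup>+x. U i x \<partial>M2))"
    using seq by simp
  also have "\<dots> = (SUP i. \<integral>\<^sup>+x. U i x \<partial>M1) + (SUP i. \<integral>\<^sup>+x. U i x \<partial>M2)"
    using seq by (intro ennreal_SUP_add) (auto simp: incseq_def le_fun_def intro!: nn_integral_mono)
  also have "(SUP i. \<integral>\<^sup>+x. U i x \<partial>M1) = (\<integral>\<^sup>+x. (SUP i. U i x) \<partial>M1)"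
    using seq m by (intro nn_integral_monotone_convergence_SUP[symmetric]) auto
  also have "(SUP i. \<integral>\<^sup>+x. U i x \<partial>M2) = (\<integral>\<^sup>+x. (SUP i. U i x) \<partial>M2)"
    using seq m by (intro nn_integral_monotone_convergence_SUP[symmetric]) auto
  finally show ?case by (simp add: image_comp)
qed

locale decomposed_measure = prob_space \<mu> for \<mu> :: "real measure" +
  fixes \<mu>s :: "real measure" and \<psi> :: "real \<Rightarrow> real"
  assumes sets_mu[simp, measurable_cong]: "sets \<mu> = sets borel"
    and carrier: "AE x in \<mu>. x \<in> {-pi..pi}"
    and decomp: "spectral_decomposition \<mu> \<mu>s \<psi>"
begin

lemma sets_mus[simp, measurable_cong]: "sets \<mu>s = sets borel"
  using decomp by (simp add: spectral_decomposition_def lebesgue_singular_def)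

lemma psi_measurable[measurable]: "\<psi> \<in> borel_measurable borel"
  using decomp by (simp add: spectral_decomposition_def)

lemma psi_nonneg: "0 \<le> \<psi> x"
  using decomp by (simp add: spectral_decomposition_def)

lemma psi_periodic: "\<psi> (x + 2 * pi) = \<psi> x"
  using decomp by (simp add: spectral_decomposition_def)

lemma nn_integral_mu:
  assumes [measurable]: "f \<in> borel_measurable borel"
  shows "(\<integral>\<^sup>+x. f x \<partial>\<mu>) = (\<integral>\<^sup>+x. f x \<partial>\<mu>s) + (\<integral>\<^sup>+x. ennreal (\<psi> x) * indicator {-pi..pi} x * f x \<partial>lborel)"
proof -
  define D where "D = density lborel (\<lambda>x. ennreal (\<psi> x) * indicator {-pi..pi} x)"
  have "(\<integral>\<^sup>+x. f x \<partial>\<mu>) = (\<integral>\<^sup>+x. f x \<partial>\<mu>s) + (\<integral>\<^sup>+x. f x \<partial>D)"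
  proof (rule nn_integral_measure_sum)
    show "sets \<mu>s = sets \<mu>" "sets D = sets \<mu>" by (simp_all add: D_def)
    show "f \<in> borel_measurable \<mu>" by measurable
    fix A assume "A \<in> sets \<mu>"
    then have A[measurable]: "A \<in> sets borel" by simp
    have "emeasure D A = (\<integral>\<^sup>+x \<in> A \<inter> {-pi..pi}. ennreal (\<psi> x) \<partial>lborel)"
      unfolding D_def by (subst emeasure_density) (auto intro!: nn_integral_cong simp: indicator_def)
    then show "emeasure \<mu> A = emeasure \<mu>s A + emeasure D A"
      using decomp A unfolding spectral_decomposition_def by auto
  qed
  also have "(\<integral>\<^sup>+x. f x \<partial>D) = (\<integral>\<^sup>+x. ennreal (\<psi> x) * indicator {-pi..pi} x * f x \<partial>lborel)"
    unfolding D_def by (rule nn_integral_density) measurable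
  finally show ?thesis .
qed

lemma total_mass: "emeasure \<mu>s UNIV + (\<integral>\<^sup>+x. ennreal (\<psi> x) * indicator {-pi..pi} x \<partial>lborel) = 1"
proof -
  have "emeasure \<mu> UNIV = 1" using emeasure_space_1 sets_eq_imp_space_eq[OF sets_mu] by simp
  then show ?thesis
    using nn_integral_mu[of "\<lambda>_. 1"] sets_eq_imp_space_eq[OF sets_mu] sets_eq_imp_space_eq[OF sets_mus]
    by simp
qed

lemma mus_mass_le: "emeasure \<mu>s UNIV \<le> 1"
  using total_mass by (metis le_iff_add)

lemma finite_mus: "finite_measure \<mu>s"
  using mus_mass_le sets_eq_imp_space_eq[OF sets_mus] by (intro finite_measureI) (auto simp: top_unique)

lemma psi_mass_le: "(\<integral>\<^sup>+x. ennreal (\<psi> x) * indicator {-pi..pi} x \<partial>lborel) \<le> 1"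
  using total_mass by (metis add.commute le_iff_add)

lemma carrier_mus: "AE x in \<mu>s. x \<in> {-pi..pi}"
proof -
  have "(\<integral>\<^sup>+x. indicator (- {-pi..pi}) x \<partial>\<mu>) = 0"
    using carrier by (subst nn_integral_0_iff_AE) (auto elim!: eventually_mono simp: indicator_def)
  then have "(\<integral>\<^sup>+x. indicator (- {-pi..pi}) x \<partial>\<mu>s) = 0"
    using nn_integral_mu[of "indicator (- {-pi..pi})"] by simp
  then show ?thesis by (subst (asm) nn_integral_0_iff_AE) (auto elim!: eventually_mono simp: indicator_def split: if_splits)
qed

lemma integrable_psi: "integrable lborel (\<lambda>x. \<psi> x * indicator {-pi..pi} x)"
proof (rule integrableI_nonneg)
  have "(\<integral>\<^sup>+x. ennreal (\<psi> x * indicator {-pi..pi} x) \<partial>lborel) = (\<integral>\<^sup>+x. ennreal (\<psi> x) * indicator {-pi..pi} x \<partial>lborel)"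
    by (intro nn_integral_cong) (auto simp: indicator_def)
  also have "\<dots> < \<infinity>" using psi_mass_le by (rule order_le_less_trans) simp
  finally show "(\<integral>\<^sup>+x. ennreal (\<psi> x * indicator {-pi..pi} x) \<partial>lborel) < \<infinity>" .
qed (auto simp: psi_nonneg)

lemma integral_mu:
  fixes f :: "real \<Rightarrow> real"
  assumes fm[measurable]: "f \<in> borel_measurable borel" and b: "\<And>x. \<bar>f x\<bar> \<le> K"
  shows "(\<integral>x. f x \<partial>\<mu>) = (\<integral>x. f x \<partial>\<mu>s) + (\<integral>x. f x * (\<psi> x * indicator {-pi..pi} x) \<partial>lborel)"
    and "integrable \<mu>s f" and "integrable lborel (\<lambda>x. f x * (\<psi> x * indicator {-pi..pi} x))"
proof -
  interpret s: finite_measure \<mu>s by (rule finite_mus)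
  have i1: "integrable \<mu> f" by (rule integrable_const_bound[of _ K]) (use b in auto)
  show i2: "integrable \<mu>s f" by (rule s.integrable_const_bound[of _ K]) (use b in auto)
  show i3: "integrable lborel (\<lambda>x. f x * (\<psi> x * indicator {-pi..pi} x))"
  proof (rule Bochner_Integration.integrable_bound[OF integrable_mult_left[OF integrable_psi, of K]])
    show "AE x in lborel. norm (f x * (\<psi> x * indicator {-pi..pi} x)) \<le> norm (\<psi> x * indicator {-pi..pi} x * K)"
    proof (rule AE_I2)
      fix x
      have "\<bar>f x\<bar> * \<bar>\<psi> x * indicator {-pi..pi} x\<bar> \<le> \<bar>K\<bar> * \<bar>\<psi> x * indicator {-pi..pi} x\<bar>"
        using b[of x] by (intro mult_right_mono) auto
      then show "norm (f x * (\<psi> x * indicator {-pi..pi} x)) \<le> norm (\<psi> x * indicator {-pi..pi} x * K)"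
        by (simp add: abs_mult mult_ac)
    qed
  qed measurable
  have fin: "(\<integral>\<^sup>+x. ennreal (g x) \<partial>\<mu>s) < top" "(\<integral>\<^sup>+x. ennreal (\<psi> x) * indicator {-pi..pi} x * ennreal (g x) \<partial>lborel) < top"
    and gm: "g \<in> borel_measurable borel" if "g = f \<or> g = (\<lambda>x. - f x)" for g
  proof -
    show g[measurable]: "g \<in> borel_measurable borel" using that by auto
    have ib: "ennreal (g x) \<le> ennreal K" for x using that b[of x] by (auto intro!: ennreal_leI simp: abs_le_iff)
    have "(\<integral>\<^sup>+x. ennreal (g x) \<partial>\<mu>) \<le> (\<integral>\<^sup>+x. ennreal K \<partial>\<mu>)" by (intro nn_integral_mono ib)
    also have "\<dots> < top" by (simp add: emeasure_space_1)
    finally show "(\<integral>\<^sup>+x. ennreal (g x) \<partial>\<mu>s) < top" "(\<integral>\<^sup>+x. ennreal (\<psi> x) * indicator {-pi..pi} x * ennreal (g x) \<partial>lborel) < top"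
      by (simp_all add: nn_integral_mu)
  qed
  have conv: "(\<integral>\<^sup>+x. ennreal (\<psi> x) * indicator {-pi..pi} x * ennreal (g x) \<partial>lborel) = (\<integral>\<^sup>+x. ennreal (g x * (\<psi> x * indicator {-pi..pi} x)) \<partial>lborel)" for g
    by (intro nn_integral_cong) (auto simp: indicator_def ennreal_mult'[OF psi_nonneg] mult.commute ennreal_mult''[OF psi_nonneg])
  have p: "enn2real (\<integral>\<^sup>+x. ennreal (g x) \<partial>\<mu>) = enn2real (\<integral>\<^sup>+x. ennreal (g x) \<partial>\<mu>s) + enn2real (\<integral>\<^sup>+x. ennreal (g x * (\<psi> x * indicator {-pi..pi} x)) \<partial>lborel)"
    if g: "g = f \<or> g = (\<lambda>x. - f x)" for g
    using fin[OF g] gm[OF g] by (simp add: nn_integral_mu enn2real_plus conv)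
  show "(\<integral>x. f x \<partial>\<mu>) = (\<integral>x. f x \<partial>\<mu>s) + (\<integral>x. f x * (\<psi> x * indicator {-pi..pi} x) \<partial>lborel)"
    unfolding real_lebesgue_integral_def[OF i1] real_lebesgue_integral_def[OF i2] real_lebesgue_integral_def[OF i3]
    using p[of f] p[of "\<lambda>x. - f x"] by simp
qed

end

section \<open>Approximating the density and the singular part\<close>

text \<open>Truncate \<open>\<psi>\<close>, write the truncation as an almost everywhere limit of continuous functions, clip these to the
  same range and use dominated convergence.\<close>

lemma continuous_L1_approx:
  fixes \<psi> :: "real \<Rightarrow> real"
  assumes m[measurable]: "\<psi> \<in> borel_measurable borel" and nn: "\<And>x. 0 \<le> \<psi> x"
    and fin: "(\<integral>\<^sup>+x. ennreal (\<psi> x) * indicator {a..b} x \<partial>lborel) < \<infinity>" and d: "0 < \<delta>"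
  obtains g G where "continuous_on UNIV g" "\<And>x. \<bar>g x\<bar> \<le> G"
    "(\<integral>\<^sup>+x. ennreal \<bar>\<psi> x - g x\<bar> * indicator {a..b} x \<partial>lborel) \<le> ennreal \<delta>"
proof -
  have "(\<lambda>i. \<integral>\<^sup>+x. ennreal \<bar>\<psi> x - min (\<psi> x) (real i)\<bar> * indicator {a..b} x \<partial>lborel) \<longlonglongrightarrow> (\<integral>\<^sup>+x. 0 \<partial>(lborel :: real measure))"
  proof (rule nn_integral_dominated_convergence[where w="\<lambda>x. ennreal (\<psi> x) * indicator {a..b} x"])
    show "AE x in lborel. ennreal \<bar>\<psi> x - min (\<psi> x) (real i)\<bar> * indicator {a..b} x \<le> ennreal (\<psi> x) * indicator {a..b} x" for i
      using nn by (intro AE_I2 mult_right_mono ennreal_leI) (auto simp: min_def)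
    show "AE x in lborel. (\<lambda>i. ennreal \<bar>\<psi> x - min (\<psi> x) (real i)\<bar> * indicator {a..b} x) \<longlonglongrightarrow> 0"
    proof (rule AE_I2, rule tendsto_eventually)
      fix x
      obtain i0 where "\<psi> x \<le> real i0" using real_arch_simple by blast
      then show "\<forall>\<^sub>F i in sequentially. ennreal \<bar>\<psi> x - min (\<psi> x) (real i)\<bar> * indicator {a..b} x = 0"
        by (intro eventually_sequentiallyI[of i0]) (auto simp: min_def)
    qed
  qed (use fin in auto)
  then have "\<forall>\<^sub>F i in sequentially. (\<integral>\<^sup>+x. ennreal \<bar>\<psi> x - min (\<psi> x) (real i)\<bar> * indicator {a..b} x \<partial>lborel) < ennreal (\<delta> / 2)"
    using d by (intro order_tendstoD) auto
  then obtain i where i: "(\<integral>\<^sup>+x. ennreal \<bar>\<psi> x - min (\<psi> x) (real i)\<bar> * indicator {a..b} x \<partial>lborel) < ennreal (\<delta> / 2)"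
    by (auto simp: eventually_sequentially)
  define \<phi> where "\<phi> x = min (\<psi> x) (real i)" for x
  have \<phi>m[measurable]: "\<phi> \<in> borel_measurable borel" unfolding \<phi>_def by measurable
  have \<phi>b: "0 \<le> \<phi> x" "\<phi> x \<le> real i" for x unfolding \<phi>_def using nn by auto
  have "\<phi> \<in> borel_measurable (lebesgue_on {a..b})"
    by (intro measurable_restrict_space1 measurable_completion) simp
  then have "\<phi> measurable_on {a..b}" by (subst measurable_on_iff_borel_measurable) auto
  then obtain N h where N: "negligible N" and hc: "\<And>n. continuous_on UNIV (h n)"
    and hl: "\<And>x. x \<notin> N \<Longrightarrow> (\<lambda>n. h n x) \<longlonglongrightarrow> (if x \<in> {a..b} then \<phi> x else 0)"
    unfolding measurable_on_def by auto
  define g where "g n x = max 0 (min (real i) (h n x))" for n x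
  have gc: "continuous_on UNIV (g n)" for n unfolding g_def by (intro continuous_intros hc)
  have gm[measurable]: "g n \<in> borel_measurable borel" for n using gc by (rule borel_measurable_continuous_onI)
  have gb: "0 \<le> g n x" "g n x \<le> real i" for n x unfolding g_def by auto
  have AEN: "AE x in lborel. x \<notin> N"
  proof -
    have "AE x in lebesgue. x \<notin> N" using N by (auto simp: negligible_iff_null_sets intro: AE_not_in)
    then show ?thesis by (simp add: AE_completion_iff)
  qed
  have "(\<lambda>n. \<integral>\<^sup>+x. ennreal \<bar>\<phi> x - g n x\<bar> * indicator {a..b} x \<partial>lborel) \<longlonglongrightarrow> (\<integral>\<^sup>+x. 0 \<partial>(lborel :: real measure))"
  proof (rule nn_integral_dominated_convergence[where w="\<lambda>x. ennreal (real i) * indicator {a..b} x"])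
    show "AE x in lborel. ennreal \<bar>\<phi> x - g n x\<bar> * indicator {a..b} x \<le> ennreal (real i) * indicator {a..b} x" for n
    proof (rule AE_I2, rule mult_right_mono, rule ennreal_leI)
      show "\<bar>\<phi> x - g n x\<bar> \<le> real i" for x using \<phi>b[of x] gb[of n x] by linarith
    qed simp
    show "(\<integral>\<^sup>+x. ennreal (real i) * indicator {a..b} x \<partial>lborel) < \<infinity>"
      by (simp add: nn_integral_cmult_indicator ennreal_mult_less_top emeasure_lborel_Icc_eq)
    show "AE x in lborel. (\<lambda>n. ennreal \<bar>\<phi> x - g n x\<bar> * indicator {a..b} x) \<longlonglongrightarrow> 0"
      using AEN
    proof eventually_elim
      fix x assume x: "x \<notin> N"
      show "(\<lambda>n. ennreal \<bar>\<phi> x - g n x\<bar> * indicator {a..b} x) \<longlonglongrightarrow> 0"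
      proof (cases "x \<in> {a..b}")
        case True
        then have "(\<lambda>n. h n x) \<longlonglongrightarrow> \<phi> x" using hl[OF x] by simp
        then have "(\<lambda>n. g n x) \<longlonglongrightarrow> max 0 (min (real i) (\<phi> x))" unfolding g_def by (intro tendsto_intros)
        then have "(\<lambda>n. g n x) \<longlonglongrightarrow> \<phi> x" using \<phi>b[of x] by (simp add: max_absorb2 min_absorb2)
        then have "(\<lambda>n. \<bar>\<phi> x - g n x\<bar>) \<longlonglongrightarrow> \<bar>\<phi> x - \<phi> x\<bar>" by (intro tendsto_intros)
        then have "(\<lambda>n. ennreal \<bar>\<phi> x - g n x\<bar>) \<longlonglongrightarrow> ennreal \<bar>\<phi> x - \<phi> x\<bar>" by (rule tendsto_ennrealI)
        then show ?thesis using True by simp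
      qed simp
    qed
  qed auto
  then have "\<forall>\<^sub>F n in sequentially. (\<integral>\<^sup>+x. ennreal \<bar>\<phi> x - g n x\<bar> * indicator {a..b} x \<partial>lborel) < ennreal (\<delta> / 2)"
    using d by (intro order_tendstoD) auto
  then obtain n where n: "(\<integral>\<^sup>+x. ennreal \<bar>\<phi> x - g n x\<bar> * indicator {a..b} x \<partial>lborel) < ennreal (\<delta> / 2)"
    by (auto simp: eventually_sequentially)
  show ?thesis
  proof (rule that[of "g n" "real i"])
    show "continuous_on UNIV (g n)" by (rule gc)
    show "\<bar>g n x\<bar> \<le> real i" for x using gb[of n x] by simp
    have "(\<integral>\<^sup>+x. ennreal \<bar>\<psi> x - g n x\<bar> * indicator {a..b} x \<partial>lborel) \<le>
       (\<integral>\<^sup>+x. ennreal \<bar>\<psi> x - \<phi> x\<bar> * indicator {a..b} x + ennreal \<bar>\<phi> x - g n x\<bar> * indicator {a..b} x \<partial>lborel)"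
      unfolding distrib_right[symmetric]
      by (intro nn_integral_mono mult_right_mono) (auto simp: ennreal_plus[symmetric] simp del: ennreal_plus intro!: ennreal_leI)
    also have "\<dots> = (\<integral>\<^sup>+x. ennreal \<bar>\<psi> x - \<phi> x\<bar> * indicator {a..b} x \<partial>lborel) + (\<integral>\<^sup>+x. ennreal \<bar>\<phi> x - g n x\<bar> * indicator {a..b} x \<partial>lborel)"
      by (rule nn_integral_add) measurable
    also have "\<dots> \<le> ennreal (\<delta> / 2) + ennreal (\<delta> / 2)"
      using i n unfolding \<phi>_def by (intro add_mono less_imp_le)
    also have "\<dots> = ennreal \<delta>" using d by (simp add: ennreal_plus[symmetric] del: ennreal_plus)
    finally show "(\<integral>\<^sup>+x. ennreal \<bar>\<psi> x - g n x\<bar> * indicator {a..b} x \<partial>lborel) \<le> ennreal \<delta>" .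
  qed
qed

text \<open>The closed neighbourhoods of a compact set decrease to it.\<close>

lemma compact_null_nbhd:
  fixes F :: "real set"
  assumes F: "compact F" "F \<noteq> {}" "emeasure lborel F = 0" and b: "0 < \<beta>"
  obtains \<eta> where "0 < \<eta>" "emeasure lborel {x \<in> {-pi..pi}. infdist x F \<le> \<eta>} \<le> ennreal \<beta>"
proof -
  define A where "A j = {x \<in> {-pi..pi}. infdist x F \<le> 1 / real (Suc j)}" for j
  have Ac: "closed (A j)" for j
  proof -
    have "A j = {-pi..pi} \<inter> {x. infdist x F \<le> 1 / real (Suc j)}" unfolding A_def by auto
    moreover have "closed {x. infdist x F \<le> 1 / real (Suc j)}" by (intro closed_Collect_le continuous_intros)
    ultimately show ?thesis by (auto intro: closed_Int)
  qed
  have Am[measurable]: "A j \<in> sets borel" for j using Ac by (rule borel_closed)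
  have dec: "decseq A"
  proof (rule decseq_SucI)
    fix j
    have "1 / real (Suc (Suc j)) \<le> 1 / real (Suc j)" by (intro divide_left_mono) auto
    then show "A (Suc j) \<subseteq> A j" unfolding A_def by (auto intro: order_trans)
  qed
  have sub: "(\<Inter>j. A j) \<subseteq> F"
  proof
    fix x assume x: "x \<in> (\<Inter>j. A j)"
    have "infdist x F \<le> 1 / real (Suc j)" for j using x unfolding A_def by auto
    moreover have "(\<lambda>j. 1 / real (Suc j)) \<longlonglongrightarrow> 0" by real_asymp
    ultimately have "infdist x F \<le> 0" by (intro LIMSEQ_le_const) auto
    then have "infdist x F = 0" using infdist_nonneg[of x F] by linarith
    then show "x \<in> F" using F in_closed_iff_infdist_zero compact_imp_closed by blast
  qed
  have "emeasure lborel (\<Inter>j. A j) \<le> emeasure lborel F" using sub borel_closed[OF compact_imp_closed[OF F(1)]] by (intro emeasure_mono) simp_all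
  then have z: "emeasure lborel (\<Inter>j. A j) = 0" using F(3) by simp
  have "(\<lambda>j. emeasure lborel (A j)) \<longlonglongrightarrow> emeasure lborel (\<Inter>j. A j)"
  proof (rule Lim_emeasure_decseq)
    show "emeasure lborel (A j) \<noteq> \<infinity>" for j
    proof -
      have "emeasure lborel (A j) \<le> emeasure lborel {-pi..pi}" unfolding A_def by (intro emeasure_mono) auto
      then show ?thesis by (auto simp: emeasure_lborel_Icc_eq top_unique)
    qed
  qed (use dec Am in auto)
  then have "\<forall>\<^sub>F j in sequentially. emeasure lborel (A j) < ennreal \<beta>"
    using b unfolding z by (intro order_tendstoD) auto
  then obtain j where "emeasure lborel (A j) < ennreal \<beta>" by (auto simp: eventually_sequentially)
  then show ?thesis by (intro that[of "1 / real (Suc j)"]) (auto simp: A_def)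
qed

section \<open>Convolution with kernels of mean zero\<close>

lemma envelope_le: "envelope n v \<le> real n"
proof -
  have "real n / (1 + (real n * sin (v / 2))\<^sup>2) \<le> real n / 1"
    by (rule divide_left_mono) (auto intro: add_pos_nonneg)
  then show ?thesis unfolding envelope_def by simp
qed

lemma envelope_conv_integral:
  assumes "\<bar>x\<bar> \<le> pi"
  shows "(\<integral>\<^sup>+u. ennreal (envelope n (x - u)) * indicator {-pi..pi} u \<partial>lborel) \<le> ennreal (4 * pi)"
    and "(\<integral>\<^sup>+u. ennreal (envelope n (u - x)) * indicator {-pi..pi} u \<partial>lborel) \<le> ennreal (4 * pi)"
proof -
  have "(\<integral>\<^sup>+u. ennreal (envelope n (u + (- x))) * indicator {-pi..-pi + 2 * pi} u \<partial>lborel) = (\<integral>\<^sup>+u. ennreal (envelope n u) * indicator {-pi..-pi + 2 * pi} u \<partial>lborel)"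
    by (rule nn_integral_period_shift) (use assms in \<open>auto simp: envelope_periodic\<close>)
  then show 1: "(\<integral>\<^sup>+u. ennreal (envelope n (u - x)) * indicator {-pi..pi} u \<partial>lborel) \<le> ennreal (4 * pi)"
    using envelope_integral[of n] by simp
  have "envelope n (x - u) = envelope n (u - x)" for u using envelope_even[of n "x - u"] by simp
  then show "(\<integral>\<^sup>+u. ennreal (envelope n (x - u)) * indicator {-pi..pi} u \<partial>lborel) \<le> ennreal (4 * pi)"
    using 1 by (simp only:)
qed

text \<open>Near \<open>x\<close> the oscillation of \<open>g\<close> is small, and away from \<open>x\<close> the envelope is.\<close>

lemma envelope_modulus_bound:
  assumes n: "0 < n" and eta: "0 < \<eta>" and x: "x \<in> {-pi + \<eta>..pi - \<eta>}" and w: "0 \<le> w"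
    and gm[measurable]: "g \<in> borel_measurable borel" and gb: "\<And>x. \<bar>g x\<bar> \<le> G"
    and mod: "\<And>u. u \<in> {-pi..pi} \<Longrightarrow> \<bar>u - x\<bar> < \<eta> \<Longrightarrow> \<bar>g u - g x\<bar> \<le> w"
  shows "(\<integral>\<^sup>+u. ennreal (envelope n (x - u)) * (ennreal \<bar>g u - g x\<bar> * indicator {-pi..pi} u) \<partial>lborel)
    \<le> ennreal (w * (4 * pi) + 2 * G * (2 * pi) / (real n * (sin (\<eta> / 2))\<^sup>2))"
proof -
  define c where "c = 1 / (real n * (sin (\<eta> / 2))\<^sup>2)"
  have c0: "0 \<le> c" unfolding c_def by simp
  have G0: "0 \<le> G" using gb[of 0] by linarith
  have "(\<integral>\<^sup>+u. ennreal (envelope n (x - u)) * (ennreal \<bar>g u - g x\<bar> * indicator {-pi..pi} u) \<partial>lborel)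
     \<le> (\<integral>\<^sup>+u. ennreal w * (ennreal (envelope n (x - u)) * indicator {-pi..pi} u) + ennreal (2 * G * c) * indicator {-pi..pi} u \<partial>lborel)"
  proof (intro nn_integral_mono)
    fix u
    show "ennreal (envelope n (x - u)) * (ennreal \<bar>g u - g x\<bar> * indicator {-pi..pi} u) \<le>
       ennreal w * (ennreal (envelope n (x - u)) * indicator {-pi..pi} u) + ennreal (2 * G * c) * indicator {-pi..pi} u"
    proof (cases "u \<in> {-pi..pi}")
      case u: True
      have "envelope n (x - u) * \<bar>g u - g x\<bar> \<le> w * envelope n (x - u) + 2 * G * c"
      proof (cases "\<bar>u - x\<bar> < \<eta>")
        case True
        have "envelope n (x - u) * \<bar>g u - g x\<bar> \<le> envelope n (x - u) * w"
          using mod[OF u True] envelope_nonneg by (intro mult_left_mono) auto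
        then show ?thesis using G0 c0 by (simp add: mult.commute add_increasing2)
      next
        case False
        have "envelope n (x - u) \<le> c" unfolding c_def using n eta x u False by (intro envelope_far) auto
        moreover have "\<bar>g u - g x\<bar> \<le> 2 * G" using gb[of u] gb[of x] by linarith
        ultimately have "envelope n (x - u) * \<bar>g u - g x\<bar> \<le> c * (2 * G)"
          using c0 envelope_nonneg by (intro mult_mono) auto
        then show ?thesis using w envelope_nonneg[of n "x - u"] by (simp add: mult.commute mult.left_commute add_increasing)
      qed
      then have "ennreal (envelope n (x - u) * \<bar>g u - g x\<bar>) \<le> ennreal (w * envelope n (x - u) + 2 * G * c)" by (rule ennreal_leI)
      then show ?thesis using u w G0 c0 envelope_nonneg[of n "x - u"] by (simp add: ennreal_mult ennreal_plus)
    qed simp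
  qed
  also have "\<dots> = ennreal w * (\<integral>\<^sup>+u. ennreal (envelope n (x - u)) * indicator {-pi..pi} u \<partial>lborel) + ennreal (2 * G * c) * emeasure lborel {-pi..pi}"
    by (subst nn_integral_add) (auto simp: nn_integral_cmult nn_integral_cmult_indicator)
  also have "\<dots> \<le> ennreal w * ennreal (4 * pi) + ennreal (2 * G * c) * ennreal (2 * pi)"
    using x eta by (intro add_mono mult_left_mono envelope_conv_integral) (auto simp: abs_le_iff)
  also have "\<dots> = ennreal (w * (4 * pi) + 2 * G * (2 * pi) / (real n * (sin (\<eta> / 2))\<^sup>2))"
    using w G0 c0 by (simp add: ennreal_mult[symmetric] ennreal_plus[symmetric] c_def mult_ac del: ennreal_plus)
  finally show ?thesis .
qed

text \<open>Convolution with the envelope is bounded on \<open>L\<^sup>1\<close> uniformly in \<open>n\<close>; through Markov's inequality this takes the place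
  of a maximal inequality.\<close>

lemma envelope_conv_mass:
  assumes [simp, measurable_cong]: "sets \<nu> = sets borel" and fin: "finite_measure \<nu>" and car: "AE u in \<nu>. u \<in> {-pi..pi}"
    and q[measurable]: "q \<in> borel_measurable borel"
  shows "(\<integral>\<^sup>+x. (\<integral>\<^sup>+u. ennreal (envelope n (x - u)) * q u \<partial>\<nu>) * indicator {-pi..pi} x \<partial>lborel) \<le> ennreal (4 * pi) * (\<integral>\<^sup>+u. q u \<partial>\<nu>)"
proof -
  interpret v: finite_measure \<nu> by (rule fin)
  interpret P: pair_sigma_finite \<nu> "lborel :: real measure" ..
  have "(\<integral>\<^sup>+x. (\<integral>\<^sup>+u. ennreal (envelope n (x - u)) * q u \<partial>\<nu>) * indicator {-pi..pi} x \<partial>lborel)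
      = (\<integral>\<^sup>+x. (\<integral>\<^sup>+u. ennreal (envelope n (x - u)) * indicator {-pi..pi} x * q u \<partial>\<nu>) \<partial>lborel)"
    by (intro nn_integral_cong) (auto simp: indicator_def)
  also have "\<dots> = (\<integral>\<^sup>+u. (\<integral>\<^sup>+x. ennreal (envelope n (x - u)) * indicator {-pi..pi} x * q u \<partial>lborel) \<partial>\<nu>)"
    by (rule P.Fubini') measurable
  also have "\<dots> = (\<integral>\<^sup>+u. (\<integral>\<^sup>+x. ennreal (envelope n (x - u)) * indicator {-pi..pi} x \<partial>lborel) * q u \<partial>\<nu>)"
    by (intro nn_integral_cong nn_integral_multc) measurable
  also have "\<dots> \<le> (\<integral>\<^sup>+u. ennreal (4 * pi) * q u \<partial>\<nu>)"
    by (rule nn_integral_mono_AE, use car in eventually_elim) (auto intro!: mult_right_mono envelope_conv_integral(2) simp: abs_le_iff)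
  also have "\<dots> = ennreal (4 * pi) * (\<integral>\<^sup>+u. q u \<partial>\<nu>)" by (rule nn_integral_cmult) measurable
  finally show ?thesis .
qed

context decomposed_measure
begin

text \<open>As the kernel has mean zero, the part \<open>g\<close> of the density may be replaced by \<open>g - g x\<close>; each of the three
  remaining pieces is estimated by the envelope.\<close>

lemma zero_mean_kernel_pointwise:
  fixes \<kappa> g :: "real \<Rightarrow> real"
  assumes kc: "continuous_on UNIV \<kappa>" and kb: "\<And>v. \<bar>\<kappa> v\<bar> \<le> A * envelope n v" and A: "0 \<le> A"
    and zero: "\<And>y. ((\<lambda>u. \<kappa> (y - u)) has_integral 0) {-pi..pi}"
    and gc: "continuous_on UNIV g" and gb: "\<And>x. \<bar>g x\<bar> \<le> G"
    and t: "0 \<le> t" "t \<le> 1 / (4 * real n)"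
  shows "ennreal \<bar>\<integral>u. \<kappa> (x + t - u) \<partial>\<mu>\<bar> \<le> ennreal (3 * A) *
    ((\<integral>\<^sup>+u. ennreal (envelope n (x - u)) \<partial>\<mu>s)
      + (\<integral>\<^sup>+u. ennreal (envelope n (x - u)) * (ennreal \<bar>\<psi> u - g u\<bar> * indicator {-pi..pi} u) \<partial>lborel)
      + (\<integral>\<^sup>+u. ennreal (envelope n (x - u)) * (ennreal \<bar>g u - g x\<bar> * indicator {-pi..pi} u) \<partial>lborel))"
proof -
  define h where "h u = \<kappa> (x + t - u)" for u
  define I :: "real \<Rightarrow> real" where "I = indicator {-pi..pi}"
  have [measurable]: "I \<in> borel_measurable borel" unfolding I_def by simp
  have [measurable]: "\<kappa> \<in> borel_measurable borel" "g \<in> borel_measurable borel"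
    using kc gc by (auto intro: borel_measurable_continuous_onI)
  have hm[measurable]: "h \<in> borel_measurable borel" unfolding h_def by measurable
  have hb: "\<bar>h u\<bar> \<le> 3 * A * envelope n (x - u)" for u
  proof -
    have "\<bar>h u\<bar> \<le> A * envelope n (x - u + t)" using kb[of "x + t - u"] unfolding h_def by (simp add: algebra_simps)
    also have "\<dots> \<le> A * (3 * envelope n (x - u))" using A t by (intro mult_left_mono envelope_shift) auto
    finally show ?thesis by simp
  qed
  have hK: "\<bar>h u\<bar> \<le> 3 * A * real n" for u
    by (rule order_trans[OF hb]) (use A envelope_le in \<open>auto intro!: mult_left_mono\<close>)
  note dec = integral_mu[OF hm hK]
  have G0: "0 \<le> G" using gb[of 0] by linarith
  have intI: "integrable lborel I" unfolding I_def by simp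
  have ih: "integrable lborel (\<lambda>u. h u * I u)"
    by (rule Bochner_Integration.integrable_bound[OF integrable_mult_right[OF intI, of "3 * A * real n"]])
      (use hK A in \<open>auto simp: abs_mult I_def indicator_def\<close>)
  have ig: "integrable lborel (\<lambda>u. h u * ((g u - g x) * I u))"
  proof (rule Bochner_Integration.integrable_bound[OF integrable_mult_right[OF intI, of "3 * A * real n * (2 * G)"]])
    show "AE u in lborel. norm (h u * ((g u - g x) * I u)) \<le> norm (3 * A * real n * (2 * G) * I u)"
    proof (rule AE_I2)
      fix u
      have "\<bar>g u - g x\<bar> \<le> 2 * G" using gb[of u] gb[of x] by linarith
      then have "\<bar>h u\<bar> * \<bar>g u - g x\<bar> \<le> (3 * A * real n) * (2 * G)" using hK A by (intro mult_mono) auto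
      then show "norm (h u * ((g u - g x) * I u)) \<le> norm (3 * A * real n * (2 * G) * I u)"
        using A G0 by (auto simp: abs_mult I_def indicator_def)
    qed
  qed measurable
  have ip: "integrable lborel (\<lambda>u. h u * (\<psi> u * I u))" using dec(3) unfolding I_def .
  have id: "integrable lborel (\<lambda>u. h u * ((\<psi> u - g u) * I u))"
  proof -
    have "integrable lborel (\<lambda>u. h u * (\<psi> u * I u) - h u * ((g u - g x) * I u) - g x * (h u * I u))"
      using ip ig ih by (intro Bochner_Integration.integrable_diff integrable_mult_right)
    then show ?thesis by (simp add: algebra_simps)
  qed
  have h0: "(\<integral>u. h u * I u \<partial>lborel) = 0"
  proof -
    have "set_integrable lborel {-pi..pi} h" using ih unfolding set_integrable_def I_def by (simp add: mult.commute)
    then have "(LINT u:{-pi..pi}|lborel. h u) = integral {-pi..pi} h" by (rule set_borel_integral_eq_integral)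
    also have "\<dots> = 0" using zero[of "x + t"] unfolding h_def by (rule integral_unique)
    finally show ?thesis unfolding set_lebesgue_integral_def I_def by (simp add: mult.commute)
  qed
  have "(\<integral>u. h u * (\<psi> u * I u) \<partial>lborel) = (\<integral>u. (h u * ((\<psi> u - g u) * I u) + h u * ((g u - g x) * I u)) + g x * (h u * I u) \<partial>lborel)"
    by (simp add: algebra_simps)
  also have "\<dots> = (\<integral>u. h u * ((\<psi> u - g u) * I u) \<partial>lborel) + (\<integral>u. h u * ((g u - g x) * I u) \<partial>lborel)"
    using id ig ih h0 by simp
  finally have "(\<integral>u. h u \<partial>\<mu>) = (\<integral>u. h u \<partial>\<mu>s) + ((\<integral>u. h u * ((\<psi> u - g u) * I u) \<partial>lborel) + (\<integral>u. h u * ((g u - g x) * I u) \<partial>lborel))"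
    using dec(1) unfolding I_def by simp
  then have "\<bar>\<integral>u. h u \<partial>\<mu>\<bar> \<le> \<bar>\<integral>u. h u \<partial>\<mu>s\<bar> + (\<bar>\<integral>u. h u * ((\<psi> u - g u) * I u) \<partial>lborel\<bar> + \<bar>\<integral>u. h u * ((g u - g x) * I u) \<partial>lborel\<bar>)"
    by linarith
  then have "ennreal \<bar>\<integral>u. h u \<partial>\<mu>\<bar> \<le> ennreal \<bar>\<integral>u. h u \<partial>\<mu>s\<bar> + (ennreal \<bar>\<integral>u. h u * ((\<psi> u - g u) * I u) \<partial>lborel\<bar> + ennreal \<bar>\<integral>u. h u * ((g u - g x) * I u) \<partial>lborel\<bar>)"
    by (simp add: ennreal_plus[symmetric] ennreal_leI del: ennreal_plus)
  also have "\<dots> \<le> (\<integral>\<^sup>+u. ennreal (3 * A) * ennreal (envelope n (x - u)) \<partial>\<mu>s)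
      + ((\<integral>\<^sup>+u. ennreal (3 * A) * (ennreal (envelope n (x - u)) * (ennreal \<bar>\<psi> u - g u\<bar> * indicator {-pi..pi} u)) \<partial>lborel)
      + (\<integral>\<^sup>+u. ennreal (3 * A) * (ennreal (envelope n (x - u)) * (ennreal \<bar>g u - g x\<bar> * indicator {-pi..pi} u)) \<partial>lborel))"
  proof (intro add_mono)
    have "ennreal \<bar>\<integral>u. h u \<partial>\<mu>s\<bar> \<le> (\<integral>\<^sup>+u. ennreal \<bar>h u\<bar> \<partial>\<mu>s)"
      using integral_norm_bound_ennreal[OF dec(2)] by simp
    also have "\<dots> \<le> (\<integral>\<^sup>+u. ennreal (3 * A) * ennreal (envelope n (x - u)) \<partial>\<mu>s)"
      using hb A by (intro nn_integral_mono) (simp add: ennreal_mult'[symmetric] ennreal_leI)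
    finally show "ennreal \<bar>\<integral>u. h u \<partial>\<mu>s\<bar> \<le> (\<integral>\<^sup>+u. ennreal (3 * A) * ennreal (envelope n (x - u)) \<partial>\<mu>s)" .
    have gen: "ennreal \<bar>\<integral>u. h u * (q u * I u) \<partial>lborel\<bar> \<le> (\<integral>\<^sup>+u. ennreal (3 * A) * (ennreal (envelope n (x - u)) * (ennreal \<bar>q u\<bar> * indicator {-pi..pi} u)) \<partial>lborel)"
      if "integrable lborel (\<lambda>u. h u * (q u * I u))" for q
    proof -
      have "ennreal \<bar>\<integral>u. h u * (q u * I u) \<partial>lborel\<bar> \<le> (\<integral>\<^sup>+u. ennreal \<bar>h u * (q u * I u)\<bar> \<partial>lborel)"
        using integral_norm_bound_ennreal[OF that] by simp
      also have "\<dots> \<le> (\<integral>\<^sup>+u. ennreal (3 * A) * (ennreal (envelope n (x - u)) * (ennreal \<bar>q u\<bar> * indicator {-pi..pi} u)) \<partial>lborel)"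
      proof (intro nn_integral_mono)
        fix u
        have "\<bar>h u\<bar> * \<bar>q u\<bar> \<le> 3 * A * envelope n (x - u) * \<bar>q u\<bar>" by (intro mult_right_mono hb) auto
        then show "ennreal \<bar>h u * (q u * I u)\<bar> \<le> ennreal (3 * A) * (ennreal (envelope n (x - u)) * (ennreal \<bar>q u\<bar> * indicator {-pi..pi} u))"
          using A envelope_nonneg[of n "x - u"]
          by (auto simp: I_def indicator_def abs_mult ennreal_mult'[symmetric] mult.assoc intro!: ennreal_leI)
      qed
      finally show ?thesis .
    qed
    show "ennreal \<bar>\<integral>u. h u * ((\<psi> u - g u) * I u) \<partial>lborel\<bar> \<le> (\<integral>\<^sup>+u. ennreal (3 * A) * (ennreal (envelope n (x - u)) * (ennreal \<bar>\<psi> u - g u\<bar> * indicator {-pi..pi} u)) \<partial>lborel)"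
      by (rule gen[OF id])
    show "ennreal \<bar>\<integral>u. h u * ((g u - g x) * I u) \<partial>lborel\<bar> \<le> (\<integral>\<^sup>+u. ennreal (3 * A) * (ennreal (envelope n (x - u)) * (ennreal \<bar>g u - g x\<bar> * indicator {-pi..pi} u)) \<partial>lborel)"
      by (rule gen[OF ig])
  qed
  also have "\<dots> = ennreal (3 * A) *
    ((\<integral>\<^sup>+u. ennreal (envelope n (x - u)) \<partial>\<mu>s)
      + (\<integral>\<^sup>+u. ennreal (envelope n (x - u)) * (ennreal \<bar>\<psi> u - g u\<bar> * indicator {-pi..pi} u) \<partial>lborel)
      + (\<integral>\<^sup>+u. ennreal (envelope n (x - u)) * (ennreal \<bar>g u - g x\<bar> * indicator {-pi..pi} u) \<partial>lborel))"
    by (subst (1 2 3) nn_integral_cmult) (auto simp: distrib_left add.assoc)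
  finally show ?thesis unfolding h_def .
qed

text \<open>The mass on \<open>F\<close> is seen from \<open>x\<close> only through the tail of the envelope.\<close>

lemma envelope_singular_bound:
  assumes n: "0 < n" and eta: "0 < \<eta>" and x: "x \<in> {-pi + \<eta>..pi - \<eta>}" and F: "closed F" and far: "\<eta> < infdist x F"
  shows "(\<integral>\<^sup>+u. ennreal (envelope n (x - u)) \<partial>\<mu>s)
    \<le> (\<integral>\<^sup>+u. ennreal (envelope n (x - u)) * indicator (- F) u \<partial>\<mu>s) + ennreal (1 / (real n * (sin (\<eta> / 2))\<^sup>2))"
proof -
  define c where "c = 1 / (real n * (sin (\<eta> / 2))\<^sup>2)"
  have Fm[measurable]: "F \<in> sets borel" using F by (rule borel_closed)
  have "(\<integral>\<^sup>+u. ennreal (envelope n (x - u)) \<partial>\<mu>s) \<le> (\<integral>\<^sup>+u. ennreal (envelope n (x - u)) * indicator (- F) u + ennreal c \<partial>\<mu>s)"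
  proof (rule nn_integral_mono_AE, use carrier_mus in eventually_elim)
    fix u :: real assume u: "u \<in> {-pi..pi}"
    show "ennreal (envelope n (x - u)) \<le> ennreal (envelope n (x - u)) * indicator (- F) u + ennreal c"
    proof (cases "u \<in> F")
      case True
      have "infdist x F \<le> dist x u" using True by (rule infdist_le)
      then have "\<eta> \<le> \<bar>x - u\<bar>" using far by (simp add: dist_real_def)
      then have "envelope n (x - u) \<le> c" unfolding c_def using n eta x u by (intro envelope_far) auto
      then show ?thesis using True by (simp add: ennreal_leI)
    qed simp
  qed
  also have "\<dots> = (\<integral>\<^sup>+u. ennreal (envelope n (x - u)) * indicator (- F) u \<partial>\<mu>s) + ennreal c * emeasure \<mu>s (space \<mu>s)"
    by (subst nn_integral_add) auto
  also have "\<dots> \<le> (\<integral>\<^sup>+u. ennreal (envelope n (x - u)) * indicator (- F) u \<partial>\<mu>s) + ennreal c * 1"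
    using mus_mass_le sets_eq_imp_space_eq[OF sets_mus] by (intro add_mono mult_left_mono) auto
  finally show ?thesis unfolding c_def by simp
qed

text \<open>Inner regularity applied to a null set that carries the singular part. The point \<open>0\<close> is added only to have a
  nonempty set.\<close>

lemma singular_compact_carrier:
  assumes d: "0 < \<delta>"
  obtains F where "compact F" "F \<noteq> {}" "emeasure lborel F = 0" "emeasure \<mu>s (- F) \<le> ennreal \<delta>"
proof -
  interpret s: finite_measure \<mu>s by (rule finite_mus)
  have sp: "space \<mu>s = UNIV" using sets_eq_imp_space_eq[OF sets_mus] by simp
  obtain N where N: "N \<in> null_sets lborel" "emeasure \<mu>s (- N) = 0"
    using decomp unfolding spectral_decomposition_def lebesgue_singular_def by auto
  have Nm[measurable]: "N \<in> sets borel" using N(1) by auto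
  have SN: "emeasure \<mu>s N = emeasure \<mu>s UNIV"
  proof -
    have "emeasure \<mu>s UNIV = emeasure \<mu>s (N \<union> - N)" by simp
    also have "\<dots> = emeasure \<mu>s N + emeasure \<mu>s (- N)" by (rule plus_emeasure[symmetric]) auto
    finally show ?thesis using N(2) by simp
  qed
  have reg: "emeasure \<mu>s N = (SUP K \<in> {K. K \<subseteq> N \<and> compact K}. emeasure \<mu>s K)"
    by (rule inner_regular) (auto simp: sp s.emeasure_finite)
  have ex: "\<exists>K. K \<subseteq> N \<and> compact K \<and> emeasure \<mu>s N \<le> emeasure \<mu>s K + ennreal \<delta>"
  proof (cases "measure \<mu>s N = 0")
    case True
    then show ?thesis by (intro exI[of _ "{}"]) (simp add: s.emeasure_eq_measure)
  next
    case False
    then have "0 < measure \<mu>s N" by (simp add: zero_less_measure_iff)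
    then have "ennreal (measure \<mu>s N - \<delta>) < emeasure \<mu>s N"
      using d unfolding s.emeasure_eq_measure by (intro ennreal_lessI) auto
    then obtain K where K: "K \<subseteq> N" "compact K" "ennreal (measure \<mu>s N - \<delta>) < emeasure \<mu>s K"
      unfolding reg less_SUP_iff by auto
    have "measure \<mu>s N - \<delta> \<le> measure \<mu>s K"
      using K(3) unfolding s.emeasure_eq_measure by (metis ennreal_leI linorder_not_le nle_le)
    then have "emeasure \<mu>s N \<le> emeasure \<mu>s K + ennreal \<delta>"
      using d unfolding s.emeasure_eq_measure by (simp add: ennreal_plus[symmetric] ennreal_leI del: ennreal_plus)
    then show ?thesis using K by blast
  qed
  then obtain K where K: "K \<subseteq> N" "compact K" "emeasure \<mu>s N \<le> emeasure \<mu>s K + ennreal \<delta>" by blast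
  define F where "F = insert 0 K"
  have Km[measurable]: "K \<in> sets borel" using K(2) by (intro borel_closed compact_imp_closed)
  have cF: "compact F" unfolding F_def using K(2) by simp
  have Fm[measurable]: "F \<in> sets borel" using cF by (intro borel_closed compact_imp_closed)
  show ?thesis
  proof (rule that[of F])
    have "{0} \<union> N \<in> null_sets lborel" using N(1) by (intro null_sets.Un) auto
    then have "F \<in> null_sets lborel" by (rule null_sets_subset) (use K(1) in \<open>auto simp: F_def\<close>)
    then show "emeasure lborel F = 0" by auto
    have "emeasure \<mu>s K + emeasure \<mu>s (- K) = emeasure \<mu>s (K \<union> - K)" by (rule plus_emeasure) auto
    also have "\<dots> \<le> emeasure \<mu>s K + ennreal \<delta>" using K(3) unfolding SN by simp
    finally have "emeasure \<mu>s (- K) \<le> ennreal \<delta>"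
      using s.emeasure_finite[of K] by (simp add: ennreal_add_left_cancel_le)
    moreover have "emeasure \<mu>s (- F) \<le> emeasure \<mu>s (- K)" unfolding F_def by (intro emeasure_mono) auto
    ultimately show "emeasure \<mu>s (- F) \<le> ennreal \<delta>" by (rule order_trans[rotated])
  qed (use cF in \<open>auto simp: F_def\<close>)
qed

text \<open>The exceptional set consists of the points close to \<open>F\<close>, the points close to \<open>\<plusminus> \<pi>\<close> (where the circle has been
  cut open), and those where the convolution \<open>H\<close> of the envelope with the small remainder is large.\<close>

theorem zero_mean_kernel_small:
  fixes \<kappa> :: "nat \<Rightarrow> real \<Rightarrow> real"
  assumes kc: "\<And>n. continuous_on UNIV (\<kappa> n)" and kb: "\<And>n v. 0 < n \<Longrightarrow> \<bar>\<kappa> n v\<bar> \<le> A * envelope n v" and A: "0 < A"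
    and zero: "\<And>n y. ((\<lambda>u. \<kappa> n (y - u)) has_integral 0) {-pi..pi}"
    and eps: "0 < \<epsilon>" and beta: "0 < \<beta>"
  shows "\<forall>\<^sub>F n in sequentially. \<exists>B\<in>sets borel. emeasure lborel B \<le> ennreal \<beta> \<and>
     (\<forall>x\<in>{-pi..pi} - B. \<forall>t\<in>{0..1 / (4 * real n)}. \<bar>\<integral>u. \<kappa> n (x + t - u) \<partial>\<mu>\<bar> \<le> \<epsilon>)"
proof -
  \<comment> \<open>the error terms will add up to at most \<open>3 * A * (3 * \<gamma>)\<close>\<close>
  define \<gamma> where "\<gamma> = \<epsilon> / (12 * A)"
  have g0: "0 < \<gamma>" unfolding \<gamma>_def using eps A by simp
  \<comment> \<open>the remainder contributes \<open>8 * \<pi> * \<delta>\<close> to the integral of \<open>H\<close>, which Markov turns into \<open>\<beta> / 3\<close>\<close>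
  define \<delta> where "\<delta> = \<beta> * \<gamma> / (24 * pi)"
  have d0: "0 < \<delta>" unfolding \<delta>_def using beta g0 by simp
  have "(\<integral>\<^sup>+x. ennreal (\<psi> x) * indicator {-pi..pi} x \<partial>lborel) < \<infinity>"
    using psi_mass_le by (rule order_le_less_trans) simp
  then obtain g G where gc: "continuous_on UNIV g" and gb: "\<And>x. \<bar>g x\<bar> \<le> G"
    and gd: "(\<integral>\<^sup>+x. ennreal \<bar>\<psi> x - g x\<bar> * indicator {-pi..pi} x \<partial>lborel) \<le> ennreal \<delta>"
    using continuous_L1_approx[OF psi_measurable psi_nonneg _ d0] by blast
  have gm[measurable]: "g \<in> borel_measurable borel" using gc by (rule borel_measurable_continuous_onI)
  have G0: "0 \<le> G" using gb[of 0] by linarith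
  obtain F where F: "compact F" "F \<noteq> {}" "emeasure lborel F = 0" "emeasure \<mu>s (- F) \<le> ennreal \<delta>"
    using singular_compact_carrier[OF d0] .
  have Fc: "closed F" using F(1) by (rule compact_imp_closed)
  have Fm[measurable]: "F \<in> sets borel" using Fc by (rule borel_closed)
  obtain \<eta>1 where e1: "0 < \<eta>1" "emeasure lborel {x \<in> {-pi..pi}. infdist x F \<le> \<eta>1} \<le> ennreal (\<beta> / 3)"
    using compact_null_nbhd[OF F(1-3), of "\<beta> / 3"] beta by auto
  define w where "w = \<gamma> / (4 * pi)"
  have w0: "0 < w" unfolding w_def using g0 by simp
  have "uniformly_continuous_on {-pi..pi} g"
    using continuous_on_subset[OF gc] by (intro compact_uniformly_continuous) auto
  then obtain \<eta>2 where e2: "0 < \<eta>2" "\<And>x u. x \<in> {-pi..pi} \<Longrightarrow> u \<in> {-pi..pi} \<Longrightarrow> dist u x < \<eta>2 \<Longrightarrow> dist (g u) (g x) < w"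
    unfolding uniformly_continuous_on_def using w0 by metis
  define \<eta> where "\<eta> = min (min \<eta>1 \<eta>2) (min (\<beta> / 6) 1)"
  have eta: "0 < \<eta>" "\<eta> \<le> \<eta>1" "\<eta> \<le> \<eta>2" "\<eta> \<le> \<beta> / 6" "\<eta> \<le> 1" unfolding \<eta>_def using e1 e2 beta by auto
  have s0: "0 < sin (\<eta> / 2)" using eta pi_ge_two by (intro sin_gt_zero) auto
  define H where "H n x = (\<integral>\<^sup>+u. ennreal (envelope n (x - u)) * indicator (- F) u \<partial>\<mu>s)
      + (\<integral>\<^sup>+u. ennreal (envelope n (x - u)) * (ennreal \<bar>\<psi> u - g u\<bar> * indicator {-pi..pi} u) \<partial>lborel)" for n x
  interpret s: finite_measure \<mu>s by (rule finite_mus)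
  have Hm[measurable]: "H n \<in> borel_measurable borel" for n
    unfolding H_def by measurable
  define B where "B n = {x \<in> {-pi..pi}. ennreal \<gamma> \<le> H n x} \<union> {x \<in> {-pi..pi}. infdist x F \<le> \<eta>1} \<union> ({-pi..-pi + \<eta>} \<union> {pi - \<eta>..pi})" for n
  have Dm: "{x \<in> {-pi..pi}. infdist x F \<le> \<eta>1} \<in> sets borel"
  proof -
    have "{x \<in> {-pi..pi}. infdist x F \<le> \<eta>1} = {-pi..pi} \<inter> {x. infdist x F \<le> \<eta>1}" by auto
    moreover have "closed {x. infdist x F \<le> \<eta>1}" by (intro closed_Collect_le continuous_intros)
    ultimately show ?thesis by auto
  qed
  have B1m: "{x \<in> {-pi..pi}. ennreal \<gamma> \<le> H n x} \<in> sets borel" for n by measurable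
  have HB: "emeasure lborel {x \<in> {-pi..pi}. ennreal \<gamma> \<le> H n x} \<le> ennreal (\<beta> / 3)" for n
  proof -
    have I1: "(\<integral>\<^sup>+x. (\<integral>\<^sup>+u. ennreal (envelope n (x - u)) * indicator (- F) u \<partial>\<mu>s) * indicator {-pi..pi} x \<partial>lborel) \<le> ennreal (4 * pi) * ennreal \<delta>"
    proof -
      have "(\<integral>\<^sup>+x. (\<integral>\<^sup>+u. ennreal (envelope n (x - u)) * indicator (- F) u \<partial>\<mu>s) * indicator {-pi..pi} x \<partial>lborel) \<le> ennreal (4 * pi) * (\<integral>\<^sup>+u. indicator (- F) u \<partial>\<mu>s)"
        by (rule envelope_conv_mass[OF sets_mus finite_mus carrier_mus]) measurable
      also have "(\<integral>\<^sup>+u. indicator (- F) u \<partial>\<mu>s) = emeasure \<mu>s (- F)" by simp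
      finally show ?thesis using F(4) by (meson mult_left_mono order_trans zero_le)
    qed
    define D where "D = density lborel (\<lambda>u. indicator {-pi..pi::real} u :: ennreal)"
    have fD: "finite_measure D" unfolding D_def
      by (intro finite_measureI) (simp add: emeasure_density emeasure_lborel_Icc_eq)
    have cD: "AE u in D. u \<in> {-pi..pi}" unfolding D_def by (subst AE_density) (auto simp: indicator_def)
    have eqD: "(\<integral>\<^sup>+u. f u \<partial>D) = (\<integral>\<^sup>+u. f u * indicator {-pi..pi} u \<partial>lborel)" if "f \<in> borel_measurable borel" for f
      unfolding D_def using that by (subst nn_integral_density) (auto simp: mult.commute)
    have I2: "(\<integral>\<^sup>+x. (\<integral>\<^sup>+u. ennreal (envelope n (x - u)) * (ennreal \<bar>\<psi> u - g u\<bar> * indicator {-pi..pi} u) \<partial>lborel) * indicator {-pi..pi} x \<partial>lborel) \<le> ennreal (4 * pi) * ennreal \<delta>"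
    proof -
      have "(\<integral>\<^sup>+x. (\<integral>\<^sup>+u. ennreal (envelope n (x - u)) * ennreal \<bar>\<psi> u - g u\<bar> \<partial>D) * indicator {-pi..pi} x \<partial>lborel) \<le> ennreal (4 * pi) * (\<integral>\<^sup>+u. ennreal \<bar>\<psi> u - g u\<bar> \<partial>D)"
        by (rule envelope_conv_mass[OF _ fD cD]) (auto simp: D_def)
      also have "\<dots> \<le> ennreal (4 * pi) * ennreal \<delta>" using gd by (intro mult_left_mono) (auto simp: eqD)
      also have "(\<lambda>x. \<integral>\<^sup>+u. ennreal (envelope n (x - u)) * ennreal \<bar>\<psi> u - g u\<bar> \<partial>D)
        = (\<lambda>x. \<integral>\<^sup>+u. ennreal (envelope n (x - u)) * (ennreal \<bar>\<psi> u - g u\<bar> * indicator {-pi..pi} u) \<partial>lborel)"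
        by (intro ext) (subst eqD, auto simp: mult.assoc)
      finally show ?thesis .
    qed
    have "(\<integral>\<^sup>+x. H n x * indicator {-pi..pi} x \<partial>lborel) \<le> ennreal (4 * pi) * ennreal \<delta> + ennreal (4 * pi) * ennreal \<delta>"
      unfolding H_def distrib_right by (subst nn_integral_add) (auto intro!: add_mono I1 I2)
    also have "\<dots> = ennreal (\<beta> / 3 * \<gamma>)"
      using d0 by (simp add: ennreal_mult[symmetric] ennreal_plus[symmetric] del: ennreal_plus) (simp add: \<delta>_def field_simps)
    finally have HI: "(\<integral>\<^sup>+x. H n x * indicator {-pi..pi} x \<partial>lborel) \<le> ennreal (\<beta> / 3 * \<gamma>)" .
    have "ennreal \<gamma> * emeasure lborel {x \<in> {-pi..pi}. ennreal \<gamma> \<le> H n x} = (\<integral>\<^sup>+x. ennreal \<gamma> * indicator {x \<in> {-pi..pi}. ennreal \<gamma> \<le> H n x} x \<partial>lborel)"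
      using B1m[of n] by (subst nn_integral_cmult_indicator) auto
    also have "\<dots> \<le> (\<integral>\<^sup>+x. H n x * indicator {-pi..pi} x \<partial>lborel)"
      by (intro nn_integral_mono) (auto simp: indicator_def)
    also note HI
    also have "ennreal (\<beta> / 3 * \<gamma>) = ennreal \<gamma> * ennreal (\<beta> / 3)"
      using g0 beta by (simp add: ennreal_mult[symmetric] mult.commute)
    finally show ?thesis using g0 by (subst (asm) ennreal_mult_le_mult_iff) auto
  qed
  have Bm: "B n \<in> sets borel" for n unfolding B_def using B1m[of n] Dm by auto
  have Bs: "emeasure lborel (B n) \<le> ennreal \<beta>" for n
  proof -
    have sub: "emeasure lborel (X \<union> Y) \<le> a + b" if "X \<in> sets borel" "Y \<in> sets borel" "emeasure lborel X \<le> a" "emeasure lborel Y \<le> b" for X Y :: "real set" and a b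
      by (rule order_trans[OF emeasure_subadditive add_mono]) (use that in auto)
    have "emeasure lborel (B n) \<le> (emeasure lborel {x \<in> {-pi..pi}. ennreal \<gamma> \<le> H n x} + emeasure lborel {x \<in> {-pi..pi}. infdist x F \<le> \<eta>1})
        + (emeasure lborel {-pi..-pi + \<eta>} + emeasure lborel {pi - \<eta>..pi})"
      unfolding B_def by (intro sub sets.Un B1m Dm order_refl) simp_all
    also have "\<dots> \<le> (ennreal (\<beta> / 3) + ennreal (\<beta> / 3)) + (ennreal \<eta> + ennreal \<eta>)"
      using eta by (intro add_mono HB e1(2)) auto
    also have "\<dots> = ennreal (2 * \<beta> / 3 + 2 * \<eta>)"
      using eta beta by (simp add: ennreal_plus[symmetric] del: ennreal_plus)
    also have "\<dots> \<le> ennreal \<beta>" using eta by (intro ennreal_leI) simp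
    finally show ?thesis .
  qed
  have lim: "(\<lambda>n. (2 * G * (2 * pi) + 1) / (real n * (sin (\<eta> / 2))\<^sup>2)) \<longlonglongrightarrow> 0"
    using s0 by real_asymp
  have "\<forall>\<^sub>F n in sequentially. (2 * G * (2 * pi) + 1) / (real n * (sin (\<eta> / 2))\<^sup>2) < \<gamma>"
    using lim g0 by (rule order_tendstoD(2))
  moreover have "\<forall>\<^sub>F n in sequentially. 0 < n" by (rule eventually_gt_at_top)
  ultimately show ?thesis
  proof eventually_elim
    fix n assume n: "(2 * G * (2 * pi) + 1) / (real n * (sin (\<eta> / 2))\<^sup>2) < \<gamma>" "0 < (n::nat)"
    show "\<exists>B\<in>sets borel. emeasure lborel B \<le> ennreal \<beta> \<and>
     (\<forall>x\<in>{-pi..pi} - B. \<forall>t\<in>{0..1 / (4 * real n)}. \<bar>\<integral>u. \<kappa> n (x + t - u) \<partial>\<mu>\<bar> \<le> \<epsilon>)"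
    proof (rule bexI[OF _ Bm[of n]], intro conjI Bs ballI)
      fix x t assume x: "x \<in> {-pi..pi} - B n" and t: "t \<in> {0..1 / (4 * real n)}"
      have xH: "H n x \<le> ennreal \<gamma>" and xF: "\<eta> < infdist x F" and xi: "x \<in> {-pi + \<eta>..pi - \<eta>}"
        using x eta unfolding B_def by auto
      define c where "c = real n * (sin (\<eta> / 2))\<^sup>2"
      have c0: "0 < c" unfolding c_def using n s0 by simp
      have cc: "2 * G * (2 * pi) / c + 1 / c \<le> \<gamma>" using n(1) unfolding c_def[symmetric] by (simp add: add_divide_distrib)
      have E1: "(\<integral>\<^sup>+u. ennreal (envelope n (x - u)) \<partial>\<mu>s)
        \<le> (\<integral>\<^sup>+u. ennreal (envelope n (x - u)) * indicator (- F) u \<partial>\<mu>s) + ennreal (1 / c)"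
        unfolding c_def by (rule envelope_singular_bound[OF n(2) eta(1) xi Fc xF])
      have E3: "(\<integral>\<^sup>+u. ennreal (envelope n (x - u)) * (ennreal \<bar>g u - g x\<bar> * indicator {-pi..pi} u) \<partial>lborel)
        \<le> ennreal (w * (4 * pi) + 2 * G * (2 * pi) / c)"
        unfolding c_def
      proof (rule envelope_modulus_bound[OF n(2) eta(1) xi less_imp_le[OF w0] gm gb])
        fix u assume u: "u \<in> {-pi..pi}" "\<bar>u - x\<bar> < \<eta>"
        have "dist (g u) (g x) < w" using x u eta by (intro e2(2)) (auto simp: dist_real_def)
        then show "\<bar>g u - g x\<bar> \<le> w" by (simp add: dist_real_def)
      qed
      have "ennreal \<bar>\<integral>u. \<kappa> n (x + t - u) \<partial>\<mu>\<bar> \<le> ennreal (3 * A) *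
        ((\<integral>\<^sup>+u. ennreal (envelope n (x - u)) \<partial>\<mu>s)
          + (\<integral>\<^sup>+u. ennreal (envelope n (x - u)) * (ennreal \<bar>\<psi> u - g u\<bar> * indicator {-pi..pi} u) \<partial>lborel)
          + (\<integral>\<^sup>+u. ennreal (envelope n (x - u)) * (ennreal \<bar>g u - g x\<bar> * indicator {-pi..pi} u) \<partial>lborel))"
        using A t by (intro zero_mean_kernel_pointwise[OF kc kb[OF n(2)] _ zero gc gb]) auto
      also have "\<dots> \<le> ennreal (3 * A) *
        (((\<integral>\<^sup>+u. ennreal (envelope n (x - u)) * indicator (- F) u \<partial>\<mu>s) + ennreal (1 / c))
          + (\<integral>\<^sup>+u. ennreal (envelope n (x - u)) * (ennreal \<bar>\<psi> u - g u\<bar> * indicator {-pi..pi} u) \<partial>lborel)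
          + ennreal (w * (4 * pi) + 2 * G * (2 * pi) / c))"
        by (intro mult_left_mono add_mono E1 E3 order_refl) auto
      also have "\<dots> = ennreal (3 * A) * (H n x + (ennreal (1 / c) + ennreal (w * (4 * pi) + 2 * G * (2 * pi) / c)))"
        unfolding H_def by (simp add: ac_simps)
      also have "\<dots> \<le> ennreal (3 * A) * (ennreal \<gamma> + (ennreal (1 / c) + ennreal (w * (4 * pi) + 2 * G * (2 * pi) / c)))"
        by (intro mult_left_mono add_mono xH order_refl) auto
      also have "\<dots> = ennreal (3 * A * (\<gamma> + (1 / c + (w * (4 * pi) + 2 * G * (2 * pi) / c))))"
        using A g0 c0 w0 G0 by (simp add: ennreal_mult[symmetric] ennreal_plus[symmetric] del: ennreal_plus)
      also have "\<dots> \<le> ennreal (3 * A * (\<gamma> + (\<gamma> + \<gamma>)))"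
      proof -
        have "w * (4 * pi) = \<gamma>" unfolding w_def by simp
        then have "\<gamma> + (1 / c + (w * (4 * pi) + 2 * G * (2 * pi) / c)) \<le> \<gamma> + (\<gamma> + \<gamma>)" using cc by linarith
        then show ?thesis using A by (intro ennreal_leI mult_left_mono) auto
      qed
      also have "\<dots> \<le> ennreal \<epsilon>" unfolding \<gamma>_def using A eps by (intro ennreal_leI) (simp add: field_simps)
      finally show "\<bar>\<integral>u. \<kappa> n (x + t - u) \<partial>\<mu>\<bar> \<le> \<epsilon>" using eps by simp
    qed
  qed
qed

end

section \<open>Variances and covariances as convolutions\<close>

text \<open>The hypothesis on sines says that the correlation function is real.\<close>

locale spectral_model = decomposed_measure +
  fixes \<eta> :: real
  assumes sine: "\<And>k l :: nat. (\<integral>u. sin ((real k - real l) * u) \<partial>\<mu>) = 0"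
    and eta: "0 < \<eta>"
    and psi_pos: "AE x in lborel. x \<in> {-pi..pi} \<longrightarrow> 0 < \<psi> x"
    and log_int: "(\<integral>\<^sup>+x. ennreal (\<bar>ln (\<psi> x)\<bar> powr (1 + \<eta>)) * indicator {-pi..pi} x \<partial>lborel) < \<infinity>"
begin

definition corr :: "nat \<Rightarrow> nat \<Rightarrow> real" where
  "corr k l = (\<integral>u. cos ((real k - real l) * u) \<partial>\<mu>)"

text \<open>The variance at \<open>x\<close> of the derivative of order \<open>j\<close> of the random trigonometric polynomial, divided by \<open>n ^ (2 * j)\<close>.\<close>

definition var_fun :: "nat \<Rightarrow> nat \<Rightarrow> real \<Rightarrow> real" where
  "var_fun j n x = (1 / real n) * (\<Sum>k=1..n. \<Sum>l=1..n. (real k / real n) ^ j * (real l / real n) ^ j * (corr k l * cos ((real k - real l) * x)))"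

text \<open>The covariance at \<open>x\<close> of the random trigonometric polynomial and its derivative, divided by \<open>n\<close>.\<close>

definition cov_fun :: "nat \<Rightarrow> real \<Rightarrow> real" where
  "cov_fun n x = (1 / real n) * (\<Sum>k=1..n. \<Sum>l=1..n. (real l / real n) * (corr k l * sin ((real k - real l) * x)))"

lemma corr_sym: "corr k l = corr l k"
proof -
  have "cos ((real k - real l) * u) = cos ((real l - real k) * u)" for u
    by (metis cos_minus minus_diff_eq mult_minus_left)
  then show ?thesis unfolding corr_def by simp
qed

lemma corr_same: "corr k k = 1"
  unfolding corr_def by (simp add: prob_space)

lemma integrable_trig:
  "integrable \<mu> (\<lambda>u. cos (c * u))" "integrable \<mu> (\<lambda>u. sin (c * u))" "integrable \<mu> (\<lambda>u. cos (c * (x - u)))" "integrable \<mu> (\<lambda>u. sin (c * (x - u)))"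
  by (rule integrable_const_bound[of _ 1]; simp)+

lemma integral_cos_shift: "(\<integral>u. cos ((real k - real l) * (x - u)) \<partial>\<mu>) = corr k l * cos ((real k - real l) * x)"
proof -
  have eq: "cos ((real k - real l) * (x - u)) = cos ((real k - real l) * x) * cos ((real k - real l) * u) + sin ((real k - real l) * x) * sin ((real k - real l) * u)" for u
    by (simp add: right_diff_distrib cos_diff)
  show ?thesis unfolding eq using integrable_trig sine[of k l] by (simp add: corr_def)
qed

lemma integral_sin_shift: "(\<integral>u. sin ((real k - real l) * (x - u)) \<partial>\<mu>) = corr k l * sin ((real k - real l) * x)"
proof -
  have eq: "sin ((real k - real l) * (x - u)) = sin ((real k - real l) * x) * cos ((real k - real l) * u) - cos ((real k - real l) * x) * sin ((real k - real l) * u)" for u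
    by (simp add: right_diff_distrib sin_diff)
  show ?thesis unfolding eq using integrable_trig sine[of k l] by (simp add: corr_def)
qed

lemma var_fun_eq: "var_fun j n x = (\<integral>u. moment_kernel j n (x - u) \<partial>\<mu>)"
  unfolding var_fun_def moment_kernel_def integral_cos_shift[symmetric]
  by (subst integral_mult_right_zero, subst Bochner_Integration.integral_sum, intro Bochner_Integration.integrable_sum integrable_mult_right integrable_trig)
    (subst Bochner_Integration.integral_sum, intro integrable_mult_right integrable_trig, simp)

lemma cov_fun_eq: "cov_fun n x = (\<integral>u. cross_kernel n (x - u) \<partial>\<mu>)"
  unfolding cov_fun_def cross_kernel_def integral_sin_shift[symmetric]
  by (subst integral_mult_right_zero, subst Bochner_Integration.integral_sum, intro Bochner_Integration.integrable_sum integrable_mult_right integrable_trig)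
    (subst Bochner_Integration.integral_sum, intro integrable_mult_right integrable_trig, simp)

lemma var_fun_nonneg: "0 \<le> var_fun j n x"
  unfolding var_fun_eq by (intro integral_nonneg_AE AE_I2 moment_kernel_nonneg)

lemma continuous_var_fun[continuous_intros]: "continuous_on A (var_fun j n)"
  unfolding var_fun_def[abs_def] by (intro continuous_intros)

lemma continuous_cov_fun[continuous_intros]: "continuous_on A (cov_fun n)"
  unfolding cov_fun_def[abs_def] by (intro continuous_intros)

lemma measurable_var_fun[measurable]: "var_fun j n \<in> borel_measurable borel"
  by (intro borel_measurable_continuous_onI continuous_var_fun)

lemma measurable_cov_fun[measurable]: "cov_fun n \<in> borel_measurable borel"
  by (intro borel_measurable_continuous_onI continuous_cov_fun)

lemma var_cov_periodic: "var_fun j n (x + 2 * pi) = var_fun j n x" "cov_fun n (x + 2 * pi) = cov_fun n x"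
  unfolding var_fun_def cov_fun_def cos_sin_int_periodic by simp_all

text \<open>Half the derivative of the variance is the covariance of the process with its derivative; in terms of the double sum,
  antisymmetrise in \<open>k\<close> and \<open>l\<close>.\<close>

lemma var_fun_derivative: "(var_fun 0 n has_real_derivative 2 * real n * cov_fun n x) (at x)"
proof -
  define T where "T = (\<Sum>k=1..n. \<Sum>l=1..n. real l * (corr k l * sin ((real k - real l) * x)))"
  have T2: "T = (\<Sum>k=1..n. \<Sum>l=1..n. - real k * (corr k l * sin ((real k - real l) * x)))"
  proof -
    have "T = (\<Sum>l=1..n. \<Sum>k=1..n. real l * (corr k l * sin ((real k - real l) * x)))" unfolding T_def by (rule sum.swap)
    also have "\<dots> = (\<Sum>k=1..n. \<Sum>l=1..n. - real k * (corr k l * sin ((real k - real l) * x)))"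
    proof (intro sum.cong refl)
      fix k l :: nat
      have "sin ((real l - real k) * x) = - sin ((real k - real l) * x)" by (metis minus_diff_eq mult_minus_left sin_minus)
      then show "real k * (corr l k * sin ((real l - real k) * x)) = - real k * (corr k l * sin ((real k - real l) * x))"
        using corr_sym[of l k] by simp
    qed
    finally show ?thesis .
  qed
  have d: "((\<lambda>x. (real k / real n) ^ 0 * (real l / real n) ^ 0 * (corr k l * cos ((real k - real l) * x))) has_real_derivative corr k l * (- sin ((real k - real l) * x) * (real k - real l))) (at x)" for k l
    by (auto intro!: derivative_eq_intros)
  have "((\<lambda>x. var_fun 0 n x) has_real_derivative (1 / real n) * (\<Sum>k=1..n. \<Sum>l=1..n. corr k l * (- sin ((real k - real l) * x) * (real k - real l)))) (at x)"
    unfolding var_fun_def by (intro DERIV_cmult DERIV_sum d)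
  also have "(\<Sum>k=1..n. \<Sum>l=1..n. corr k l * (- sin ((real k - real l) * x) * (real k - real l))) = T + T"
    by (subst (2) T2) (simp add: T_def sum.distrib[symmetric] algebra_simps)
  also have "(1 / real n) * (T + T) = 2 * real n * cov_fun n x"
  proof -
    have c: "cov_fun n x = (1 / real n) * (T / real n)"
    proof -
      have "(\<Sum>k=1..n. \<Sum>l=1..n. (real l / real n) * (corr k l * sin ((real k - real l) * x))) = T / real n"
        unfolding T_def sum_divide_distrib by (intro sum.cong refl) (simp only: times_divide_eq_left)
      then show ?thesis unfolding cov_fun_def by (simp only:)
    qed
    show ?thesis unfolding c by (cases "n = 0") (simp_all add: field_simps)
  qed
  finally show ?thesis .
qed

text \<open>Only the diagonal terms survive integration over a period.\<close>

lemma nn_integral_var_fun: "(\<integral>\<^sup>+x. ennreal (var_fun j n x) * indicator {-pi..pi} x \<partial>lborel) = ennreal (2 * pi * mean_power j n)"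
proof -
  have "((\<lambda>x. var_fun j n x) has_integral (1 / real n) * (\<Sum>k=1..n. \<Sum>l=1..n. (real k / real n) ^ j * (real l / real n) ^ j * (corr k l * (if k = l then 2 * pi else 0)))) {-pi..pi}"
    unfolding var_fun_def by (intro has_integral_mult_right has_integral_sum has_integral_cos_int) auto
  also have "(\<Sum>k=1..n. \<Sum>l=1..n. (real k / real n) ^ j * (real l / real n) ^ j * (corr k l * (if k = l then 2 * pi else 0)))
     = (\<Sum>k=1..n. \<Sum>l=1..n. (real k / real n) ^ j * (real l / real n) ^ j * (if k = l then 2 * pi else 0))"
    by (intro sum.cong refl) (auto simp: corr_same)
  also have "(1 / real n) * \<dots> = 2 * pi * mean_power j n" unfolding diagonal_sum mean_power_def by simp
  finally have "((\<lambda>x. if x \<in> {-pi..pi} then var_fun j n x else 0) has_integral 2 * pi * mean_power j n) UNIV"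
    by (simp only: has_integral_restrict_UNIV)
  then have "(\<integral>\<^sup>+x. ennreal (if x \<in> {-pi..pi} then var_fun j n x else 0) \<partial>lborel) = ennreal (2 * pi * mean_power j n)"
    by (rule nn_integral_has_integral_lborel[rotated 2]) (auto simp: var_fun_nonneg)
  also have "(\<integral>\<^sup>+x. ennreal (if x \<in> {-pi..pi} then var_fun j n x else 0) \<partial>lborel) = (\<integral>\<^sup>+x. ennreal (var_fun j n x) * indicator {-pi..pi} x \<partial>lborel)"
    by (intro nn_integral_cong) (auto simp: indicator_def)
  finally show ?thesis .
qed

lemma cov_fun_small:
  assumes "0 < \<epsilon>" "0 < \<beta>"
  shows "\<forall>\<^sub>F n in sequentially. \<exists>B\<in>sets borel. emeasure lborel B \<le> ennreal \<beta> \<and>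
     (\<forall>x\<in>{-pi..pi} - B. \<forall>t\<in>{0..1 / (4 * real n)}. \<bar>cov_fun n (x + t)\<bar> \<le> \<epsilon>)"
  unfolding cov_fun_eq
  by (rule zero_mean_kernel_small[where A=2])
    (use assms in \<open>auto intro!: cross_kernel_le_envelope has_integral_cross_kernel_shift continuous_intros\<close>)

lemma var_fun_ratio_small:
  assumes "0 < \<epsilon>" "0 < \<beta>"
  shows "\<forall>\<^sub>F n in sequentially. \<exists>B\<in>sets borel. emeasure lborel B \<le> ennreal \<beta> \<and>
     (\<forall>x\<in>{-pi..pi} - B. \<forall>t\<in>{0..1 / (4 * real n)}. \<bar>var_fun 1 n (x + t) - mean_power 1 n * var_fun 0 n (x + t)\<bar> \<le> \<epsilon>)"
proof -
  have im: "integrable \<mu> (\<lambda>u. moment_kernel j n (y - u))" for j n y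
    unfolding moment_kernel_def by (intro integrable_mult_right Bochner_Integration.integrable_sum integrable_trig)
  have eq: "var_fun 1 n y - mean_power 1 n * var_fun 0 n y = (\<integral>u. moment_kernel 1 n (y - u) - mean_power 1 n * moment_kernel 0 n (y - u) \<partial>\<mu>)" for n y
    unfolding var_fun_eq using im by simp
  show ?thesis
    unfolding eq
  proof (rule zero_mean_kernel_small[where A=4 and \<kappa>="\<lambda>n v. moment_kernel 1 n v - mean_power 1 n * moment_kernel 0 n v"])
    show "continuous_on UNIV (\<lambda>v. moment_kernel 1 n v - mean_power 1 n * moment_kernel 0 n v)" for n by (intro continuous_intros)
    show "\<bar>moment_kernel 1 n v - mean_power 1 n * moment_kernel 0 n v\<bar> \<le> 4 * envelope n v" if n: "0 < n" for n v
    proof -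
      have a: "0 \<le> moment_kernel 1 n v" "moment_kernel 1 n v \<le> 2 * envelope n v" "0 \<le> moment_kernel 0 n v" "moment_kernel 0 n v \<le> 2 * envelope n v"
        using n by (auto intro: moment_kernel_le_envelope moment_kernel_nonneg)
      have "mean_power 1 n * moment_kernel 0 n v \<le> 1 * (2 * envelope n v)"
        using a mean_power_bounds by (intro mult_mono) auto
      moreover have "0 \<le> mean_power 1 n * moment_kernel 0 n v" using a mean_power_bounds by simp
      ultimately show ?thesis using a by linarith
    qed
    show "((\<lambda>u. moment_kernel 1 n (y - u) - mean_power 1 n * moment_kernel 0 n (y - u)) has_integral 0) {-pi..pi}" for n y
    proof -
      have "((\<lambda>u. moment_kernel 1 n (y - u) - mean_power 1 n * moment_kernel 0 n (y - u)) has_integral (2 * pi * mean_power 1 n - mean_power 1 n * (2 * pi * mean_power 0 n))) {-pi..pi}"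
        by (intro has_integral_diff has_integral_mult_right has_integral_moment_kernel_shift)
      moreover have "2 * pi * mean_power 1 n - mean_power 1 n * (2 * pi * mean_power 0 n) = 0"
        by (cases "n = 0") (auto simp: mean_power_0 mean_power_def)
      ultimately show ?thesis by (simp only:)
    qed
  qed (use assms in auto)
qed

section \<open>The variance is rarely small\<close>

definition log_mass :: real where
  "log_mass = enn2real (\<integral>\<^sup>+x. ennreal (\<bar>ln (\<psi> x)\<bar> powr (1 + \<eta>)) * indicator {-pi..pi} x \<partial>lborel)"

lemma log_mass: "(\<integral>\<^sup>+x. ennreal (\<bar>ln (\<psi> x)\<bar> powr (1 + \<eta>)) * indicator {-pi..pi} x \<partial>lborel) = ennreal log_mass" "0 \<le> log_mass"
  unfolding log_mass_def using log_int by auto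

text \<open>A probability density on \<open>[- \<pi>, \<pi>]\<close> concentrated near \<open>x\<close>.\<close>

definition fejer_weight :: "nat \<Rightarrow> real \<Rightarrow> real \<Rightarrow> real" where
  "fejer_weight n x u = moment_kernel 0 n (x - u) / (2 * pi) * indicator {-pi..pi} u"

lemma fejer_weight_nonneg: "0 \<le> fejer_weight n x u"
  unfolding fejer_weight_def using moment_kernel_nonneg by simp

lemma measurable_moment_kernel[measurable]: "moment_kernel j n \<in> borel_measurable borel"
  by (intro borel_measurable_continuous_onI continuous_intros)

lemma measurable_fejer_weight[measurable]: "(\<lambda>(x, u). fejer_weight n x u) \<in> borel_measurable (borel \<Otimes>\<^sub>M borel)"
  unfolding fejer_weight_def by measurable

lemma has_bochner_fejer_weight:
  assumes "0 < n"
  shows "has_bochner_integral lborel (fejer_weight n x) 1"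
proof -
  have "((\<lambda>u. moment_kernel 0 n (x - u) / (2 * pi)) has_integral (2 * pi * mean_power 0 n) / (2 * pi)) {-pi..pi}"
    by (intro has_integral_divide has_integral_moment_kernel_shift)
  then have "((\<lambda>u. if u \<in> {-pi..pi} then moment_kernel 0 n (x - u) / (2 * pi) else 0) has_integral 1) UNIV"
    by (simp only: has_integral_restrict_UNIV mean_power_0[OF assms]) simp
  also have "(\<lambda>u. if u \<in> {-pi..pi} then moment_kernel 0 n (x - u) / (2 * pi) else 0) = fejer_weight n x"
    by (auto simp: fejer_weight_def indicator_def)
  finally have "(\<integral>\<^sup>+u. ennreal (fejer_weight n x u) \<partial>lborel) = ennreal 1"
    by (rule nn_integral_has_integral_lborel[rotated 2]) (auto simp: fejer_weight_nonneg)
  then show ?thesis by (intro has_bochner_integral_nn_integral) (auto simp: fejer_weight_nonneg)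
qed

lemma fejer_weight_bound: "0 < n \<Longrightarrow> fejer_weight n x u \<le> real n * indicator {-pi..pi} u"
proof -
  assume n: "0 < n"
  have "moment_kernel 0 n (x - u) \<le> 2 * real n"
    using moment_kernel_le_envelope[OF n, of 0 "x - u"] envelope_le[of n "x - u"] by simp
  then have "moment_kernel 0 n (x - u) / (2 * pi) \<le> 2 * real n / 2"
    using pi_ge_two moment_kernel_nonneg[of 0 n "x - u"] by (intro frac_le) auto
  then show ?thesis unfolding fejer_weight_def by (auto simp: indicator_def)
qed

lemma weighted_log_integrable:
  assumes n: "0 < n"
  shows "integrable lborel (\<lambda>u. fejer_weight n x u * \<bar>ln (\<psi> u)\<bar>)"
    and "integrable lborel (\<lambda>u. fejer_weight n x u * \<bar>ln (\<psi> u)\<bar> powr (1 + \<eta>))"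
proof -
  have il: "integrable lborel (\<lambda>u. \<bar>ln (\<psi> u)\<bar> powr (1 + \<eta>) * indicator {-pi..pi} u)"
  proof (rule integrableI_nonneg)
    have "(\<integral>\<^sup>+x. ennreal (\<bar>ln (\<psi> x)\<bar> powr (1 + \<eta>) * indicator {-pi..pi} x) \<partial>lborel) = (\<integral>\<^sup>+x. ennreal (\<bar>ln (\<psi> x)\<bar> powr (1 + \<eta>)) * indicator {-pi..pi} x \<partial>lborel)"
      by (intro nn_integral_cong) (auto simp: indicator_def)
    then show "(\<integral>\<^sup>+x. ennreal (\<bar>ln (\<psi> x)\<bar> powr (1 + \<eta>) * indicator {-pi..pi} x) \<partial>lborel) < \<infinity>" using log_int by simp
  qed auto
  have i1: "integrable lborel (indicator {-pi..pi} :: real \<Rightarrow> real)" by simp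
  show "integrable lborel (\<lambda>u. fejer_weight n x u * \<bar>ln (\<psi> u)\<bar> powr (1 + \<eta>))"
  proof (rule Bochner_Integration.integrable_bound[OF integrable_mult_right[OF il, of "real n"]])
    show "AE u in lborel. norm (fejer_weight n x u * \<bar>ln (\<psi> u)\<bar> powr (1 + \<eta>)) \<le> norm (real n * (\<bar>ln (\<psi> u)\<bar> powr (1 + \<eta>) * indicator {-pi..pi} u))"
    proof (rule AE_I2)
      fix u
      have "fejer_weight n x u * \<bar>ln (\<psi> u)\<bar> powr (1 + \<eta>) \<le> (real n * indicator {-pi..pi} u) * \<bar>ln (\<psi> u)\<bar> powr (1 + \<eta>)"
        by (intro mult_right_mono fejer_weight_bound n) auto
      then show "norm (fejer_weight n x u * \<bar>ln (\<psi> u)\<bar> powr (1 + \<eta>)) \<le> norm (real n * (\<bar>ln (\<psi> u)\<bar> powr (1 + \<eta>) * indicator {-pi..pi} u))"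
        using fejer_weight_nonneg[of n x u] by (simp add: mult_ac)
    qed
  qed measurable
  show "integrable lborel (\<lambda>u. fejer_weight n x u * \<bar>ln (\<psi> u)\<bar>)"
  proof (rule Bochner_Integration.integrable_bound[OF integrable_mult_right[OF Bochner_Integration.integrable_add[OF i1 il], of "real n"]])
    show "AE u in lborel. norm (fejer_weight n x u * \<bar>ln (\<psi> u)\<bar>) \<le> norm (real n * (indicator {-pi..pi} u + \<bar>ln (\<psi> u)\<bar> powr (1 + \<eta>) * indicator {-pi..pi} u))"
    proof (rule AE_I2)
      fix u
      define y where "y = \<bar>ln (\<psi> u)\<bar>"
      have y0: "0 \<le> y" unfolding y_def by simp
      have "y \<le> 1 + y powr (1 + \<eta>)"
      proof (cases "y \<le> 1")
        case True
        then show ?thesis by (simp add: add_increasing2)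
      next
        case False
        then have "y powr 1 \<le> y powr (1 + \<eta>)" using eta by (intro powr_mono) auto
        then show ?thesis using False by simp
      qed
      then have "fejer_weight n x u * y \<le> (real n * indicator {-pi..pi} u) * (1 + y powr (1 + \<eta>))"
        using fejer_weight_bound[OF n, of x u] fejer_weight_nonneg[of n x u] y0 by (intro mult_mono) auto
      then show "norm (fejer_weight n x u * \<bar>ln (\<psi> u)\<bar>) \<le> norm (real n * (indicator {-pi..pi} u + \<bar>ln (\<psi> u)\<bar> powr (1 + \<eta>) * indicator {-pi..pi} u))"
        unfolding y_def[symmetric] using fejer_weight_nonneg[of n x u] y0 by (simp add: abs_mult algebra_simps)
    qed
  qed measurable
qed

text \<open>The singular part contributes a nonnegative amount, and the rest is \<open>2 * \<pi>\<close> times the mean of \<open>\<psi>\<close> under the Fejer weight.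
  Jensen's inequality for the exponential function is obtained from its tangent line, \<open>y \<ge> exp (- L) * (1 + ln y + L)\<close>.\<close>

lemma var_fun_jensen:
  assumes n: "0 < n"
  shows "2 * pi * exp (- (\<integral>u. fejer_weight n x u * \<bar>ln (\<psi> u)\<bar> \<partial>lborel)) \<le> var_fun 0 n x"
proof -
  define L where "L = (\<integral>u. fejer_weight n x u * \<bar>ln (\<psi> u)\<bar> \<partial>lborel)"
  define h where "h u = moment_kernel 0 n (x - u)" for u
  have hm[measurable]: "h \<in> borel_measurable borel" unfolding h_def by measurable
  have hb: "\<bar>h u\<bar> \<le> 2 * real n" for u
    unfolding h_def using moment_kernel_le_envelope[OF n, of 0 "x - u"] envelope_le[of n "x - u"] moment_kernel_nonneg[of 0 n "x - u"] by simp
  note dec = integral_mu[OF hm hb]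
  have wl: "h u * (\<psi> u * indicator {-pi..pi} u) = 2 * pi * (fejer_weight n x u * \<psi> u)" for u
    unfolding h_def fejer_weight_def by simp
  have i1: "integrable lborel (\<lambda>u. fejer_weight n x u * \<psi> u)"
  proof -
    have "integrable lborel (\<lambda>u. (1 / (2 * pi)) * (h u * (\<psi> u * indicator {-pi..pi} u)))" by (intro integrable_mult_right dec(3))
    then show ?thesis unfolding wl by simp
  qed
  have W: "integrable lborel (fejer_weight n x)" "(\<integral>u. fejer_weight n x u \<partial>lborel) = 1"
    using has_bochner_fejer_weight[OF n, of x] by (auto simp: has_bochner_integral_iff)
  have "(\<integral>u. exp (- L) * ((1 + L) * fejer_weight n x u - fejer_weight n x u * \<bar>ln (\<psi> u)\<bar>) \<partial>lborel) \<le> (\<integral>u. fejer_weight n x u * \<psi> u \<partial>lborel)"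
  proof (rule integral_mono_AE)
    show "integrable lborel (\<lambda>u. exp (- L) * ((1 + L) * fejer_weight n x u - fejer_weight n x u * \<bar>ln (\<psi> u)\<bar>))"
      using W(1) weighted_log_integrable(1)[OF n] by (intro integrable_mult_right Bochner_Integration.integrable_diff)
    show "AE u in lborel. exp (- L) * ((1 + L) * fejer_weight n x u - fejer_weight n x u * \<bar>ln (\<psi> u)\<bar>) \<le> fejer_weight n x u * \<psi> u"
      using psi_pos
    proof eventually_elim
      fix u assume p: "u \<in> {-pi..pi} \<longrightarrow> 0 < \<psi> u"
      show "exp (- L) * ((1 + L) * fejer_weight n x u - fejer_weight n x u * \<bar>ln (\<psi> u)\<bar>) \<le> fejer_weight n x u * \<psi> u"
      proof (cases "u \<in> {-pi..pi}")
        case True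
        have "1 + L - \<bar>ln (\<psi> u)\<bar> \<le> 1 + (ln (\<psi> u) + L)" by simp
        also have "\<dots> \<le> exp (ln (\<psi> u) + L)" by (rule exp_ge_add_one_self)
        finally have "exp (- L) * (1 + L - \<bar>ln (\<psi> u)\<bar>) \<le> exp (- L) * exp (ln (\<psi> u) + L)" by (intro mult_left_mono) auto
        also have "\<dots> = \<psi> u" using p True by (simp add: exp_add[symmetric])
        finally have "fejer_weight n x u * (exp (- L) * (1 + L - \<bar>ln (\<psi> u)\<bar>)) \<le> fejer_weight n x u * \<psi> u"
          using fejer_weight_nonneg by (intro mult_left_mono) auto
        then show ?thesis by (simp add: algebra_simps)
      next
        case False
        then show ?thesis by (simp add: fejer_weight_def)
      qed
    qed
  qed (rule i1)
  also have "(\<integral>u. exp (- L) * ((1 + L) * fejer_weight n x u - fejer_weight n x u * \<bar>ln (\<psi> u)\<bar>) \<partial>lborel) = exp (- L) * ((1 + L) * 1 - L)"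
    using W weighted_log_integrable(1)[OF n, of x] unfolding L_def by simp
  finally have "exp (- L) \<le> (\<integral>u. fejer_weight n x u * \<psi> u \<partial>lborel)" by simp
  moreover have "var_fun 0 n x = (\<integral>u. h u \<partial>\<mu>s) + 2 * pi * (\<integral>u. fejer_weight n x u * \<psi> u \<partial>lborel)"
    unfolding var_fun_eq using dec(1) by (simp add: wl h_def[symmetric])
  moreover have "0 \<le> (\<integral>u. h u \<partial>\<mu>s)" unfolding h_def by (intro integral_nonneg_AE AE_I2 moment_kernel_nonneg)
  moreover have "2 * pi * exp (- L) \<le> 2 * pi * (\<integral>u. fejer_weight n x u * \<psi> u \<partial>lborel)"
    using calculation(1) by (intro mult_left_mono) auto
  ultimately show ?thesis unfolding L_def[symmetric] by linarith
qed

lemma var_fun_pos: "0 < n \<Longrightarrow> 0 < var_fun 0 n x"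
  by (rule less_le_trans[OF _ var_fun_jensen]) auto

text \<open>A small variance means that the Fejer average of \<open>\<bar>ln \<psi>\<bar>\<close> exceeds \<open>l = m * ln 2\<close>. Values of \<open>\<bar>ln \<psi>\<bar>\<close> below \<open>l / 2\<close>
  contribute at most \<open>l / 2\<close> to this average, so the Fejer average of \<open>\<bar>ln \<psi>\<bar> powr (1 + \<eta>)\<close> is at least
  \<open>(l / 2) powr (1 + \<eta>)\<close>. Averaging does not increase the integral, and Markov's inequality applies.\<close>

lemma small_variance_measure:
  assumes n: "0 < n" and m: "0 < m"
  shows "emeasure lborel {x \<in> {-pi..pi}. var_fun 0 n x < (1 / 2) ^ m} \<le> ennreal (log_mass * (2 / (real m * ln 2)) powr (1 + \<eta>))"
proof -
  \<comment> \<open>\<open>(1 / 2) ^ m = exp (- l)\<close>\<close>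
  define l where "l = real m * ln 2"
  have l0: "0 < l" unfolding l_def using m by simp
  define c where "c = (l / 2) powr (1 + \<eta>)"
  have c0: "0 < c" unfolding c_def using l0 by simp
  define Q where "Q x = (\<integral>\<^sup>+u. ennreal (fejer_weight n x u) * ennreal (\<bar>ln (\<psi> u)\<bar> powr (1 + \<eta>)) \<partial>lborel)" for x
  have Qm[measurable]: "Q \<in> borel_measurable borel" unfolding Q_def by measurable
  let ?A = "{x \<in> {-pi..pi}. var_fun 0 n x < (1 / 2) ^ m}"
  have Am[measurable]: "?A \<in> sets borel" by measurable
  have Qbig: "ennreal c \<le> Q x" if x: "x \<in> ?A" for x
  proof -
    define L where "L = (\<integral>u. fejer_weight n x u * \<bar>ln (\<psi> u)\<bar> \<partial>lborel)"
    define R where "R = (\<integral>u. fejer_weight n x u * \<bar>ln (\<psi> u)\<bar> powr (1 + \<eta>) \<partial>lborel)"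
    have "exp (- L) * 1 \<le> exp (- L) * (2 * pi)" using pi_ge_two by (intro mult_left_mono) auto
    also have "\<dots> \<le> var_fun 0 n x" using var_fun_jensen[OF n, of x] unfolding L_def by (simp add: mult.commute)
    also have "\<dots> < (1 / 2) ^ m" using x by simp
    also have "\<dots> = exp (- l)" unfolding l_def by (simp add: exp_minus exp_of_nat_mult power_divide inverse_eq_divide)
    finally have lL: "l < L" by simp
    have W: "integrable lborel (fejer_weight n x)" "(\<integral>u. fejer_weight n x u \<partial>lborel) = 1"
      using has_bochner_fejer_weight[OF n, of x] by (auto simp: has_bochner_integral_iff)
    have pt: "y \<le> l / 2 + (l / 2) / c * y powr (1 + \<eta>)" if y: "0 \<le> y" for y
    proof (cases "y \<le> l / 2")
      case True
      then show ?thesis using l0 c0 by (simp add: add_increasing2)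
    next
      case False
      define z where "z = y / (l / 2)"
      have z: "1 < z" "y = (l / 2) * z" unfolding z_def using False l0 by (auto simp: field_simps)
      have "z powr 1 \<le> z powr (1 + \<eta>)" using z eta by (intro powr_mono) auto
      then have "(l / 2) * z \<le> (l / 2) * z powr (1 + \<eta>)" using z l0 by (intro mult_left_mono) auto
      also have "z powr (1 + \<eta>) = y powr (1 + \<eta>) / c" unfolding z_def c_def by (rule powr_divide)
      finally have "y \<le> (l / 2) * (y powr (1 + \<eta>) / c)" unfolding z(2)[symmetric] .
      then have "y \<le> (l / 2) / c * y powr (1 + \<eta>)" by simp
      then show ?thesis using l0 by linarith
    qed
    have "L \<le> (\<integral>u. (l / 2) * fejer_weight n x u + (l / 2) / c * (fejer_weight n x u * \<bar>ln (\<psi> u)\<bar> powr (1 + \<eta>)) \<partial>lborel)"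
      unfolding L_def
    proof (rule integral_mono)
      show "integrable lborel (\<lambda>u. (l / 2) * fejer_weight n x u + (l / 2) / c * (fejer_weight n x u * \<bar>ln (\<psi> u)\<bar> powr (1 + \<eta>)))"
        using W(1) weighted_log_integrable(2)[OF n] by (intro Bochner_Integration.integrable_add integrable_mult_right)
      show "fejer_weight n x u * \<bar>ln (\<psi> u)\<bar> \<le> (l / 2) * fejer_weight n x u + (l / 2) / c * (fejer_weight n x u * \<bar>ln (\<psi> u)\<bar> powr (1 + \<eta>))" for u
        using mult_left_mono[OF pt[of "\<bar>ln (\<psi> u)\<bar>"] fejer_weight_nonneg[of n x u]] by (simp add: algebra_simps)
    qed (rule weighted_log_integrable(1)[OF n])
    also have "\<dots> = l / 2 + (l / 2) / c * R"
      using W weighted_log_integrable(2)[OF n, of x] unfolding R_def by simp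
    finally have "l / 2 < (l / 2) / c * R" using lL by linarith
    then have cR: "c \<le> R" using l0 c0 by (simp add: field_simps)
    have "Q x = (\<integral>\<^sup>+u. ennreal (fejer_weight n x u * \<bar>ln (\<psi> u)\<bar> powr (1 + \<eta>)) \<partial>lborel)"
      unfolding Q_def by (intro nn_integral_cong ennreal_mult[symmetric] fejer_weight_nonneg) simp
    also have "\<dots> = ennreal R" unfolding R_def
      by (rule nn_integral_eq_integral[OF weighted_log_integrable(2)[OF n]]) (auto simp: fejer_weight_nonneg)
    finally show ?thesis using cR by (simp add: ennreal_leI)
  qed
  have IQ: "(\<integral>\<^sup>+x. Q x * indicator {-pi..pi} x \<partial>lborel) \<le> ennreal log_mass"
  proof -
    have "(\<integral>\<^sup>+x. Q x * indicator {-pi..pi} x \<partial>lborel) = (\<integral>\<^sup>+x. (\<integral>\<^sup>+u. ennreal (fejer_weight n x u) * ennreal (\<bar>ln (\<psi> u)\<bar> powr (1 + \<eta>)) * indicator {-pi..pi} x \<partial>lborel) \<partial>lborel)"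
      unfolding Q_def by (intro nn_integral_cong nn_integral_multc[symmetric]) measurable
    also have "\<dots> = (\<integral>\<^sup>+u. (\<integral>\<^sup>+x. ennreal (fejer_weight n x u) * ennreal (\<bar>ln (\<psi> u)\<bar> powr (1 + \<eta>)) * indicator {-pi..pi} x \<partial>lborel) \<partial>lborel)"
      by (rule lborel_pair.Fubini') measurable
    also have "\<dots> \<le> (\<integral>\<^sup>+u. ennreal (\<bar>ln (\<psi> u)\<bar> powr (1 + \<eta>)) * indicator {-pi..pi} u \<partial>lborel)"
    proof (intro nn_integral_mono)
      fix u
      have sw: "fejer_weight n x u * indicator {-pi..pi} x = fejer_weight n u x * indicator {-pi..pi} u" for x
      proof -
        have "moment_kernel 0 n (x - u) = moment_kernel 0 n (u - x)"
          unfolding moment_kernel_def by (intro arg_cong2[where f="(*)"] sum.cong refl) (metis cos_minus minus_diff_eq mult_minus_right)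
        then show ?thesis unfolding fejer_weight_def by simp
      qed
      have "(\<integral>\<^sup>+x. ennreal (fejer_weight n x u) * ennreal (\<bar>ln (\<psi> u)\<bar> powr (1 + \<eta>)) * indicator {-pi..pi} x \<partial>lborel)
        = (\<integral>\<^sup>+x. ennreal (fejer_weight n u x) * (ennreal (\<bar>ln (\<psi> u)\<bar> powr (1 + \<eta>)) * indicator {-pi..pi} u) \<partial>lborel)"
      proof (intro nn_integral_cong)
        fix x
        have "ennreal (fejer_weight n x u) * indicator {-pi..pi} x = ennreal (fejer_weight n u x) * indicator {-pi..pi} u"
          using arg_cong[OF sw[of x], of ennreal] by (auto simp: indicator_def split: if_splits)
        then show "ennreal (fejer_weight n x u) * ennreal (\<bar>ln (\<psi> u)\<bar> powr (1 + \<eta>)) * indicator {-pi..pi} x = ennreal (fejer_weight n u x) * (ennreal (\<bar>ln (\<psi> u)\<bar> powr (1 + \<eta>)) * indicator {-pi..pi} u)"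
          by (metis mult.assoc mult.commute)
      qed
      also have "\<dots> = (\<integral>\<^sup>+x. ennreal (fejer_weight n u x) \<partial>lborel) * (ennreal (\<bar>ln (\<psi> u)\<bar> powr (1 + \<eta>)) * indicator {-pi..pi} u)"
        by (rule nn_integral_multc) measurable
      also have "(\<integral>\<^sup>+x. ennreal (fejer_weight n u x) \<partial>lborel) = 1"
        using has_bochner_fejer_weight[OF n, of u] by (subst nn_integral_eq_integral) (auto simp: has_bochner_integral_iff fejer_weight_nonneg)
      finally show "(\<integral>\<^sup>+x. ennreal (fejer_weight n x u) * ennreal (\<bar>ln (\<psi> u)\<bar> powr (1 + \<eta>)) * indicator {-pi..pi} x \<partial>lborel) \<le> ennreal (\<bar>ln (\<psi> u)\<bar> powr (1 + \<eta>)) * indicator {-pi..pi} u"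
        by simp
    qed
    finally show ?thesis unfolding log_mass(1) .
  qed
  have "ennreal c * emeasure lborel ?A = (\<integral>\<^sup>+x. ennreal c * indicator ?A x \<partial>lborel)"
    by (subst nn_integral_cmult_indicator) auto
  also have "\<dots> \<le> (\<integral>\<^sup>+x. Q x * indicator {-pi..pi} x \<partial>lborel)"
    using Qbig by (intro nn_integral_mono) (auto simp: indicator_def)
  also note IQ
  also have "ennreal log_mass = ennreal c * ennreal (log_mass / c)" using c0 log_mass(2) by (simp add: ennreal_mult[symmetric])
  finally have "emeasure lborel ?A \<le> ennreal (log_mass / c)" using c0 by (subst (asm) ennreal_mult_le_mult_iff) auto
  also have "log_mass / c = log_mass * (2 / l) powr (1 + \<eta>)"
  proof -
    have "(2 / l) powr (1 + \<eta>) = (1 / (l / 2)) powr (1 + \<eta>)" by simp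
    also have "\<dots> = 1 / c" unfolding c_def using l0 by (subst powr_divide) auto
    finally show ?thesis by simp
  qed
  finally show ?thesis unfolding l_def .
qed

end

section \<open>The random trigonometric polynomial and its derivatives\<close>

lemma quarter_shift:
  "cos (y + real (Suc j) * (pi / 2)) = - sin (y + real j * (pi / 2))"
  "sin (y + real (Suc j) * (pi / 2)) = cos (y + real j * (pi / 2))"
proof -
  have e: "y + real (Suc j) * (pi / 2) = (y + real j * (pi / 2)) + pi / 2" by (simp add: algebra_simps add_divide_distrib)
  show "cos (y + real (Suc j) * (pi / 2)) = - sin (y + real j * (pi / 2))"
    "sin (y + real (Suc j) * (pi / 2)) = cos (y + real j * (pi / 2))"
    unfolding e by (simp_all only: cos_add sin_add cos_pi_half sin_pi_half mult_zero_right mult_1_right diff_0 add_0)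
qed

lemma cos_diff_phase:
  "cos ((real k - real l) * x) = cos (real k * x + y) * cos (real l * x + y) + sin (real k * x + y) * sin (real l * x + y)"
  unfolding cos_diff[symmetric] by (simp add: algebra_simps)

text \<open>All that is used of the two sequences is the joint characteristic function of their finite linear combinations.\<close>

locale random_trig_model = spectral_model + P: prob_space M for M :: "'a measure" +
  fixes a b :: "nat \<Rightarrow> 'a \<Rightarrow> real"
  assumes a_measurable: "\<And>k. 1 \<le> k \<Longrightarrow> a k \<in> borel_measurable M"
    and b_measurable: "\<And>k. 1 \<le> k \<Longrightarrow> b k \<in> borel_measurable M"
    and joint_char: "\<And>n c d. (CLINT \<omega>|M. iexp (\<Sum>k=1..n. c k * a k \<omega> + d k * b k \<omega>)) =
      of_real (exp (- (\<Sum>k=1..n. \<Sum>l=1..n. (c k * c l + d k * d l) * corr k l) / 2))"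
begin

text \<open>The derivative of order \<open>j\<close> of \<open>f\<^sub>n\<close>; differentiation shifts all phases by a quarter period.\<close>

definition deriv_proc :: "nat \<Rightarrow> nat \<Rightarrow> 'a \<Rightarrow> real \<Rightarrow> real" where
  "deriv_proc j n \<omega> x = (\<Sum>k=1..n. (real k ^ j / sqrt (real n)) *
     (a k \<omega> * cos (real k * x + real j * (pi / 2)) + b k \<omega> * sin (real k * x + real j * (pi / 2))))"

lemma deriv_proc_0: "deriv_proc 0 n \<omega> x = random_trig_poly a b n \<omega> x"
  unfolding deriv_proc_def random_trig_poly_def by (simp add: sum_distrib_left)

lemma deriv_proc_derivative: "(deriv_proc j n \<omega> has_real_derivative deriv_proc (Suc j) n \<omega> x) (at x)"
proof -
  have d: "((\<lambda>x. (real k ^ j / sqrt (real n)) *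
     (a k \<omega> * cos (real k * x + real j * (pi / 2)) + b k \<omega> * sin (real k * x + real j * (pi / 2)))) has_real_derivative
     (real k ^ Suc j / sqrt (real n)) *
     (a k \<omega> * cos (real k * x + real (Suc j) * (pi / 2)) + b k \<omega> * sin (real k * x + real (Suc j) * (pi / 2)))) (at x)" for k
  proof -
    define y where "y = real j * (pi / 2)"
    have eq: "(real k ^ Suc j / sqrt (real n)) * (a k \<omega> * cos (real k * x + real (Suc j) * (pi / 2)) + b k \<omega> * sin (real k * x + real (Suc j) * (pi / 2)))
       = (real k ^ j / sqrt (real n)) * (a k \<omega> * (- sin (real k * x + y) * real k) + b k \<omega> * (cos (real k * x + y) * real k))"
      unfolding quarter_shift y_def by (simp add: algebra_simps)
    have i: "((\<lambda>x. a k \<omega> * cos (real k * x + y) + b k \<omega> * sin (real k * x + y)) has_real_derivative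
       a k \<omega> * (- sin (real k * x + y) * real k) + b k \<omega> * (cos (real k * x + y) * real k)) (at x)"
      by (auto intro!: derivative_eq_intros)
    show ?thesis unfolding eq y_def[symmetric] by (rule DERIV_cmult[OF i])
  qed
  show ?thesis unfolding deriv_proc_def[abs_def] by (intro DERIV_sum d)
qed

lemma continuous_deriv_proc: "continuous_on A (deriv_proc j n \<omega>)"
  by (intro DERIV_continuous_on) (use deriv_proc_derivative has_field_derivative_at_within in blast)

lemma measurable_deriv_proc[measurable]: "(\<lambda>(\<omega>, x). deriv_proc j n \<omega> x) \<in> borel_measurable (M \<Otimes>\<^sub>M borel)"
proof -
  have "(\<lambda>p. a k (fst p)) \<in> borel_measurable (M \<Otimes>\<^sub>M (borel :: real measure))" "(\<lambda>p. b k (fst p)) \<in> borel_measurable (M \<Otimes>\<^sub>M (borel :: real measure))"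
    if "k \<in> {1..n}" for k
    using measurable_compose[OF measurable_fst a_measurable[of k]] measurable_compose[OF measurable_fst b_measurable[of k]] that by auto
  moreover have "(\<lambda>p. cos (c * snd p + e)) \<in> borel_measurable (M \<Otimes>\<^sub>M borel)" "(\<lambda>p. sin (c * snd p + e)) \<in> borel_measurable (M \<Otimes>\<^sub>M borel)" for c e :: real
    by measurable
  ultimately show ?thesis
    unfolding deriv_proc_def split_beta
    by (intro borel_measurable_sum borel_measurable_times borel_measurable_add borel_measurable_const) auto
qed

lemma measurable_deriv_proc_at[measurable]: "(\<lambda>\<omega>. deriv_proc j n \<omega> x) \<in> borel_measurable M"
  unfolding deriv_proc_def
  by (intro borel_measurable_sum borel_measurable_times borel_measurable_add borel_measurable_const a_measurable b_measurable) auto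

lemma deriv_proc_char:
  assumes n: "0 < n"
  shows "(CLINT \<omega>|M. iexp (t * deriv_proc j n \<omega> x)) = of_real (exp (- (t\<^sup>2 * (real n ^ (2 * j) * var_fun j n x)) / 2))"
proof -
  define y where "y = real j * (pi / 2)"
  define c where "c k = t * (real k ^ j / sqrt (real n)) * cos (real k * x + y)" for k
  define d where "d k = t * (real k ^ j / sqrt (real n)) * sin (real k * x + y)" for k
  have "t * deriv_proc j n \<omega> x = (\<Sum>k=1..n. c k * a k \<omega> + d k * b k \<omega>)" for \<omega>
    unfolding deriv_proc_def c_def d_def y_def sum_distrib_left by (intro sum.cong refl) (simp add: algebra_simps)
  then have "(CLINT \<omega>|M. iexp (t * deriv_proc j n \<omega> x)) = of_real (exp (- (\<Sum>k=1..n. \<Sum>l=1..n. (c k * c l + d k * d l) * corr k l) / 2))"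
    using joint_char[where c=c and d=d and n=n] by (simp only:)
  also have "(\<Sum>k=1..n. \<Sum>l=1..n. (c k * c l + d k * d l) * corr k l) = t\<^sup>2 * (real n ^ (2 * j) * var_fun j n x)"
  proof -
    have "(c k * c l + d k * d l) * corr k l = t\<^sup>2 * (real n ^ (2 * j) * ((1 / real n) * ((real k / real n) ^ j * (real l / real n) ^ j * (corr k l * cos ((real k - real l) * x)))))" for k l
    proof -
      have "c k * c l + d k * d l = t\<^sup>2 * (real k ^ j * real l ^ j / (sqrt (real n) * sqrt (real n))) * cos ((real k - real l) * x)"
        unfolding c_def d_def cos_diff_phase[where y=y] by (simp add: power2_eq_square algebra_simps)
      also have "sqrt (real n) * sqrt (real n) = real n" by simp
      finally have 1: "c k * c l + d k * d l = t\<^sup>2 * (real k ^ j * real l ^ j / real n) * cos ((real k - real l) * x)" .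
      have 2: "real k ^ j * real l ^ j / real n = real n ^ (2 * j) * ((1 / real n) * ((real k / real n) ^ j * (real l / real n) ^ j))"
        using n by (simp add: power_divide mult_2 power_add)
      show ?thesis unfolding 1 2 by (simp add: mult_ac)
    qed
    then show ?thesis unfolding var_fun_def by (simp only: sum_distrib_left)
  qed
  finally show ?thesis .
qed

lemma deriv_proc_second_moment:
  assumes n: "0 < n"
  shows "(\<integral>\<^sup>+\<omega>. ennreal ((deriv_proc j n \<omega> x)\<^sup>2) \<partial>M) = ennreal (real n ^ (2 * j) * var_fun j n x)"
  by (rule P.gaussian_second_moment[OF measurable_deriv_proc_at _ deriv_proc_char[OF n]]) (simp add: var_fun_nonneg)

lemma deriv_proc_pair:
  assumes n: "0 < n"
  shows "gaussian_pair M (\<lambda>\<omega>. deriv_proc 0 n \<omega> x) (\<lambda>\<omega>. deriv_proc 1 n \<omega> x) (var_fun 0 n x) (real n * cov_fun n x) ((real n)\<^sup>2 * var_fun 1 n x)"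
proof -
  have "(CLINT \<omega>|M. iexp (\<alpha> * deriv_proc 0 n \<omega> x + \<beta> * deriv_proc 1 n \<omega> x)) =
     of_real (exp (- (\<alpha>\<^sup>2 * var_fun 0 n x + 2 * \<alpha> * \<beta> * (real n * cov_fun n x) + \<beta>\<^sup>2 * ((real n)\<^sup>2 * var_fun 1 n x)) / 2))" for \<alpha> \<beta>
  proof -
    define r where "r = 1 / sqrt (real n)"
    have rr: "r * r = 1 / real n" unfolding r_def by simp
    define c where "c k = r * (\<alpha> * cos (real k * x) - \<beta> * real k * sin (real k * x))" for k
    define d where "d k = r * (\<alpha> * sin (real k * x) + \<beta> * real k * cos (real k * x))" for k
    have qs: "cos (y + pi / 2) = - sin y" "sin (y + pi / 2) = cos y" for y :: real
      by (simp_all add: cos_add sin_add)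
    have "\<alpha> * deriv_proc 0 n \<omega> x + \<beta> * deriv_proc 1 n \<omega> x = (\<Sum>k=1..n. c k * a k \<omega> + d k * b k \<omega>)" for \<omega>
      unfolding deriv_proc_def c_def d_def r_def sum_distrib_left sum.distrib[symmetric]
      by (intro sum.cong refl) (simp add: qs diff_divide_distrib add_divide_distrib algebra_simps)
    then have "(CLINT \<omega>|M. iexp (\<alpha> * deriv_proc 0 n \<omega> x + \<beta> * deriv_proc 1 n \<omega> x)) = of_real (exp (- (\<Sum>k=1..n. \<Sum>l=1..n. (c k * c l + d k * d l) * corr k l) / 2))"
      using joint_char[where c=c and d=d and n=n] by (simp only:)
    also have "(\<Sum>k=1..n. \<Sum>l=1..n. (c k * c l + d k * d l) * corr k l) =
       \<alpha>\<^sup>2 * var_fun 0 n x + 2 * \<alpha> * \<beta> * (real n * cov_fun n x) + \<beta>\<^sup>2 * ((real n)\<^sup>2 * var_fun 1 n x)"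
    proof -
      define co where "co k l = cos ((real k - real l) * x)" for k l :: nat
      define si where "si k l = sin ((real k - real l) * x)" for k l :: nat
      have co: "co k l = cos (real k * x) * cos (real l * x) + sin (real k * x) * sin (real l * x)" for k l
        unfolding co_def by (simp add: left_diff_distrib cos_diff)
      have si: "si k l = sin (real k * x) * cos (real l * x) - cos (real k * x) * sin (real l * x)" for k l
        unfolding si_def by (simp add: left_diff_distrib sin_diff)
      have "c k * c l + d k * d l = (r * r) * (\<alpha>\<^sup>2 * co k l + \<alpha> * \<beta> * (real l * si k l) + \<alpha> * \<beta> * (real k * si l k) + \<beta>\<^sup>2 * (real k * real l * co k l))" for k l
        unfolding c_def d_def co si power2_eq_square by (simp only: algebra_simps)
      then have "(\<Sum>k=1..n. \<Sum>l=1..n. (c k * c l + d k * d l) * corr k l) =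
         (\<Sum>k=1..n. \<Sum>l=1..n. \<alpha>\<^sup>2 * ((1 / real n) * (corr k l * co k l)) + \<alpha> * \<beta> * ((1 / real n) * (real l * (corr k l * si k l)))
            + \<alpha> * \<beta> * ((1 / real n) * (real k * (corr l k * si l k))) + \<beta>\<^sup>2 * ((1 / real n) * (real k * real l * (corr k l * co k l))))"
        unfolding rr by (intro sum.cong refl) (simp only: corr_sym[of l k for l k] distrib_left distrib_right mult_ac)
      also have "\<dots> = \<alpha>\<^sup>2 * ((1 / real n) * (\<Sum>k=1..n. \<Sum>l=1..n. corr k l * co k l)) + \<alpha> * \<beta> * ((1 / real n) * (\<Sum>k=1..n. \<Sum>l=1..n. real l * (corr k l * si k l)))
            + \<alpha> * \<beta> * ((1 / real n) * (\<Sum>k=1..n. \<Sum>l=1..n. real k * (corr l k * si l k))) + \<beta>\<^sup>2 * ((1 / real n) * (\<Sum>k=1..n. \<Sum>l=1..n. real k * real l * (corr k l * co k l)))"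
        by (simp only: sum.distrib sum_distrib_left)
      also have "(\<Sum>k=1..n. \<Sum>l=1..n. real k * (corr l k * si l k)) = (\<Sum>k=1..n. \<Sum>l=1..n. real l * (corr k l * si k l))"
        by (rule sum.swap)
      also have "(1 / real n) * (\<Sum>k=1..n. \<Sum>l=1..n. corr k l * co k l) = var_fun 0 n x"
        unfolding var_fun_def co_def by simp
      also have "(1 / real n) * (\<Sum>k=1..n. \<Sum>l=1..n. real l * (corr k l * si k l)) = real n * cov_fun n x"
        unfolding cov_fun_def si_def sum_distrib_left using n by (intro sum.cong refl) simp
      also have "(1 / real n) * (\<Sum>k=1..n. \<Sum>l=1..n. real k * real l * (corr k l * co k l)) = (real n)\<^sup>2 * var_fun 1 n x"
        unfolding var_fun_def co_def sum_distrib_left using n by (intro sum.cong refl) (simp add: power2_eq_square)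
      finally show ?thesis by (simp add: algebra_simps)
    qed
    finally show ?thesis .
  qed
  then show ?thesis unfolding gaussian_pair_def by simp
qed

text \<open>The Kac--Rice density of zeros.\<close>

definition zero_density :: "nat \<Rightarrow> real \<Rightarrow> real" where
  "zero_density n x = real n / pi * sqrt (var_fun 1 n x / var_fun 0 n x - (cov_fun n x / var_fun 0 n x)\<^sup>2)"

lemma measurable_zero_density[measurable]: "zero_density n \<in> borel_measurable borel"
  unfolding zero_density_def[abs_def] by measurable

lemma zero_density_periodic: "zero_density n (x + 2 * pi) = zero_density n x"
  unfolding zero_density_def var_cov_periodic ..

text \<open>The derivative is again a trigonometric polynomial of degree at most \<open>n\<close>; it vanishes identically only if
  \<open>f\<^sub>n\<close> does.\<close>

lemma expected_zeros:
  assumes n: "0 < n" and st: "s < t" "t \<le> s + 2 * pi"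
  obtains U where "U \<in> borel_measurable M" "AE \<omega> in M. num_zeros (random_trig_poly a b n \<omega>) {s..t} = U \<omega>"
    "(\<integral>\<^sup>+\<omega>. U \<omega> \<partial>M) = (\<integral>\<^sup>+x. ennreal (zero_density n x) * indicator {s..t} x \<partial>lborel)"
proof -
  have rt: "random_trig_poly a b n = deriv_proc 0 n" by (intro ext) (rule deriv_proc_0[symmetric])
  have "\<exists>U\<in>borel_measurable M. (AE \<omega> in M. num_zeros (deriv_proc 0 n \<omega>) {s..t} = U \<omega>) \<and> (\<integral>\<^sup>+\<omega>. U \<omega> \<partial>M) =
    (\<integral>\<^sup>+x. ennreal (sqrt (((real n)\<^sup>2 * var_fun 1 n x) / var_fun 0 n x - ((real n * cov_fun n x) / var_fun 0 n x)\<^sup>2) / pi) * indicator {s..t} x \<partial>lborel)"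
  proof (rule P.kac_rice_formula[where g="deriv_proc 1 n" and K="2 * n", OF measurable_deriv_proc measurable_deriv_proc])
    show "(deriv_proc 0 n \<omega> has_real_derivative deriv_proc 1 n \<omega> x) (at x)" for \<omega> x
      using deriv_proc_derivative[of 0] by simp
    show "continuous_on UNIV (deriv_proc 1 n \<omega>)" for \<omega> by (rule continuous_deriv_proc)
    show "gaussian_pair M (\<lambda>\<omega>. deriv_proc 0 n \<omega> x) (\<lambda>\<omega>. deriv_proc 1 n \<omega> x) (var_fun 0 n x) (real n * cov_fun n x) ((real n)\<^sup>2 * var_fun 1 n x)" for x
      by (rule deriv_proc_pair[OF n])
    show "0 < var_fun 0 n x" for x by (rule var_fun_pos[OF n])
    show "finite {x \<in> {s<..<t}. deriv_proc 1 n \<omega> x = 0} \<and> card {x \<in> {s<..<t}. deriv_proc 1 n \<omega> x = 0} \<le> 2 * n"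
      if nz: "deriv_proc 0 n \<omega> s \<noteq> 0" for \<omega>
    proof -
      define A where "A k = real k * (b k \<omega> / sqrt (real n))" for k
      define B where "B k = - real k * (a k \<omega> / sqrt (real n))" for k
      have qs: "cos (y + pi / 2) = - sin y" "sin (y + pi / 2) = cos y" for y :: real
        by (simp_all add: cos_add sin_add)
      have eq: "deriv_proc 1 n \<omega> = trig_poly A B n"
        by (intro ext) (simp add: deriv_proc_def trig_poly_def A_def B_def qs algebra_simps)
      have "\<exists>j\<in>{1..n}. a j \<omega> \<noteq> 0 \<or> b j \<omega> \<noteq> 0"
      proof (rule ccontr)
        assume "\<not> ?thesis"
        then have "deriv_proc 0 n \<omega> s = 0" unfolding deriv_proc_def by (intro sum.neutral) auto
        then show False using nz by simp
      qed
      then obtain j where j: "j \<in> {1..n}" "A j \<noteq> 0 \<or> B j \<noteq> 0" unfolding A_def B_def using n by auto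
      show ?thesis unfolding eq using trig_poly_zeros[where A=A and B=B, OF j st(2)] by simp
    qed
  qed (use st in \<open>auto intro!: continuous_intros\<close>)
  then obtain U where U: "U \<in> borel_measurable M" "AE \<omega> in M. num_zeros (deriv_proc 0 n \<omega>) {s..t} = U \<omega>" "(\<integral>\<^sup>+\<omega>. U \<omega> \<partial>M) =
    (\<integral>\<^sup>+x. ennreal (sqrt (((real n)\<^sup>2 * var_fun 1 n x) / var_fun 0 n x - ((real n * cov_fun n x) / var_fun 0 n x)\<^sup>2) / pi) * indicator {s..t} x \<partial>lborel)"
    by (elim bexE conjE)
  note U(3)
  also have "(\<integral>\<^sup>+x. ennreal (sqrt (((real n)\<^sup>2 * var_fun 1 n x) / var_fun 0 n x - ((real n * cov_fun n x) / var_fun 0 n x)\<^sup>2) / pi) * indicator {s..t} x \<partial>lborel)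
     = (\<integral>\<^sup>+x. ennreal (zero_density n x) * indicator {s..t} x \<partial>lborel)"
  proof (intro nn_integral_cong)
    fix x
    have "((real n)\<^sup>2 * var_fun 1 n x) / var_fun 0 n x - ((real n * cov_fun n x) / var_fun 0 n x)\<^sup>2 = (real n)\<^sup>2 * (var_fun 1 n x / var_fun 0 n x - (cov_fun n x / var_fun 0 n x)\<^sup>2)"
      by (simp add: right_diff_distrib power_mult_distrib power_divide)
    then have "sqrt (((real n)\<^sup>2 * var_fun 1 n x) / var_fun 0 n x - ((real n * cov_fun n x) / var_fun 0 n x)\<^sup>2) / pi = zero_density n x"
      unfolding zero_density_def by (simp add: real_sqrt_mult)
    then show "ennreal (sqrt (((real n)\<^sup>2 * var_fun 1 n x) / var_fun 0 n x - ((real n * cov_fun n x) / var_fun 0 n x)\<^sup>2) / pi) * indicator {s..t} x = ennreal (zero_density n x) * indicator {s..t} x"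
      by simp
  qed
  finally show ?thesis using that U(1,2) unfolding rt by blast
qed

end

section \<open>Zero counts in windows are uniformly integrable\<close>

context random_trig_model
begin

text \<open>The expected number of zeros in a window of length \<open>1 / (4 * n)\<close> starting at \<open>x\<close>, with Kac--Rice built in so that
  it is visibly measurable in \<open>x\<close>.\<close>

definition window_zeros :: "nat \<Rightarrow> real \<Rightarrow> ennreal" where
  "window_zeros n x = (\<integral>\<^sup>+t. ennreal (zero_density n (x + t)) * indicator {0..1 / (4 * real n)} t \<partial>lborel)"

lemma measurable_window_zeros[measurable]: "window_zeros n \<in> borel_measurable borel"
  unfolding window_zeros_def[abs_def] by measurable

lemma window_zeros_expectation:
  assumes n: "0 < n"
  shows "window_zeros n x = (\<integral>\<^sup>+\<omega>. num_zeros (random_trig_poly a b n \<omega>) {x..x + 1 / (4 * real n)} \<partial>M)"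
proof -
  have h: "0 < 1 / (4 * real n)" "1 / (4 * real n) \<le> 1" using n by (auto simp: field_simps)
  have p: "1 \<le> 2 * pi" using pi_ge_two by simp
  obtain U where U: "AE \<omega> in M. num_zeros (random_trig_poly a b n \<omega>) {x..x + 1 / (4 * real n)} = U \<omega>"
    "(\<integral>\<^sup>+\<omega>. U \<omega> \<partial>M) = (\<integral>\<^sup>+t. ennreal (zero_density n t) * indicator {x..x + 1 / (4 * real n)} t \<partial>lborel)"
    by (rule expected_zeros[OF n, of x "x + 1 / (4 * real n)"]) (use h p in linarith)+
  have "(\<integral>\<^sup>+\<omega>. num_zeros (random_trig_poly a b n \<omega>) {x..x + 1 / (4 * real n)} \<partial>M) = (\<integral>\<^sup>+\<omega>. U \<omega> \<partial>M)"
    by (rule nn_integral_cong_AE[OF U(1)])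
  then show ?thesis unfolding U(2) window_zeros_def by (subst window_shift) auto
qed

text \<open>An upper bound for the probability that a window contains more than \<open>m\<close> zeros. The first two summands bound the
  probability of \<open>\<bar>f\<^sub>n(x)\<bar> \<le> 2 ^ (- (m + 1))\<close>, the last one that of a large derivative of order \<open>m + 1\<close>.\<close>

definition tail_term :: "nat \<Rightarrow> nat \<Rightarrow> real \<Rightarrow> ennreal" where
  "tail_term n m x = ennreal (sqrt (1 / 2) ^ Suc m) + (indicator {y. var_fun 0 n y < (1 / 2) ^ Suc m} x
     + ennreal (4 * real n * (1 / 4) ^ Suc m) * (\<integral>\<^sup>+t. ennreal (var_fun (Suc m) n (x + t)) * indicator {0..1 / (4 * real n)} t \<partial>lborel))"

text \<open>The density of \<open>f\<^sub>n(x)\<close> is at most \<open>1 / sqrt (2 * \<pi> * S)\<close>, and \<open>S\<close> is at least the threshold itself outside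
  the set in the indicator.\<close>

lemma small_value_probability:
  assumes n: "0 < n"
  shows "emeasure M {\<omega> \<in> space M. \<bar>deriv_proc 0 n \<omega> x\<bar> \<le> (1 / 2) ^ Suc m} \<le>
    ennreal (sqrt (1 / 2) ^ Suc m) + indicator {y. var_fun 0 n y < (1 / 2) ^ Suc m} x"
proof (cases "var_fun 0 n x < (1 / 2) ^ Suc m")
  case True
  then have "(1 :: ennreal) \<le> ennreal (sqrt (1 / 2) ^ Suc m) + indicator {y. var_fun 0 n y < (1 / 2) ^ Suc m} x" by simp
  then show ?thesis using P.emeasure_le_1 by (rule order_trans[rotated])
next
  case False
  define th :: real where "th = (1 / 2) ^ Suc m"
  have th: "0 < th" unfolding th_def by simp
  define v where "v = var_fun 0 n x"
  have v: "0 < v" "th \<le> v" using False var_fun_pos[OF n, of x] unfolding v_def th_def by auto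
  have ch: "(CLINT \<omega>|M. iexp (t * deriv_proc 0 n \<omega> x)) = of_real (exp (- (t\<^sup>2 * v) / 2))" for t
    using deriv_proc_char[OF n, of t 0 x] unfolding v_def by simp
  have "P.prob {\<omega> \<in> space M. \<bar>deriv_proc 0 n \<omega> x\<bar> \<le> th} \<le> 2 * th * normal_density 0 (sqrt v) 0"
    by (rule P.gaussian_small_ball(1)[OF measurable_deriv_proc_at v(1) ch]) (use th in simp)
  also have "\<dots> = 2 * th / sqrt (2 * pi * v)" unfolding normal_density_def using v by simp
  also have "\<dots> \<le> 2 * th / sqrt (4 * th)"
  proof (rule divide_left_mono)
    have "2 * 2 * th \<le> 2 * pi * v" using v th pi_ge_two by (intro mult_mono) auto
    then show "sqrt (4 * th) \<le> sqrt (2 * pi * v)" by simp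
  qed (use th v in auto)
  also have "\<dots> = sqrt th" using th by (simp add: real_sqrt_mult real_div_sqrt)
  also have "\<dots> = sqrt (1 / 2) ^ Suc m" unfolding th_def by (rule real_sqrt_power)
  finally have "ennreal (P.prob {\<omega> \<in> space M. \<bar>deriv_proc 0 n \<omega> x\<bar> \<le> th}) \<le> ennreal (sqrt (1 / 2) ^ Suc m)" by (rule ennreal_leI)
  then show ?thesis unfolding P.emeasure_eq_measure th_def by (rule order_trans) simp
qed

text \<open>Markov's inequality. The window length \<open>1 / (4 * n)\<close> was chosen such that the powers of \<open>n\<close> cancel and
  the factor \<open>4 ^ (- (m + 1))\<close> remains.\<close>

lemma large_derivative_probability:
  assumes n: "0 < n"
  defines "h \<equiv> 1 / (4 * real n)"
  shows "emeasure M {\<omega> \<in> space M. ennreal (((1 / 2) ^ Suc m)\<^sup>2 / h ^ (2 * m + 1)) \<le> (\<integral>\<^sup>+t. ennreal ((deriv_proc (Suc m) n \<omega> t)\<^sup>2) * indicator {x..x + h} t \<partial>lborel)}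
     \<le> ennreal (4 * real n * (1 / 4) ^ Suc m) * (\<integral>\<^sup>+t. ennreal (var_fun (Suc m) n (x + t)) * indicator {0..h} t \<partial>lborel)"
proof -
  define c where "c = ((1 / 2) ^ Suc m)\<^sup>2 / h ^ (2 * m + 1)"
  have h0: "0 < h" unfolding h_def using n by simp
  have c0: "0 < c" unfolding c_def using h0 by simp
  define Y where "Y \<omega> = (\<integral>\<^sup>+t. ennreal ((deriv_proc (Suc m) n \<omega> t)\<^sup>2) * indicator {x..x + h} t \<partial>lborel)" for \<omega>
  have Ym[measurable]: "Y \<in> borel_measurable M" unfolding Y_def by measurable
  define V where "V = (\<integral>\<^sup>+t. ennreal (var_fun (Suc m) n t) * indicator {x..x + h} t \<partial>lborel)"
  have sf: "pair_sigma_finite M (lborel :: real measure)" by (intro pair_sigma_finite.intro sigma_finite_lborel) unfold_locales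
  have "(\<integral>\<^sup>+\<omega>. Y \<omega> \<partial>M) = (\<integral>\<^sup>+t. (\<integral>\<^sup>+\<omega>. ennreal ((deriv_proc (Suc m) n \<omega> t)\<^sup>2) * indicator {x..x + h} t \<partial>M) \<partial>lborel)"
    unfolding Y_def by (rule pair_sigma_finite.Fubini'[OF sf, symmetric]) measurable
  also have "\<dots> = (\<integral>\<^sup>+t. ennreal (real n ^ (2 * Suc m)) * (ennreal (var_fun (Suc m) n t) * indicator {x..x + h} t) \<partial>lborel)"
  proof (intro nn_integral_cong)
    fix t
    have "(\<integral>\<^sup>+\<omega>. ennreal ((deriv_proc (Suc m) n \<omega> t)\<^sup>2) * indicator {x..x + h} t \<partial>M) = (\<integral>\<^sup>+\<omega>. ennreal ((deriv_proc (Suc m) n \<omega> t)\<^sup>2) \<partial>M) * indicator {x..x + h} t"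
      by (rule nn_integral_multc) measurable
    also have "\<dots> = ennreal (real n ^ (2 * Suc m)) * (ennreal (var_fun (Suc m) n t) * indicator {x..x + h} t)"
      unfolding deriv_proc_second_moment[OF n] by (simp add: ennreal_mult var_fun_nonneg mult.assoc)
    finally show "(\<integral>\<^sup>+\<omega>. ennreal ((deriv_proc (Suc m) n \<omega> t)\<^sup>2) * indicator {x..x + h} t \<partial>M) = ennreal (real n ^ (2 * Suc m)) * (ennreal (var_fun (Suc m) n t) * indicator {x..x + h} t)" .
  qed
  also have "\<dots> = ennreal (real n ^ (2 * Suc m)) * V" unfolding V_def by (rule nn_integral_cmult) measurable
  finally have EY: "(\<integral>\<^sup>+\<omega>. Y \<omega> \<partial>M) = ennreal (real n ^ (2 * Suc m)) * V" .
  have "ennreal c * emeasure M {\<omega> \<in> space M. ennreal c \<le> Y \<omega>} = (\<integral>\<^sup>+\<omega>. ennreal c * indicator {\<omega> \<in> space M. ennreal c \<le> Y \<omega>} \<omega> \<partial>M)"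
    by (rule nn_integral_cmult_indicator[symmetric]) measurable
  also have "\<dots> \<le> (\<integral>\<^sup>+\<omega>. Y \<omega> \<partial>M)" by (intro nn_integral_mono) (auto simp: indicator_def)
  also have "\<dots> = ennreal (real n ^ (2 * Suc m)) * V" by (rule EY)
  also have "real n ^ (2 * Suc m) = c * (4 * real n * (1 / 4) ^ Suc m)"
  proof -
    have h2: "h ^ (2 * m + 1) = 1 / ((4 * real n) ^ (2 * m + 1))" unfolding h_def by (simp add: power_divide)
    have q: "((1 / 2 :: real) ^ Suc m)\<^sup>2 = (1 / 4) ^ Suc m" by (simp add: power2_eq_square power_mult_distrib[symmetric])
    have c1: "c = (1 / 4) ^ Suc m * (4 * real n) ^ (2 * m + 1)" unfolding c_def h2 q by simp
    have "c * (4 * real n * (1 / 4) ^ Suc m) = (1 / 4) ^ Suc m * (1 / 4) ^ Suc m * (4 * real n) ^ Suc (2 * m + 1)"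
      unfolding c1 by (simp only: power_Suc mult_ac)
    also have "\<dots> = (1 / 4) ^ Suc m * (1 / 4) ^ Suc m * (4 ^ Suc m * 4 ^ Suc m) * real n ^ (2 * Suc m)"
      by (simp add: power_mult_distrib power_add[symmetric] mult_2)
    also have "(1 / 4) ^ Suc m * (1 / 4) ^ Suc m * (4 ^ Suc m * 4 ^ Suc m) = (1 :: real)"
      by (simp only: power_mult_distrib[symmetric]) simp
    finally have "c * (4 * real n * (1 / 4) ^ Suc m) = real n ^ (2 * Suc m)" by (simp only: mult_1_left)
    then show ?thesis by (rule sym)
  qed
  also have "ennreal (c * (4 * real n * (1 / 4) ^ Suc m)) * V = ennreal c * (ennreal (4 * real n * (1 / 4) ^ Suc m) * V)"
    using c0 by (simp add: ennreal_mult mult.assoc)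
  finally have "emeasure M {\<omega> \<in> space M. ennreal c \<le> Y \<omega>} \<le> ennreal (4 * real n * (1 / 4) ^ Suc m) * V"
    using c0 by (subst (asm) ennreal_mult_le_mult_iff) auto
  then show ?thesis unfolding c_def Y_def V_def by (subst window_shift) auto
qed

lemma window_zeros_bound:
  assumes n: "0 < n"
  shows "window_zeros n x \<le> of_nat K + (\<Sum>i. tail_term n (K + i) x)"
proof -
  define h where "h = 1 / (4 * real n)"
  have h0: "0 < h" unfolding h_def using n by simp
  have rt: "random_trig_poly a b n = deriv_proc 0 n" by (intro ext) (rule deriv_proc_0[symmetric])
  define A where "A m = {\<omega> \<in> space M. \<bar>deriv_proc 0 n \<omega> x\<bar> \<le> (1 / 2) ^ Suc m}" for m
  define D where "D m = {\<omega> \<in> space M. ennreal (((1 / 2) ^ Suc m)\<^sup>2 / h ^ (2 * m + 1)) \<le> (\<integral>\<^sup>+t. ennreal ((deriv_proc (Suc m) n \<omega> t)\<^sup>2) * indicator {x..x + h} t \<partial>lborel)}" for m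
  have Am[measurable]: "A m \<in> sets M" for m unfolding A_def by measurable
  have Dm[measurable]: "D m \<in> sets M" for m unfolding D_def by measurable
  have "window_zeros n x = (\<integral>\<^sup>+\<omega>. num_zeros (deriv_proc 0 n \<omega>) {x..x + h} \<partial>M)"
    unfolding window_zeros_expectation[OF n] rt h_def ..
  also have "\<dots> \<le> (\<integral>\<^sup>+\<omega>. of_nat K + (\<Sum>i. indicator (A (K + i)) \<omega> + indicator (D (K + i)) \<omega>) \<partial>M)"
  proof (intro nn_integral_mono)
    fix \<omega> assume w: "\<omega> \<in> space M"
    have "num_zeros (deriv_proc 0 n \<omega>) {x..x + h} \<le> of_nat K + (\<Sum>i. if \<omega> \<in> A (K + i) \<or> \<omega> \<in> D (K + i) then 1 else 0)"
    proof (rule num_zeros_le_suminf)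
      fix m Z assume Z: "finite Z" "card Z = Suc m" "Z \<subseteq> {x..x + h}" "\<And>z. z \<in> Z \<Longrightarrow> deriv_proc 0 n \<omega> z = 0"
      have "\<bar>deriv_proc 0 n \<omega> x\<bar> \<le> (1 / 2) ^ Suc m \<or> ennreal (((1 / 2) ^ Suc m)\<^sup>2 / h ^ (2 * m + 1)) \<le> (\<integral>\<^sup>+t. ennreal ((deriv_proc (Suc m) n \<omega> t)\<^sup>2) * indicator {x..x + h} t \<partial>lborel)"
        by (rule many_zeros_dichotomy[where F="\<lambda>j. deriv_proc j n \<omega>", OF deriv_proc_derivative Z h0]) auto
      then show "\<omega> \<in> A m \<or> \<omega> \<in> D m" unfolding A_def D_def using w by simp
    qed
    also have "\<dots> \<le> of_nat K + (\<Sum>i. indicator (A (K + i)) \<omega> + indicator (D (K + i)) \<omega>)"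
      by (intro add_left_mono suminf_le) (auto simp: indicator_def)
    finally show "num_zeros (deriv_proc 0 n \<omega>) {x..x + h} \<le> of_nat K + (\<Sum>i. indicator (A (K + i)) \<omega> + indicator (D (K + i)) \<omega>)" .
  qed
  also have "\<dots> = of_nat K + (\<Sum>i. emeasure M (A (K + i)) + emeasure M (D (K + i)))"
    by (subst nn_integral_add, simp, simp, subst nn_integral_suminf, simp, subst nn_integral_add) (simp_all add: P.emeasure_space_1)
  also have "\<dots> \<le> of_nat K + (\<Sum>i. tail_term n (K + i) x)"
  proof (intro add_left_mono suminf_le summableI)
    fix i
    have "emeasure M (A (K + i)) + emeasure M (D (K + i)) \<le> (ennreal (sqrt (1 / 2) ^ Suc (K + i)) + indicator {y. var_fun 0 n y < (1 / 2) ^ Suc (K + i)} x)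
      + ennreal (4 * real n * (1 / 4) ^ Suc (K + i)) * (\<integral>\<^sup>+t. ennreal (var_fun (Suc (K + i)) n (x + t)) * indicator {0..h} t \<partial>lborel)"
      unfolding A_def D_def h_def by (intro add_mono small_value_probability[OF n] large_derivative_probability[OF n])
    then show "emeasure M (A (K + i)) + emeasure M (D (K + i)) \<le> tail_term n (K + i) x"
      unfolding tail_term_def h_def by (simp only: add.assoc)
  qed
  finally show ?thesis .
qed

text \<open>A bound for the integral of \<open>tail_term n m\<close> over a period that is independent of \<open>n\<close> and summable in \<open>m\<close>.\<close>

definition tail_bound :: "nat \<Rightarrow> real" where
  "tail_bound m = 2 * pi * sqrt (1 / 2) ^ Suc m + (log_mass * (2 / (real (Suc m) * ln 2)) powr (1 + \<eta>) + 2 * pi * (1 / 4) ^ Suc m)"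

lemma tail_bound_nonneg: "0 \<le> tail_bound m"
  unfolding tail_bound_def using log_mass(2) by simp

text \<open>The exponent \<open>1 + \<eta>\<close> exceeds one.\<close>

lemma summable_tail_bound: "summable tail_bound"
proof -
  have "summable (\<lambda>m. (2 / ln 2) powr (1 + \<eta>) * of_nat (Suc m) powr (- (1 + \<eta>)))"
    using eta by (intro summable_mult) (subst summable_Suc_iff, simp add: summable_real_powr_iff)
  moreover have "(2 / (real (Suc m) * ln 2)) powr (1 + \<eta>) = (2 / ln 2) powr (1 + \<eta>) * of_nat (Suc m) powr (- (1 + \<eta>))" for m
  proof -
    have eq: "2 / (real (Suc m) * ln 2) = (2 / ln 2) / real (Suc m)" by simp
    have "(2 / (real (Suc m) * ln 2)) powr (1 + \<eta>) = (2 / ln 2) powr (1 + \<eta>) / real (Suc m) powr (1 + \<eta>)"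
      unfolding eq by (rule powr_divide)
    then show ?thesis by (simp only: powr_minus divide_inverse)
  qed
  ultimately have "summable (\<lambda>m. (2 / (real (Suc m) * ln 2)) powr (1 + \<eta>))" by (simp only:)
  moreover have "sqrt (1 / 2) < 1" by (simp add: real_sqrt_lt_1_iff)
  then have "summable (\<lambda>m. sqrt (1 / 2) ^ m)" by (intro summable_geometric) simp
  then have "summable (\<lambda>m. sqrt (1 / 2) ^ Suc m)" by (subst summable_Suc_iff)
  moreover have "summable (\<lambda>m. (1 / 4 :: real) ^ m)" by (intro summable_geometric) simp
  then have "summable (\<lambda>m. (1 / 4 :: real) ^ Suc m)" by (subst summable_Suc_iff)
  ultimately show ?thesis unfolding tail_bound_def[abs_def] by (intro summable_add summable_mult)
qed

lemma tail_term_integral: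
  assumes n: "0 < n"
  shows "(\<integral>\<^sup>+x. tail_term n m x * indicator {-pi..pi} x \<partial>lborel) \<le> ennreal (tail_bound m)"
proof -
  define h where "h = 1 / (4 * real n)"
  have h0: "0 < h" "h \<le> 1" unfolding h_def using n by (auto simp: field_simps)
  define V where "V x = (\<integral>\<^sup>+t. ennreal (var_fun (Suc m) n (x + t)) * indicator {0..h} t \<partial>lborel)" for x
  have Vm[measurable]: "V \<in> borel_measurable borel" unfolding V_def by measurable
  have IV: "(\<integral>\<^sup>+x. V x * indicator {-pi..pi} x \<partial>lborel) \<le> ennreal (2 * pi * h)"
  proof -
    have "(\<integral>\<^sup>+x. V x * indicator {-pi..pi} x \<partial>lborel) = (\<integral>\<^sup>+x. (\<integral>\<^sup>+t. ennreal (var_fun (Suc m) n (x + t)) * indicator {0..h} t * indicator {-pi..pi} x \<partial>lborel) \<partial>lborel)"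
      unfolding V_def by (intro nn_integral_cong nn_integral_multc[symmetric]) measurable
    also have "\<dots> = (\<integral>\<^sup>+t. (\<integral>\<^sup>+x. ennreal (var_fun (Suc m) n (x + t)) * indicator {0..h} t * indicator {-pi..pi} x \<partial>lborel) \<partial>lborel)"
      by (rule lborel_pair.Fubini') measurable
    also have "\<dots> \<le> (\<integral>\<^sup>+t. ennreal (2 * pi) * indicator {0..h} t \<partial>lborel)"
    proof (intro nn_integral_mono)
      fix t
      show "(\<integral>\<^sup>+x. ennreal (var_fun (Suc m) n (x + t)) * indicator {0..h} t * indicator {-pi..pi} x \<partial>lborel) \<le> ennreal (2 * pi) * indicator {0..h} t"
      proof (cases "t \<in> {0..h}")
        case True
        have "(\<integral>\<^sup>+x. ennreal (var_fun (Suc m) n (x + t)) * indicator {-pi..-pi + 2 * pi} x \<partial>lborel) = (\<integral>\<^sup>+x. ennreal (var_fun (Suc m) n x) * indicator {-pi..-pi + 2 * pi} x \<partial>lborel)"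
          by (rule nn_integral_period_shift) (use True h0 pi_ge_two in \<open>auto simp: var_cov_periodic\<close>)
        also have "\<dots> = ennreal (2 * pi * mean_power (Suc m) n)" using nn_integral_var_fun[of "Suc m" n] by simp
        also have "\<dots> \<le> ennreal (2 * pi)" using mean_power_bounds[of "Suc m" n] by (intro ennreal_leI) (simp add: mult_left_le)
        finally show ?thesis using True by simp
      qed simp
    qed
    also have "\<dots> = ennreal (2 * pi * h)" using h0 by (simp add: nn_integral_cmult_indicator ennreal_mult)
    finally show ?thesis .
  qed
  have Sm[measurable]: "{y. var_fun 0 n y < (1 / 2) ^ Suc m} \<in> sets borel" by measurable
  have IS: "(\<integral>\<^sup>+x. indicator {y. var_fun 0 n y < (1 / 2) ^ Suc m} x * indicator {-pi..pi} x \<partial>lborel) \<le> ennreal (log_mass * (2 / (real (Suc m) * ln 2)) powr (1 + \<eta>))"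
  proof -
    have "(\<integral>\<^sup>+x. indicator {y. var_fun 0 n y < (1 / 2) ^ Suc m} x * indicator {-pi..pi} x \<partial>lborel) = (\<integral>\<^sup>+x. indicator {x \<in> {-pi..pi}. var_fun 0 n x < (1 / 2) ^ Suc m} x \<partial>lborel)"
      by (intro nn_integral_cong) (auto simp: indicator_def)
    also have "\<dots> = emeasure lborel {x \<in> {-pi..pi}. var_fun 0 n x < (1 / 2) ^ Suc m}"
      by (rule nn_integral_indicator) measurable
    also have "\<dots> \<le> ennreal (log_mass * (2 / (real (Suc m) * ln 2)) powr (1 + \<eta>))"
      by (rule small_variance_measure[OF n]) simp
    finally show ?thesis .
  qed
  have "(\<integral>\<^sup>+x. tail_term n m x * indicator {-pi..pi} x \<partial>lborel) = (\<integral>\<^sup>+x. ennreal (sqrt (1 / 2) ^ Suc m) * indicator {-pi..pi} x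
      + (indicator {y. var_fun 0 n y < (1 / 2) ^ Suc m} x * indicator {-pi..pi} x + ennreal (4 * real n * (1 / 4) ^ Suc m) * (V x * indicator {-pi..pi} x)) \<partial>lborel)"
    unfolding tail_term_def V_def h_def by (intro nn_integral_cong) (auto simp: indicator_def)
  also have "\<dots> = ennreal (sqrt (1 / 2) ^ Suc m) * emeasure lborel {-pi..pi}
      + ((\<integral>\<^sup>+x. indicator {y. var_fun 0 n y < (1 / 2) ^ Suc m} x * indicator {-pi..pi} x \<partial>lborel) + ennreal (4 * real n * (1 / 4) ^ Suc m) * (\<integral>\<^sup>+x. V x * indicator {-pi..pi} x \<partial>lborel))"
    by (subst nn_integral_add, measurable, subst nn_integral_add, measurable, subst nn_integral_cmult, measurable, subst nn_integral_cmult_indicator) simp_all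
  also have "\<dots> \<le> ennreal (sqrt (1 / 2) ^ Suc m) * ennreal (2 * pi)
      + (ennreal (log_mass * (2 / (real (Suc m) * ln 2)) powr (1 + \<eta>)) + ennreal (4 * real n * (1 / 4) ^ Suc m) * ennreal (2 * pi * h))"
    by (intro add_mono IS mult_left_mono IV) (auto simp: emeasure_lborel_Icc_eq)
  also have "\<dots> = ennreal (sqrt (1 / 2) ^ Suc m * (2 * pi) + (log_mass * (2 / (real (Suc m) * ln 2)) powr (1 + \<eta>) + 4 * real n * (1 / 4) ^ Suc m * (2 * pi * h)))"
    using log_mass(2) h0 by (simp add: ennreal_mult[symmetric] ennreal_plus[symmetric] del: ennreal_plus power_Suc of_nat_Suc)
  also have "sqrt (1 / 2) ^ Suc m * (2 * pi) + (log_mass * (2 / (real (Suc m) * ln 2)) powr (1 + \<eta>) + 4 * real n * (1 / 4) ^ Suc m * (2 * pi * h)) = tail_bound m"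
    unfolding tail_bound_def h_def using n by (simp del: power_Suc of_nat_Suc)
  finally show ?thesis .
qed

text \<open>The first \<open>K\<close> zeros are controlled by the size of \<open>B\<close>, the others by the tail of a series that depends
  neither on \<open>n\<close> nor on \<open>B\<close>.\<close>

lemma window_zeros_uniformly_integrable:
  assumes n: "0 < n" and B[measurable]: "B \<in> sets borel"
  shows "(\<integral>\<^sup>+x. window_zeros n x * indicator (B \<inter> {-pi..pi}) x \<partial>lborel) \<le> of_nat K * emeasure lborel B + ennreal (\<Sum>i. tail_bound (i + K))"
proof -
  have tm[measurable]: "tail_term n m \<in> borel_measurable borel" for m unfolding tail_term_def[abs_def] by measurable
  have "(\<integral>\<^sup>+x. window_zeros n x * indicator (B \<inter> {-pi..pi}) x \<partial>lborel) \<le> (\<integral>\<^sup>+x. of_nat K * indicator B x + (\<Sum>i. tail_term n (K + i) x * indicator {-pi..pi} x) \<partial>lborel)"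
  proof (intro nn_integral_mono)
    fix x
    show "window_zeros n x * indicator (B \<inter> {-pi..pi}) x \<le> of_nat K * indicator B x + (\<Sum>i. tail_term n (K + i) x * indicator {-pi..pi} x)"
      using window_zeros_bound[OF n, of x K] by (auto simp: indicator_def)
  qed
  also have "\<dots> = of_nat K * emeasure lborel B + (\<Sum>i. \<integral>\<^sup>+x. tail_term n (K + i) x * indicator {-pi..pi} x \<partial>lborel)"
    by (subst nn_integral_add, measurable, subst nn_integral_cmult_indicator, simp, subst nn_integral_suminf) simp_all
  also have "\<dots> \<le> of_nat K * emeasure lborel B + (\<Sum>i. ennreal (tail_bound (K + i)))"
    by (intro add_left_mono suminf_le summableI tail_term_integral[OF n])
  also have "(\<Sum>i. ennreal (tail_bound (K + i))) = ennreal (\<Sum>i. tail_bound (K + i))"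
  proof (rule suminf_ennreal2)
    have "summable (\<lambda>i. tail_bound (i + K))" using summable_tail_bound by (rule summable_ignore_initial_segment)
    then show "summable (\<lambda>i. tail_bound (K + i))" by (simp add: add.commute)
  qed (rule tail_bound_nonneg)
  finally show ?thesis by (simp add: add.commute)
qed

end

section \<open>Typical windows and the limit\<close>

lemma tendsto_ennreal_sandwich:
  assumes "0 \<le> L" and "\<And>e. 0 < e \<Longrightarrow> \<forall>\<^sub>F n in F. ennreal (L - e) \<le> W n \<and> W n \<le> ennreal (L + e)"
  shows "(W \<longlongrightarrow> ennreal L) F"
proof (rule order_tendstoI)
  fix z assume z: "z < ennreal L"
  then obtain r where r: "0 \<le> r" "z = ennreal r" by (cases z) auto
  then have "r < L" using z by (simp add: ennreal_less_iff)
  then have "\<forall>\<^sub>F n in F. ennreal (L - (L - r) / 2) \<le> W n \<and> W n \<le> ennreal (L + (L - r) / 2)" by (intro assms) simp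
  then show "\<forall>\<^sub>F n in F. z < W n"
  proof eventually_elim
    fix n assume "ennreal (L - (L - r) / 2) \<le> W n \<and> W n \<le> ennreal (L + (L - r) / 2)"
    moreover have "z < ennreal (L - (L - r) / 2)" unfolding r(2) using r(1) \<open>r < L\<close> by (intro ennreal_lessI) (auto simp: field_simps)
    ultimately show "z < W n" by (auto intro: less_le_trans)
  qed
next
  fix z assume z: "ennreal L < z"
  obtain e where e: "0 < e" "ennreal (L + e) < z"
  proof (cases z)
    case (real r)
    then have "L < r" using z assms(1) by (simp add: ennreal_less_iff)
    then have "ennreal (L + (r - L) / 2) < z" unfolding real(2) using assms(1) by (intro ennreal_lessI) (auto simp: field_simps)
    then show ?thesis using \<open>L < r\<close> by (intro that[of "(r - L) / 2"]) auto
  next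
    case top
    then show ?thesis by (intro that[of 1]) (auto simp: ennreal_less_top)
  qed
  show "\<forall>\<^sub>F n in F. W n < z"
    using assms(2)[OF e(1)] by eventually_elim (use e(2) in \<open>auto intro: le_less_trans\<close>)
qed

context random_trig_model
begin

text \<open>The window length \<open>1 / (4 * n)\<close> times the limiting density \<open>n / (\<pi> * sqrt 3)\<close>.\<close>

definition window_limit :: real where
  "window_limit = 1 / (4 * pi) * sqrt (1 / 3)"

lemma variance_window_stable:
  assumes n: "0 < n" and t: "t \<in> {0..1 / (4 * real n)}" and d: "0 \<le> d"
    and cov: "\<And>s. s \<in> {0..1 / (4 * real n)} \<Longrightarrow> \<bar>cov_fun n (x + s)\<bar> \<le> d"
  shows "\<bar>var_fun 0 n (x + t) - var_fun 0 n x\<bar> \<le> d / 2"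
proof -
  have "norm (var_fun 0 n (x + t) - var_fun 0 n x) \<le> (2 * real n * d) * norm (x + t - x)"
  proof (rule field_differentiable_bound[of "{x..x + t}"])
    show "(var_fun 0 n has_field_derivative 2 * real n * cov_fun n y) (at y within {x..x + t})" for y
      using var_fun_derivative by (rule has_field_derivative_at_within)
    show "norm (2 * real n * cov_fun n y) \<le> 2 * real n * d" if "y \<in> {x..x + t}" for y
      using cov[of "y - x"] that t by (simp add: abs_mult mult_left_mono)
  qed (use t in auto)
  also have "\<dots> = (2 * real n * d) * t" using t by simp
  also have "\<dots> \<le> (2 * real n * d) * (1 / (4 * real n))" using t d by (intro mult_left_mono) auto
  also have "\<dots> = d / 2" using n by simp
  finally show ?thesis by simp
qed

text \<open>Outside a small set \<open>S \<ge> \<kappa>\<close> at the left end point of the window, while \<open>C\<close> and \<open>V - c\<^sub>n S\<close> are at most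
  \<open>r * \<kappa>\<close> throughout it. Then \<open>V / S - (C / S)\<^sup>2\<close> is within \<open>\<delta>\<close> of \<open>1 / 3\<close>.\<close>

lemma window_zeros_good:
  assumes e: "0 < \<epsilon>" and b: "0 < \<beta>"
  shows "\<forall>\<^sub>F n in sequentially. \<exists>B\<in>sets borel. emeasure lborel B \<le> ennreal \<beta> \<and>
     (\<forall>x\<in>{-pi..pi} - B. ennreal (window_limit - \<epsilon>) \<le> window_zeros n x \<and> window_zeros n x \<le> ennreal (window_limit + \<epsilon>))"
proof -
  have "isCont sqrt (1 / 3)" by (intro continuous_intros)
  then obtain \<delta> where d: "0 < \<delta>" "\<And>q. \<bar>q - 1 / 3\<bar> < \<delta> \<Longrightarrow> \<bar>sqrt q - sqrt (1 / 3)\<bar> < 4 * pi * \<epsilon>"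
    using e unfolding continuous_at_eps_delta dist_real_def by (metis mult_pos_pos pi_gt_zero zero_less_numeral)
  \<comment> \<open>the measure of \<open>{S < 2 ^ (- (m + 1))}\<close> is one of the summands of \<open>tail_bound m\<close>\<close>
  have "(\<lambda>m. tail_bound m) \<longlonglongrightarrow> 0" using summable_tail_bound by (rule summable_LIMSEQ_zero)
  then have "\<forall>\<^sub>F m in sequentially. tail_bound m < \<beta> / 3" using b by (intro order_tendstoD) auto
  then obtain m where m: "tail_bound m < \<beta> / 3" by (auto simp: eventually_sequentially)
  define \<kappa> :: real where "\<kappa> = (1 / 2) ^ Suc m"
  have k0: "0 < \<kappa>" unfolding \<kappa>_def by simp
  \<comment> \<open>both \<open>V / S - c\<^sub>n\<close> and \<open>(C / S)\<^sup>2\<close> will be bounded by \<open>2 * r\<close>\<close>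
  define r where "r = min (1 / 2) (\<delta> / 8)"
  have r0: "0 < r" "r \<le> 1 / 2" "r \<le> \<delta> / 8" unfolding r_def using d by auto
  define z where "z = r * \<kappa>"
  have z0: "0 < z" "z \<le> \<kappa> / 2" unfolding z_def using r0 k0 by (auto simp: mult_right_mono)
  have b3: "0 < \<beta> / 3" using b by simp
  have mp: "\<forall>\<^sub>F n in sequentially. dist (mean_power 1 n) (1 / 3) < \<delta> / 4"
    by (rule tendstoD[OF mean_power_1_limit]) (use d in simp)
  show ?thesis
    using cov_fun_small[OF z0(1) b3] var_fun_ratio_small[OF z0(1) b3] mp eventually_gt_at_top[of 0]
  proof eventually_elim
    fix n
    assume C: "\<exists>B\<in>sets borel. emeasure lborel B \<le> ennreal (\<beta> / 3) \<and>
        (\<forall>x\<in>{-pi..pi} - B. \<forall>t\<in>{0..1 / (4 * real n)}. \<bar>cov_fun n (x + t)\<bar> \<le> z)"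
      and V: "\<exists>B\<in>sets borel. emeasure lborel B \<le> ennreal (\<beta> / 3) \<and>
        (\<forall>x\<in>{-pi..pi} - B. \<forall>t\<in>{0..1 / (4 * real n)}. \<bar>var_fun 1 n (x + t) - mean_power 1 n * var_fun 0 n (x + t)\<bar> \<le> z)"
      and mp: "dist (mean_power 1 n) (1 / 3) < \<delta> / 4" and n: "(0::nat) < n"
    obtain B1 where B1: "B1 \<in> sets borel" "emeasure lborel B1 \<le> ennreal (\<beta> / 3)"
       "\<And>x t. x \<in> {-pi..pi} - B1 \<Longrightarrow> t \<in> {0..1 / (4 * real n)} \<Longrightarrow> \<bar>cov_fun n (x + t)\<bar> \<le> z" using C by blast
    obtain B2 where B2: "B2 \<in> sets borel" "emeasure lborel B2 \<le> ennreal (\<beta> / 3)"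
       "\<And>x t. x \<in> {-pi..pi} - B2 \<Longrightarrow> t \<in> {0..1 / (4 * real n)} \<Longrightarrow> \<bar>var_fun 1 n (x + t) - mean_power 1 n * var_fun 0 n (x + t)\<bar> \<le> z" using V by blast
    define B3 where "B3 = {x \<in> {-pi..pi}. var_fun 0 n x < \<kappa>}"
    have B3m[measurable]: "B3 \<in> sets borel" unfolding B3_def by measurable
    have "emeasure lborel B3 \<le> ennreal (log_mass * (2 / (real (Suc m) * ln 2)) powr (1 + \<eta>))"
      unfolding B3_def \<kappa>_def by (rule small_variance_measure[OF n]) simp
    also have "\<dots> \<le> ennreal (\<beta> / 3)"
    proof (rule ennreal_leI)
      have "0 \<le> 2 * pi * sqrt (1 / 2) ^ Suc m" "0 \<le> 2 * pi * (1 / 4) ^ Suc m" by simp_all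
      then show "log_mass * (2 / (real (Suc m) * ln 2)) powr (1 + \<eta>) \<le> \<beta> / 3" using m unfolding tail_bound_def by linarith
    qed
    finally have B3: "emeasure lborel B3 \<le> ennreal (\<beta> / 3)" .
    show "\<exists>B\<in>sets borel. emeasure lborel B \<le> ennreal \<beta> \<and>
       (\<forall>x\<in>{-pi..pi} - B. ennreal (window_limit - \<epsilon>) \<le> window_zeros n x \<and> window_zeros n x \<le> ennreal (window_limit + \<epsilon>))"
    proof (intro bexI[of _ "B1 \<union> B2 \<union> B3"] conjI ballI)
      show "B1 \<union> B2 \<union> B3 \<in> sets borel" using B1 B2 by auto
      have "emeasure lborel (B1 \<union> B2 \<union> B3) \<le> emeasure lborel (B1 \<union> B2) + emeasure lborel B3"
        using B1 B2 by (intro emeasure_subadditive) auto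
      also have "\<dots> \<le> (emeasure lborel B1 + emeasure lborel B2) + emeasure lborel B3"
        using B1 B2 by (intro add_right_mono emeasure_subadditive) auto
      also have "\<dots> \<le> (ennreal (\<beta> / 3) + ennreal (\<beta> / 3)) + ennreal (\<beta> / 3)" by (intro add_mono B1 B2 B3)
      also have "\<dots> = ennreal \<beta>" using b by (simp add: ennreal_plus[symmetric] del: ennreal_plus)
      finally show "emeasure lborel (B1 \<union> B2 \<union> B3) \<le> ennreal \<beta>" .
      fix x assume x: "x \<in> {-pi..pi} - (B1 \<union> B2 \<union> B3)"
      define h where "h = 1 / (4 * real n)"
      have h0: "0 < h" unfolding h_def using n by simp
      have dens: "real n / pi * (sqrt (1 / 3) - 4 * pi * \<epsilon>) \<le> zero_density n (x + t) \<and> zero_density n (x + t) \<le> real n / pi * (sqrt (1 / 3) + 4 * pi * \<epsilon>)"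
        if t: "t \<in> {0..h}" for t
      proof -
        define S where "S = var_fun 0 n (x + t)"
        have cov: "\<bar>cov_fun n (x + t)\<bar> \<le> z" using B1(3) x t unfolding h_def by auto
        have "\<bar>S - var_fun 0 n x\<bar> \<le> z / 2"
          unfolding S_def using x t z0 B1(3) unfolding h_def by (intro variance_window_stable[OF n]) auto
        moreover have "\<kappa> \<le> var_fun 0 n x" using x unfolding B3_def by auto
        ultimately have S: "\<kappa> / 2 \<le> S" using z0 by linarith
        have S0: "0 < S" using S k0 by linarith
        have zS: "z / S \<le> 2 * r"
        proof -
          have "z / S \<le> z / (\<kappa> / 2)" using z0 k0 S by (intro divide_left_mono) auto
          then show ?thesis unfolding z_def using k0 by simp
        qed
        have "\<bar>var_fun 1 n (x + t) / S - mean_power 1 n\<bar> = \<bar>var_fun 1 n (x + t) - mean_power 1 n * S\<bar> / S"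
          using S0 by (simp add: field_simps abs_divide[symmetric])
        also have "\<dots> \<le> z / S" using B2(3) x t S0 unfolding S_def h_def by (intro divide_right_mono) auto
        finally have q1: "\<bar>var_fun 1 n (x + t) / S - mean_power 1 n\<bar> \<le> 2 * r" using zS by linarith
        have "\<bar>cov_fun n (x + t) / S\<bar> \<le> z / S" using cov S0 by (simp add: divide_right_mono)
        then have c1: "\<bar>cov_fun n (x + t) / S\<bar> \<le> 2 * r" using zS by linarith
        have "(cov_fun n (x + t) / S)\<^sup>2 = \<bar>cov_fun n (x + t) / S\<bar> * \<bar>cov_fun n (x + t) / S\<bar>" by (simp add: power2_eq_square abs_mult[symmetric])
        also have "\<dots> \<le> (2 * r) * 1" using c1 r0 by (intro mult_mono) auto
        finally have q2: "0 \<le> (cov_fun n (x + t) / S)\<^sup>2" "(cov_fun n (x + t) / S)\<^sup>2 \<le> 2 * r" by auto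
        have "\<bar>mean_power 1 n - 1 / 3\<bar> < \<delta> / 4" using mp by (simp add: dist_real_def)
        then have "\<bar>(var_fun 1 n (x + t) / S - (cov_fun n (x + t) / S)\<^sup>2) - 1 / 3\<bar> < \<delta>"
          using q1 q2 r0 by linarith
        then have "\<bar>sqrt (var_fun 1 n (x + t) / S - (cov_fun n (x + t) / S)\<^sup>2) - sqrt (1 / 3)\<bar> < 4 * pi * \<epsilon>" by (rule d(2))
        then have "sqrt (1 / 3) - 4 * pi * \<epsilon> \<le> sqrt (var_fun 1 n (x + t) / S - (cov_fun n (x + t) / S)\<^sup>2)"
          "sqrt (var_fun 1 n (x + t) / S - (cov_fun n (x + t) / S)\<^sup>2) \<le> sqrt (1 / 3) + 4 * pi * \<epsilon>" by linarith+
        then show ?thesis unfolding zero_density_def S_def[symmetric] by (intro conjI mult_left_mono) auto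
      qed
      have const: "(\<integral>\<^sup>+t. ennreal (real n / pi * y) * indicator {0..h} t \<partial>lborel) = ennreal (1 / (4 * pi) * y)" for y
      proof -
        have "(\<integral>\<^sup>+t. ennreal (real n / pi * y) * indicator {0..h} t \<partial>lborel) = ennreal (real n / pi * y) * ennreal h"
          using h0 by (simp add: nn_integral_cmult_indicator)
        also have "\<dots> = ennreal (real n / pi * y * h)" using h0 by (intro ennreal_mult''[symmetric]) simp
        also have "real n / pi * y * h = 1 / (4 * pi) * y" unfolding h_def using n by (simp add: field_simps)
        finally show ?thesis .
      qed
      have w: "1 / (4 * pi) * (sqrt (1 / 3) - 4 * pi * \<epsilon>) = window_limit - \<epsilon>" "1 / (4 * pi) * (sqrt (1 / 3) + 4 * pi * \<epsilon>) = window_limit + \<epsilon>"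
        unfolding window_limit_def by (simp_all add: right_diff_distrib distrib_left)
      have "(\<integral>\<^sup>+t. ennreal (real n / pi * (sqrt (1 / 3) - 4 * pi * \<epsilon>)) * indicator {0..h} t \<partial>lborel) \<le> window_zeros n x"
        unfolding window_zeros_def h_def[symmetric] using dens by (intro nn_integral_mono) (auto simp: indicator_def intro!: ennreal_leI)
      then show "ennreal (window_limit - \<epsilon>) \<le> window_zeros n x" unfolding const w .
      have "window_zeros n x \<le> (\<integral>\<^sup>+t. ennreal (real n / pi * (sqrt (1 / 3) + 4 * pi * \<epsilon>)) * indicator {0..h} t \<partial>lborel)"
        unfolding window_zeros_def h_def[symmetric] using dens by (intro nn_integral_mono) (auto simp: indicator_def intro!: ennreal_leI)
      then show "window_zeros n x \<le> ennreal (window_limit + \<epsilon>)" unfolding const w .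
    qed
  qed
qed

lemma window_limit_bounds: "0 \<le> window_limit" "window_limit \<le> 1"
proof -
  show "0 \<le> window_limit" unfolding window_limit_def by simp
  have "1 / (4 * pi) * sqrt (1 / 3) \<le> 1 * 1" using pi_ge_two by (intro mult_mono) (auto simp: field_simps)
  then show "window_limit \<le> 1" unfolding window_limit_def by simp
qed

text \<open>Typical windows give the limit up to \<open>\<epsilon>\<close>; the exceptional ones are negligible by uniform integrability.\<close>

lemma window_average_limit:
  "(\<lambda>n. \<integral>\<^sup>+x. window_zeros n x * indicator {-pi..pi} x \<partial>lborel) \<longlonglongrightarrow> ennreal (2 * pi * window_limit)"
proof (rule tendsto_ennreal_sandwich)
  show "0 \<le> 2 * pi * window_limit" using window_limit_bounds by simp
  fix e :: real assume e: "0 < e"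
  have "(\<lambda>K. \<Sum>i. tail_bound (i + K)) \<longlonglongrightarrow> 0" by (rule suminf_exist_split2[OF summable_tail_bound])
  then have "\<forall>\<^sub>F K in sequentially. (\<Sum>i. tail_bound (i + K)) < e / 3" using e by (intro order_tendstoD) auto
  then obtain K where K: "(\<Sum>i. tail_bound (i + K)) < e / 3" by (auto simp: eventually_sequentially)
  \<comment> \<open>\<open>K\<close> zeros in each window of a set of measure \<open>\<beta>\<close> contribute at most \<open>e / 3\<close>\<close>
  define \<beta> where "\<beta> = e / (3 * (real K + 1))"
  have b0: "0 < \<beta>" unfolding \<beta>_def using e by simp
  have bK: "real K * \<beta> \<le> e / 3" "\<beta> \<le> e / 3" unfolding \<beta>_def using e by (auto simp: field_simps)
  define \<epsilon> where "\<epsilon> = e / (6 * pi)"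
  have e0: "0 < \<epsilon>" unfolding \<epsilon>_def using e by simp
  have e2: "2 * pi * \<epsilon> = e / 3" unfolding \<epsilon>_def by simp
  show "\<forall>\<^sub>F n in sequentially. ennreal (2 * pi * window_limit - e) \<le> (\<integral>\<^sup>+x. window_zeros n x * indicator {-pi..pi} x \<partial>lborel) \<and>
      (\<integral>\<^sup>+x. window_zeros n x * indicator {-pi..pi} x \<partial>lborel) \<le> ennreal (2 * pi * window_limit + e)"
    using window_zeros_good[OF e0 b0] eventually_gt_at_top[of 0]
  proof eventually_elim
    fix n
    assume "\<exists>B\<in>sets borel. emeasure lborel B \<le> ennreal \<beta> \<and>
     (\<forall>x\<in>{-pi..pi} - B. ennreal (window_limit - \<epsilon>) \<le> window_zeros n x \<and> window_zeros n x \<le> ennreal (window_limit + \<epsilon>))" and n: "(0::nat) < n"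
    then obtain B where B: "B \<in> sets borel" "emeasure lborel B \<le> ennreal \<beta>"
      "\<And>x. x \<in> {-pi..pi} - B \<Longrightarrow> ennreal (window_limit - \<epsilon>) \<le> window_zeros n x"
      "\<And>x. x \<in> {-pi..pi} - B \<Longrightarrow> window_zeros n x \<le> ennreal (window_limit + \<epsilon>)" by blast
    have Bm[measurable]: "B \<in> sets borel" by fact
    have "(\<integral>\<^sup>+x. window_zeros n x * indicator {-pi..pi} x \<partial>lborel) \<le> (\<integral>\<^sup>+x. ennreal (window_limit + \<epsilon>) * indicator {-pi..pi} x + window_zeros n x * indicator (B \<inter> {-pi..pi}) x \<partial>lborel)"
      using B(4) by (intro nn_integral_mono) (auto simp: indicator_def)
    also have "\<dots> = ennreal (window_limit + \<epsilon>) * ennreal (2 * pi) + (\<integral>\<^sup>+x. window_zeros n x * indicator (B \<inter> {-pi..pi}) x \<partial>lborel)"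
      by (subst nn_integral_add, measurable, subst nn_integral_cmult_indicator) (simp_all add: emeasure_lborel_Icc_eq)
    also have "\<dots> \<le> ennreal (window_limit + \<epsilon>) * ennreal (2 * pi) + (of_nat K * ennreal \<beta> + ennreal (\<Sum>i. tail_bound (i + K)))"
      by (intro add_left_mono order_trans[OF window_zeros_uniformly_integrable[OF n Bm, of K]] add_right_mono mult_left_mono B(2)) simp
    also have "\<dots> \<le> ennreal (window_limit + \<epsilon>) * ennreal (2 * pi) + (ennreal (real K * \<beta>) + ennreal (e / 3))"
      using K b0 by (intro add_mono order_refl ennreal_leI) (auto simp: ennreal_mult ennreal_of_nat_eq_real_of_nat)
    also have "\<dots> = ennreal ((window_limit + \<epsilon>) * (2 * pi) + (real K * \<beta> + e / 3))"
      using window_limit_bounds e0 e b0 by (simp add: ennreal_mult[symmetric] ennreal_plus[symmetric] del: ennreal_plus)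
    also have "\<dots> \<le> ennreal (2 * pi * window_limit + e)"
      using bK(1) e2 by (intro ennreal_leI) (simp add: algebra_simps)
    finally have up: "(\<integral>\<^sup>+x. window_zeros n x * indicator {-pi..pi} x \<partial>lborel) \<le> ennreal (2 * pi * window_limit + e)" .
    have "ennreal (2 * pi * window_limit - e) \<le> ennreal ((window_limit - \<epsilon>) * (2 * pi) - max 0 (window_limit - \<epsilon>) * \<beta>)"
    proof (rule ennreal_leI)
      have "max 0 (window_limit - \<epsilon>) * \<beta> \<le> 1 * \<beta>" using window_limit_bounds e0 b0 by (intro mult_right_mono) auto
      then show "2 * pi * window_limit - e \<le> (window_limit - \<epsilon>) * (2 * pi) - max 0 (window_limit - \<epsilon>) * \<beta>"
        using bK(2) e2 e by (simp add: algebra_simps)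
    qed
    also have "\<dots> \<le> (\<integral>\<^sup>+x. window_zeros n x * indicator {-pi..pi} x \<partial>lborel)"
    proof -
      define W where "W = (\<integral>\<^sup>+x. window_zeros n x * indicator {-pi..pi} x \<partial>lborel)"
      define l where "l = max 0 (window_limit - \<epsilon>)"
      have l0: "0 \<le> l" unfolding l_def by simp
      have "ennreal l * ennreal (2 * pi) = (\<integral>\<^sup>+x. ennreal l * indicator {-pi..pi} x \<partial>lborel)"
        by (subst nn_integral_cmult_indicator) (simp_all add: emeasure_lborel_Icc_eq)
      also have "\<dots> \<le> (\<integral>\<^sup>+x. window_zeros n x * indicator {-pi..pi} x + ennreal l * indicator B x \<partial>lborel)"
        using B(3) by (intro nn_integral_mono) (auto simp: indicator_def l_def max_def ennreal_neg)
      also have "\<dots> = W + ennreal l * emeasure lborel B"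
        unfolding W_def by (subst nn_integral_add, measurable, subst nn_integral_cmult_indicator) simp_all
      also have "\<dots> \<le> W + ennreal l * ennreal \<beta>" by (intro add_left_mono mult_left_mono B(2)) simp
      finally have le: "ennreal (l * (2 * pi)) \<le> W + ennreal (l * \<beta>)" using l0 b0 by (simp add: ennreal_mult)
      have "ennreal (l * (2 * pi) - l * \<beta>) \<le> W"
      proof (cases W)
        case (real r)
        have "l * (2 * pi) \<le> r + l * \<beta>" using le unfolding real(2) using real(1) l0 b0 by (simp add: ennreal_plus[symmetric] del: ennreal_plus)
        then show ?thesis unfolding real(2) by (intro ennreal_leI) simp
      qed simp
      moreover have "(window_limit - \<epsilon>) * (2 * pi) \<le> l * (2 * pi)" unfolding l_def by (intro mult_right_mono) auto
      then have "ennreal ((window_limit - \<epsilon>) * (2 * pi) - l * \<beta>) \<le> ennreal (l * (2 * pi) - l * \<beta>)" by (intro ennreal_leI) simp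
      ultimately show ?thesis unfolding W_def l_def by (rule order_trans[rotated])
    qed
    finally show "ennreal (2 * pi * window_limit - e) \<le> (\<integral>\<^sup>+x. window_zeros n x * indicator {-pi..pi} x \<partial>lborel) \<and>
      (\<integral>\<^sup>+x. window_zeros n x * indicator {-pi..pi} x \<partial>lborel) \<le> ennreal (2 * pi * window_limit + e)" using up by (intro conjI)
  qed
qed

text \<open>Each point lies in the windows that start within \<open>1 / (4 * n)\<close> to its left, so by Tonelli and periodicity the
  window counts integrate to \<open>1 / (4 * n)\<close> times the total count.\<close>

lemma window_average_eq:
  assumes n: "0 < n"
  shows "(\<integral>\<^sup>+\<omega>. num_zeros (random_trig_poly a b n \<omega>) {0..2 * pi} / of_nat n \<partial>M) = 4 * (\<integral>\<^sup>+x. window_zeros n x * indicator {-pi..pi} x \<partial>lborel)"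
proof -
  define h where "h = 1 / (4 * real n)"
  have h0: "0 < h" "h \<le> 1" unfolding h_def using n by (auto simp: field_simps)
  define D where "D = (\<integral>\<^sup>+x. ennreal (zero_density n x) * indicator {-pi..pi} x \<partial>lborel)"
  obtain U where U: "U \<in> borel_measurable M" "AE \<omega> in M. num_zeros (random_trig_poly a b n \<omega>) {0..2 * pi} = U \<omega>"
    "(\<integral>\<^sup>+\<omega>. U \<omega> \<partial>M) = (\<integral>\<^sup>+x. ennreal (zero_density n x) * indicator {0..2 * pi} x \<partial>lborel)"
    by (rule expected_zeros[OF n, of 0 "2 * pi"]) auto
  have per: "(\<integral>\<^sup>+x. ennreal (zero_density n x) * indicator {0..2 * pi} x \<partial>lborel) = D"
  proof -
    have "(\<integral>\<^sup>+x. ennreal (zero_density n x) * indicator {-pi..-pi + 2 * pi} x \<partial>lborel) = (\<integral>\<^sup>+x. ennreal (zero_density n x) * indicator {0..0 + 2 * pi} x \<partial>lborel)"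
      by (rule nn_integral_period_aux) (auto simp: zero_density_periodic)
    then show ?thesis unfolding D_def by simp
  qed
  have "(\<integral>\<^sup>+\<omega>. num_zeros (random_trig_poly a b n \<omega>) {0..2 * pi} / of_nat n \<partial>M) = (\<integral>\<^sup>+\<omega>. U \<omega> / of_nat n \<partial>M)"
    by (rule nn_integral_cong_AE, use U(2) in eventually_elim) simp
  also have "\<dots> = D / of_nat n" unfolding nn_integral_divide[OF U(1)] U(3) per ..
  finally have L: "(\<integral>\<^sup>+\<omega>. num_zeros (random_trig_poly a b n \<omega>) {0..2 * pi} / of_nat n \<partial>M) = D / of_nat n" .
  have "(\<integral>\<^sup>+x. window_zeros n x * indicator {-pi..pi} x \<partial>lborel) = (\<integral>\<^sup>+x. (\<integral>\<^sup>+t. ennreal (zero_density n (x + t)) * indicator {0..h} t * indicator {-pi..pi} x \<partial>lborel) \<partial>lborel)"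
    unfolding window_zeros_def h_def by (intro nn_integral_cong nn_integral_multc[symmetric]) measurable
  also have "\<dots> = (\<integral>\<^sup>+t. (\<integral>\<^sup>+x. ennreal (zero_density n (x + t)) * indicator {0..h} t * indicator {-pi..pi} x \<partial>lborel) \<partial>lborel)"
    by (rule lborel_pair.Fubini') measurable
  also have "\<dots> = (\<integral>\<^sup>+t. D * indicator {0..h} t \<partial>lborel)"
  proof (intro nn_integral_cong)
    fix t
    show "(\<integral>\<^sup>+x. ennreal (zero_density n (x + t)) * indicator {0..h} t * indicator {-pi..pi} x \<partial>lborel) = D * indicator {0..h} t"
    proof (cases "t \<in> {0..h}")
      case True
      have "(\<integral>\<^sup>+x. ennreal (zero_density n (x + t)) * indicator {-pi..-pi + 2 * pi} x \<partial>lborel) = (\<integral>\<^sup>+x. ennreal (zero_density n x) * indicator {-pi..-pi + 2 * pi} x \<partial>lborel)"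
        by (rule nn_integral_period_shift) (use True h0 pi_ge_two in \<open>auto simp: zero_density_periodic\<close>)
      then show ?thesis using True unfolding D_def by simp
    qed simp
  qed
  also have "\<dots> = D * ennreal h" using h0 by (simp add: nn_integral_cmult_indicator)
  finally have R: "(\<integral>\<^sup>+x. window_zeros n x * indicator {-pi..pi} x \<partial>lborel) = D * ennreal h" .
  have "4 * (D * ennreal h) = D * (ennreal 4 * ennreal h)" by (simp add: mult_ac)
  also have "ennreal 4 * ennreal h = ennreal (1 / real n)" unfolding h_def by (subst ennreal_mult[symmetric]) auto
  also have "D * ennreal (1 / real n) = D / of_nat n"
    using n by (simp add: divide_ennreal_def ennreal_of_nat_eq_real_of_nat inverse_ennreal inverse_eq_divide)
  finally show ?thesis unfolding L R ..
qed

theorem expected_zeros_limit: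
  "(\<lambda>n. \<integral>\<^sup>+\<omega>. num_zeros (random_trig_poly a b n \<omega>) {0..2 * pi} / of_nat n \<partial>M) \<longlonglongrightarrow> ennreal (2 / sqrt 3)"
proof -
  have "(\<lambda>n. 4 * (\<integral>\<^sup>+x. window_zeros n x * indicator {-pi..pi} x \<partial>lborel)) \<longlonglongrightarrow> 4 * ennreal (2 * pi * window_limit)"
    by (intro ennreal_tendsto_cmult window_average_limit) (simp add: ennreal_less_top)
  also have "4 * ennreal (2 * pi * window_limit) = ennreal (4 * (2 * pi * window_limit))"
    by (subst ennreal_mult') (simp_all only: ennreal_numeral zero_le_numeral)
  also have "4 * (2 * pi * window_limit) = 2 / sqrt 3"
    unfolding window_limit_def by (simp add: real_sqrt_divide)
  finally show ?thesis
    by (rule Lim_transform_eventually) (rule eventually_mono[OF eventually_gt_at_top[of 0]], rule window_average_eq[symmetric])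
qed

end

section \<open>From Gaussian sequences to the model\<close>

lemma (in prob_space) gaussian_rv_moments:
  assumes g: "gaussian_rv M X" and mean: "expectation X = 0"
  shows "integrable M X" "integrable M (\<lambda>\<omega>. (X \<omega>)\<^sup>2)"
    and "(CLINT \<omega>|M. iexp (X \<omega>)) = of_real (exp (- expectation (\<lambda>\<omega>. (X \<omega>)\<^sup>2) / 2))"
proof -
  have Xm[measurable]: "X \<in> borel_measurable M" using g by (simp add: gaussian_rv_def)
  consider (deg) m where "AE \<omega> in M. X \<omega> = m" | (nondeg) m \<sigma> where "0 < \<sigma>" "distributed M lborel X (\<lambda>x. ennreal (normal_density m \<sigma> x))"
    using g unfolding gaussian_rv_def by blast
  then have "integrable M X \<and> integrable M (\<lambda>\<omega>. (X \<omega>)\<^sup>2) \<and> (CLINT \<omega>|M. iexp (X \<omega>)) = of_real (exp (- expectation (\<lambda>\<omega>. (X \<omega>)\<^sup>2) / 2))"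
  proof cases
    case deg
    have "expectation X = expectation (\<lambda>_. m)" by (rule integral_cong_AE) (use deg in auto)
    then have "m = 0" using mean by (simp add: prob_space)
    then have z: "AE \<omega> in M. X \<omega> = 0" using deg by simp
    have i1: "integrable M X" by (subst integrable_cong_AE[where g="\<lambda>_. 0"]) (use z in auto)
    have i2: "integrable M (\<lambda>\<omega>. (X \<omega>)\<^sup>2)" by (subst integrable_cong_AE[where g="\<lambda>_. 0"]) (use z in auto)
    have e2: "expectation (\<lambda>\<omega>. (X \<omega>)\<^sup>2) = expectation (\<lambda>_. 0)" by (rule integral_cong_AE) (use z in auto)
    have "(CLINT \<omega>|M. iexp (X \<omega>)) = (CLINT \<omega>|M. 1)" by (rule integral_cong_AE) (use z in auto)
    then show ?thesis using i1 i2 e2 by (simp add: prob_space)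
  next
    case nondeg
    have "m = 0" using normal_distributed_expectation[OF nondeg] mean by simp
    then have D: "distributed M lborel X (\<lambda>x. ennreal (normal_density 0 \<sigma> x))" using nondeg by simp
    have i1: "integrable M X"
      using distributed_integrable[OF D, of "\<lambda>x. x"] integrable_normal_moment[OF nondeg(1), of 0 1] by simp
    have i2: "integrable M (\<lambda>\<omega>. (X \<omega>)\<^sup>2)"
      using distributed_integrable[OF D, of "\<lambda>x. x\<^sup>2"] integrable_normal_moment[OF nondeg(1), of 0 2] by simp
    have v: "expectation (\<lambda>\<omega>. (X \<omega>)\<^sup>2) = \<sigma>\<^sup>2"
      using normal_distributed_variance[OF nondeg(1) D] mean by simp
    have S: "distributed M lborel (\<lambda>\<omega>. (X \<omega> - 0) / \<sigma>) std_normal_density"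
      using D nondeg(1) by (subst (asm) normal_standard_normal_convert) auto
    have "(CLINT \<omega>|M. iexp (X \<omega>)) = (CLINT \<omega>|M. iexp (\<sigma> * ((X \<omega> - 0) / \<sigma>)))" using nondeg(1) by simp
    also have "\<dots> = (CLINT x|distr M lborel (\<lambda>\<omega>. (X \<omega> - 0) / \<sigma>). iexp (\<sigma> * x))"
      by (subst integral_distr) auto
    also have "distr M lborel (\<lambda>\<omega>. (X \<omega> - 0) / \<sigma>) = std_normal_distribution" using S by (simp add: distributed_def)
    also have "(CLINT x|std_normal_distribution. iexp (\<sigma> * x)) = of_real (exp (- (\<sigma>\<^sup>2) / 2))"
      using fun_cong[OF char_std_normal_distribution, of \<sigma>] unfolding char_def by simp
    finally show ?thesis using i1 i2 v by simp
  qed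
  then show "integrable M X" "integrable M (\<lambda>\<omega>. (X \<omega>)\<^sup>2)"
    "(CLINT \<omega>|M. iexp (X \<omega>)) = of_real (exp (- expectation (\<lambda>\<omega>. (X \<omega>)\<^sup>2) / 2))" by auto
qed

lemma (in prob_space) gaussian_seq_char:
  assumes s: "stationary_gaussian_seq M r X" and r: "\<And>k l. 1 \<le> k \<Longrightarrow> 1 \<le> l \<Longrightarrow> Re (r \<bar>int k - int l\<bar>) = C k l"
  shows "\<And>k. 1 \<le> k \<Longrightarrow> X k \<in> borel_measurable M"
    and "(CLINT \<omega>|M. iexp (\<Sum>k=1..n. c k * X k \<omega>)) = of_real (exp (- (\<Sum>k=1..n. \<Sum>l=1..n. c k * c l * C k l) / 2))"
proof -
  have gp: "gaussian_rv M (\<lambda>\<omega>. \<Sum>j\<in>J. c j * X j \<omega>)" if "finite J" "J \<subseteq> {1..}" for J c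
    using s that unfolding stationary_gaussian_seq_def gaussian_process_def by blast
  have g: "gaussian_rv M (X k)" if "1 \<le> k" for k using gp[of "{k}" "\<lambda>_. 1"] that by simp
  have m: "expectation (X k) = 0" if "1 \<le> k" for k using s that unfolding stationary_gaussian_seq_def by blast
  show Xm: "X k \<in> borel_measurable M" if "1 \<le> k" for k using g[OF that] by (simp add: gaussian_rv_def)
  have cov: "expectation (\<lambda>\<omega>. X k \<omega> * X l \<omega>) = C k l" if "1 \<le> k" "1 \<le> l" for k l
  proof -
    have "complex_of_real (expectation (\<lambda>\<omega>. X k \<omega> * X l \<omega>)) = r \<bar>int k - int l\<bar>" using s that unfolding stationary_gaussian_seq_def by blast
    then show ?thesis using r[OF that] by (metis Re_complex_of_real)
  qed
  have i1: "integrable M (X k)" if "1 \<le> k" for k by (rule gaussian_rv_moments(1)[OF g[OF that] m[OF that]])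
  have i2: "integrable M (\<lambda>\<omega>. X k \<omega> * X l \<omega>)" if "1 \<le> k" "1 \<le> l" for k l
  proof (rule Bochner_Integration.integrable_bound)
    show "integrable M (\<lambda>\<omega>. (X k \<omega>)\<^sup>2 + (X l \<omega>)\<^sup>2)"
      using gaussian_rv_moments(2)[OF g m] that by (intro Bochner_Integration.integrable_add) auto
    show "(\<lambda>\<omega>. X k \<omega> * X l \<omega>) \<in> borel_measurable M" using Xm that by (intro borel_measurable_times)
    show "AE \<omega> in M. norm (X k \<omega> * X l \<omega>) \<le> norm ((X k \<omega>)\<^sup>2 + (X l \<omega>)\<^sup>2)"
    proof (rule AE_I2)
      fix \<omega>
      have "2 * (\<bar>X k \<omega>\<bar> * \<bar>X l \<omega>\<bar>) \<le> (X k \<omega>)\<^sup>2 + (X l \<omega>)\<^sup>2" using sum_squares_bound[of "\<bar>X k \<omega>\<bar>" "\<bar>X l \<omega>\<bar>"] by simp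
      moreover have "0 \<le> \<bar>X k \<omega>\<bar> * \<bar>X l \<omega>\<bar>" by simp
      ultimately have "\<bar>X k \<omega>\<bar> * \<bar>X l \<omega>\<bar> \<le> (X k \<omega>)\<^sup>2 + (X l \<omega>)\<^sup>2" by linarith
      then show "norm (X k \<omega> * X l \<omega>) \<le> norm ((X k \<omega>)\<^sup>2 + (X l \<omega>)\<^sup>2)" by (simp add: abs_mult)
    qed
  qed
  define Y where "Y \<omega> = (\<Sum>k=1..n. c k * X k \<omega>)" for \<omega>
  have gY: "gaussian_rv M Y" unfolding Y_def by (rule gp) auto
  have EY: "expectation Y = 0"
  proof -
    have "expectation Y = (\<Sum>k=1..n. expectation (\<lambda>\<omega>. c k * X k \<omega>))"
      unfolding Y_def by (rule Bochner_Integration.integral_sum) (use i1 in auto)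
    also have "\<dots> = 0" by (intro sum.neutral ballI) (use m in auto)
    finally show ?thesis .
  qed
  have EY2: "expectation (\<lambda>\<omega>. (Y \<omega>)\<^sup>2) = (\<Sum>k=1..n. \<Sum>l=1..n. c k * c l * C k l)"
  proof -
    have "(Y \<omega>)\<^sup>2 = (\<Sum>k=1..n. \<Sum>l=1..n. c k * c l * (X k \<omega> * X l \<omega>))" for \<omega>
      unfolding Y_def power2_eq_square sum_product by (intro sum.cong refl) (simp add: mult_ac)
    then have "expectation (\<lambda>\<omega>. (Y \<omega>)\<^sup>2) = expectation (\<lambda>\<omega>. \<Sum>k=1..n. \<Sum>l=1..n. c k * c l * (X k \<omega> * X l \<omega>))" by (simp only:)
    also have "\<dots> = (\<Sum>k=1..n. \<Sum>l=1..n. c k * c l * expectation (\<lambda>\<omega>. X k \<omega> * X l \<omega>))"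
      using i2 by (subst Bochner_Integration.integral_sum, force intro: Bochner_Integration.integrable_sum,
        intro sum.cong refl, subst Bochner_Integration.integral_sum, force, simp)
    also have "\<dots> = (\<Sum>k=1..n. \<Sum>l=1..n. c k * c l * C k l)" by (intro sum.cong refl) (use cov in auto)
    finally show ?thesis .
  qed
  show "(CLINT \<omega>|M. iexp (\<Sum>k=1..n. c k * X k \<omega>)) = of_real (exp (- (\<Sum>k=1..n. \<Sum>l=1..n. c k * c l * C k l) / 2))"
    using gaussian_rv_moments(3)[OF gY EY] unfolding EY2 unfolding Y_def .
qed

lemma (in prob_space) indep_seqs_linear:
  assumes ind: "indep_seqs M X Y"
  shows "indep_var borel (\<lambda>\<omega>. \<Sum>k=1..n. c k * X k \<omega>) borel (\<lambda>\<omega>. \<Sum>k=1..n. d k * Y k \<omega>)"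
proof -
  have meas: "(\<lambda>z. \<Sum>k=1..n. c k * z k) \<in> measurable (\<Pi>\<^sub>M k\<in>{1..}. borel) borel" for c :: "nat \<Rightarrow> real"
    by (intro borel_measurable_sum borel_measurable_times borel_measurable_const measurable_component_singleton) auto
  have "indep_var borel ((\<lambda>z. \<Sum>k=1..n. c k * z k) \<circ> (\<lambda>\<omega>. \<lambda>k\<in>{1..}. X k \<omega>)) borel ((\<lambda>z. \<Sum>k=1..n. d k * z k) \<circ> (\<lambda>\<omega>. \<lambda>k\<in>{1..}. Y k \<omega>))"
    using ind unfolding indep_seqs_def by (intro indep_var_compose[OF _ meas meas])
  moreover have "((\<lambda>z. \<Sum>k=1..n. c k * z k) \<circ> (\<lambda>\<omega>. \<lambda>k\<in>{1..}. X k \<omega>)) = (\<lambda>\<omega>. \<Sum>k=1..n. c k * X k \<omega>)" for c and X :: "nat \<Rightarrow> 'a \<Rightarrow> real"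
    by (intro ext) (auto intro!: sum.cong)
  ultimately show ?thesis by simp
qed

theorem theorem1p3:
  fixes M :: "'a measure"
    and a b :: "nat \<Rightarrow> 'a \<Rightarrow> real"
    and \<mu> \<mu>s :: "real measure"
    and \<psi> :: "real \<Rightarrow> real"
    and \<eta> :: real
  assumes "prob_space M"
    and "symmetric_spectral_measure \<mu>"
    and "stationary_gaussian_seq M (spectral_corr \<mu>) a"
    and "stationary_gaussian_seq M (spectral_corr \<mu>) b"
    and "indep_seqs M a b"
    and "spectral_decomposition \<mu> \<mu>s \<psi>"
    and "0 < \<eta>" and "\<eta> < 1"
    and "log_in_Lp \<psi> (1 + \<eta>) 0 (2 * pi)"
  shows "(\<lambda>n. \<integral>\<^sup>+\<omega>. num_zeros (random_trig_poly a b n \<omega>) {0..2 * pi} / of_nat n \<partial>M)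
           \<longlonglongrightarrow> ennreal (2 / sqrt 3)"
proof -
  interpret P: prob_space M by fact
  interpret decomposed_measure \<mu> \<mu>s \<psi>
    using assms(2,6) unfolding symmetric_spectral_measure_def decomposed_measure_def decomposed_measure_axioms_def by auto
  have int: "integrable \<mu> (\<lambda>x. exp (- \<i> * of_int k * complex_of_real x))" for k
    by (rule integrable_const_bound[of _ 1]) auto
  have Rec: "Re (spectral_corr \<mu> k) = (\<integral>u. cos (of_int k * u) \<partial>\<mu>)" for k
    unfolding spectral_corr_def using int[of k] by (subst integral_Re[symmetric]) (auto simp: Re_exp)
  have Imc: "Im (spectral_corr \<mu> k) = - (\<integral>u. sin (of_int k * u) \<partial>\<mu>)" for k
    unfolding spectral_corr_def using int[of k] by (subst integral_Im[symmetric]) (auto simp: Im_exp)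
  \<comment> \<open>covariances are real numbers, so the imaginary part of the correlation function vanishes\<close>
  have sine: "(\<integral>u. sin ((real k - real l) * u) \<partial>\<mu>) = 0" for k l :: nat
  proof -
    have "complex_of_real (\<integral>\<omega>. a (Suc k) \<omega> * a (Suc l) \<omega> \<partial>M) = spectral_corr \<mu> \<bar>int (Suc k) - int (Suc l)\<bar>"
      using assms(3) unfolding stationary_gaussian_seq_def by auto
    then have "Im (spectral_corr \<mu> \<bar>int k - int l\<bar>) = 0" by (metis Im_complex_of_real of_nat_Suc add_diff_cancel_left)
    then have z: "(\<integral>u. sin (of_int \<bar>int k - int l\<bar> * u) \<partial>\<mu>) = 0" unfolding Imc by simp
    show ?thesis
    proof (cases "l \<le> k")
      case True
      then have "real_of_int \<bar>int k - int l\<bar> = real k - real l" by simp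
      then show ?thesis using z by simp
    next
      case False
      then have e: "real_of_int \<bar>int k - int l\<bar> = - (real k - real l)" by simp
      show ?thesis using z unfolding e mult_minus_left sin_minus by simp
    qed
  qed
  have corr: "Re (spectral_corr \<mu> \<bar>int k - int l\<bar>) = (\<integral>u. cos ((real k - real l) * u) \<partial>\<mu>)" for k l :: nat
  proof -
    have "cos (of_int \<bar>int k - int l\<bar> * u) = cos ((real k - real l) * u)" for u :: real
    proof (cases "l \<le> k")
      case True
      then have "real_of_int \<bar>int k - int l\<bar> = real k - real l" by simp
      then show ?thesis by simp
    next
      case False
      then have e: "real_of_int \<bar>int k - int l\<bar> = - (real k - real l)" by simp
      show ?thesis unfolding e mult_minus_left cos_minus ..
    qed
    then show ?thesis unfolding Rec by simp
  qed
  have shift: "(\<integral>\<^sup>+x. f x * indicator {-pi..pi} x \<partial>lborel) = (\<integral>\<^sup>+x. f x * indicator {0..2 * pi} x \<partial>lborel)"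
    if "f \<in> borel_measurable borel" "\<And>x. f (x + 2 * pi) = f x" for f :: "real \<Rightarrow> ennreal"
  proof -
    have "(\<integral>\<^sup>+x. f x * indicator {-pi..-pi + 2 * pi} x \<partial>lborel) = (\<integral>\<^sup>+x. f x * indicator {0..0 + 2 * pi} x \<partial>lborel)"
      by (rule nn_integral_period_aux) (use that in auto)
    then show ?thesis by simp
  qed
  have psi_pos: "AE x in lborel. x \<in> {-pi..pi} \<longrightarrow> 0 < \<psi> x"
  proof -
    have "(\<integral>\<^sup>+x. indicator {x. \<psi> x \<le> 0} x * indicator {0..2 * pi} x \<partial>lborel) = 0"
      using assms(9) unfolding log_in_Lp_def
      by (subst nn_integral_0_iff_AE) (auto elim!: eventually_mono simp: indicator_def)
    then have "(\<integral>\<^sup>+x. indicator {x. \<psi> x \<le> 0} x * indicator {-pi..pi} x \<partial>lborel) = 0"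
      by (subst shift) (auto simp: psi_periodic indicator_def)
    then show ?thesis
      by (subst (asm) nn_integral_0_iff_AE) (auto elim!: eventually_mono simp: indicator_def split: if_splits)
  qed
  have log_int: "(\<integral>\<^sup>+x. ennreal (\<bar>ln (\<psi> x)\<bar> powr (1 + \<eta>)) * indicator {-pi..pi} x \<partial>lborel) < \<infinity>"
  proof -
    have "integrable lborel (\<lambda>x. indicator {0..2 * pi} x * \<bar>ln (\<psi> x)\<bar> powr (1 + \<eta>))"
      using assms(9) unfolding log_in_Lp_def set_integrable_def by simp
    then have "(\<integral>\<^sup>+x. ennreal (norm (indicator {0..2 * pi} x * \<bar>ln (\<psi> x)\<bar> powr (1 + \<eta>))) \<partial>lborel) < \<infinity>"
      by (simp add: integrable_iff_bounded)
    also have "(\<integral>\<^sup>+x. ennreal (norm (indicator {0..2 * pi} x * \<bar>ln (\<psi> x)\<bar> powr (1 + \<eta>))) \<partial>lborel) = (\<integral>\<^sup>+x. ennreal (\<bar>ln (\<psi> x)\<bar> powr (1 + \<eta>)) * indicator {0..2 * pi} x \<partial>lborel)"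
      by (intro nn_integral_cong) (auto simp: indicator_def)
    finally show ?thesis by (subst shift) (auto simp: psi_periodic)
  qed
  interpret spectral_model \<mu> \<mu>s \<psi> \<eta>
    by unfold_locales (use sine assms(7) psi_pos log_int in auto)
  have re_corr: "Re (spectral_corr \<mu> \<bar>int k - int l\<bar>) = corr k l" for k l unfolding corr corr_def ..
  have am: "a k \<in> borel_measurable M" if "1 \<le> k" for k by (rule P.gaussian_seq_char(1)[OF assms(3) re_corr that])
  have bm: "b k \<in> borel_measurable M" if "1 \<le> k" for k by (rule P.gaussian_seq_char(1)[OF assms(4) re_corr that])
  have jc: "(CLINT \<omega>|M. iexp (\<Sum>k=1..n. c k * a k \<omega> + d k * b k \<omega>)) =
      of_real (exp (- (\<Sum>k=1..n. \<Sum>l=1..n. (c k * c l + d k * d l) * corr k l) / 2))" for n c d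
  proof -
    define A where "A \<omega> = (\<Sum>k=1..n. c k * a k \<omega>)" for \<omega>
    define B where "B \<omega> = (\<Sum>k=1..n. d k * b k \<omega>)" for \<omega>
    have ind: "P.indep_var borel A borel B" unfolding A_def B_def by (rule P.indep_seqs_linear[OF assms(5)])
    have Am[measurable]: "A \<in> borel_measurable M" and Bm[measurable]: "B \<in> borel_measurable M"
      using P.indep_var_rv1[OF ind] P.indep_var_rv2[OF ind] by auto
    have "(CLINT \<omega>|M. iexp (A \<omega> + B \<omega>)) = char (distr M borel (\<lambda>\<omega>. A \<omega> + B \<omega>)) 1"
      unfolding char_def by (subst integral_distr) auto
    also have "\<dots> = char (distr M borel A) 1 * char (distr M borel B) 1"
      by (rule P.char_distr_add[OF ind])
    also have "char (distr M borel A) 1 = (CLINT \<omega>|M. iexp (A \<omega>))"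
      unfolding char_def by (subst integral_distr) auto
    also have "char (distr M borel B) 1 = (CLINT \<omega>|M. iexp (B \<omega>))"
      unfolding char_def by (subst integral_distr) auto
    also have "(CLINT \<omega>|M. iexp (A \<omega>)) = of_real (exp (- (\<Sum>k=1..n. \<Sum>l=1..n. c k * c l * corr k l) / 2))"
      unfolding A_def by (rule P.gaussian_seq_char(2)[OF assms(3) re_corr])
    also have "(CLINT \<omega>|M. iexp (B \<omega>)) = of_real (exp (- (\<Sum>k=1..n. \<Sum>l=1..n. d k * d l * corr k l) / 2))"
      unfolding B_def by (rule P.gaussian_seq_char(2)[OF assms(4) re_corr])
    also have "of_real (exp (- (\<Sum>k=1..n. \<Sum>l=1..n. c k * c l * corr k l) / 2)) * of_real (exp (- (\<Sum>k=1..n. \<Sum>l=1..n. d k * d l * corr k l) / 2))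
       = complex_of_real (exp (- (\<Sum>k=1..n. \<Sum>l=1..n. (c k * c l + d k * d l) * corr k l) / 2))"
      unfolding of_real_mult[symmetric] exp_add[symmetric] by (simp add: distrib_right sum.distrib add_divide_distrib)
    finally show ?thesis unfolding A_def B_def sum.distrib[symmetric] .
  qed
  interpret random_trig_model \<mu> \<mu>s \<psi> \<eta> M a b
    by unfold_locales (use am bm jc in auto)
  show ?thesis by (rule expected_zeros_limit)
qed

end
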